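(* Let $d\ge 1$, $0\le\lambda<1$, and let $(X_m)_{m=0}^\infty$ be the biased random walk $\mathrm{RW}_\lambda$ on $\mathbb{Z}^d$ starting at $x$, where $x\in\mathbb{Z}^d$ is arbitrary; write $X_m=(X_m^1,\dots,X_m^d)$. Put $v=\left(\frac{1-\lambda}{d(1+\lambda)},\dots,\frac{1-\lambda}{d(1+\lambda)}\right)\in\mathbb{R}^d$ and $\rho_\lambda=\frac{2\sqrt{\lambda}}{1+\lambda}$. Then, on the Skorohod space $D([0,\infty),\mathbb{R}^d)$, the process $$\left(\frac{\left(|X^1_{\lfloor nt\rfloor}|,\dots,|X^d_{\lfloor nt\rfloor}|\right)-nvt}{\sqrt n}\right)_{t\ge 0}$$ converges in distribution, as $n\to\infty$, to $\left(\frac{1}{\sqrt d}\left[I-\frac{1-\rho_\lambda}{d}E\right]W_t\right)_{t\ge0}$, where $(W_t)_{t\ge 0}$ is the $d$-dimensional Brownian motion starting at $\mathbf{0}$, $I$ is the $d\times d$ identity matrix and $E$ is the $d\times d$ matrix all of whose entries equal $1$. In particular, $$\frac{(|X_n^1|,\dots,|X_n^d|)-nv}{\sqrt n}\to\mathcal{N}(\mathbf{0},\Sigma)$$ in distribution as $n\to\infty$, where $\Sigma=(\Sigma_{ij})_{1\le i,j\le d}$ with $\Sigma_{ii}=\frac1d-\frac{(1-\lambda)^2}{d^2(1+\lambda)^2}$ and $\Sigma_{ij}=-\frac{(1-\lambda)^2}{d^2(1+\lambda)^2}$ for $i\ne j$.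
   Context: For $x=(x_1,\dots,x_d)\in\mathbb{Z}^d$ let $|x|=\sum_{i=1}^d|x_i|$ and $\mathbf{0}=(0,\dots,0)$. The biased random walk $\mathrm{RW}_\lambda$ ($\lambda\ge0$) on $\mathbb{Z}^d$ is the nearest-neighbour Markov chain $(X_n)_{n\ge0}$ with the following transition probabilities $p(v,u)$ for $u$ a nearest neighbour of $v$ (and $p(v,u)=0$ otherwise): $p(\mathbf{0},u)=\frac1{2d}$; and for $v\neq\mathbf{0}$, $p(v,u)=\frac{\lambda}{2d+(\lambda-1)d_v^-}$ if $|u|=|v|-1$, and $p(v,u)=\frac{1}{2d+(\lambda-1)d_v^-}$ if $|u|=|v|+1$. Here $d_v^-$ is the number of neighbours $u$ of $v$ with $|u|=|v|-1$, i.e. $d_v^-=d-\kappa(v)$ with $\kappa(v)=\#\{i: v_i=0\}$. $\mathcal{N}(\mathbf{0},A)$ denotes the (possibly degenerate) centred Gaussian law on $\mathbb{R}^d$ with covariance matrix $A$; $\lfloor a\rfloor$ is the integer part of $a$. *)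

theory Defs
  imports "HOL-Probability.Probability"
begin

section \<open>The biased random walk on the integer lattice\<close>

definition norm1 :: "int ^ 'd \<Rightarrow> int" where
  "norm1 x = (\<Sum>i\<in>UNIV. \<bar>x $ i\<bar>)"

definition neighbours :: "int ^ 'd \<Rightarrow> (int ^ 'd) set" where
  "neighbours v = {u. norm1 (u - v) = 1}"

definition deg_minus :: "int ^ 'd \<Rightarrow> nat" where
  "deg_minus v = card {u \<in> neighbours v. norm1 u = norm1 v - 1}"

definition rw_prob :: "real \<Rightarrow> int ^ 'd \<Rightarrow> int ^ 'd \<Rightarrow> real" where
  "rw_prob lam v u =
     (if u \<notin> neighbours v then 0
      else if v = 0 then 1 / (2 * real CARD('d))
      else if norm1 u = norm1 v - 1
        then lam / (2 * real CARD('d) + (lam - 1) * real (deg_minus v))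
      else 1 / (2 * real CARD('d) + (lam - 1) * real (deg_minus v)))"

definition biased_random_walk ::
  "real \<Rightarrow> int ^ 'd \<Rightarrow> 'a measure \<Rightarrow> (nat \<Rightarrow> 'a \<Rightarrow> int ^ 'd) \<Rightarrow> bool" where
  "biased_random_walk lam x M X \<longleftrightarrow>
     prob_space M \<and>
     (\<forall>n. X n \<in> measurable M (count_space UNIV)) \<and>
     (AE \<omega> in M. X 0 \<omega> = x) \<and>
     (\<forall>n path u. \<P>(\<omega> in M. \<forall>i\<le>n. X i \<omega> = path i) \<noteq> 0 \<longrightarrow>
        \<P>(\<omega> in M. X (Suc n) \<omega> = u \<bar> \<forall>i\<le>n. X i \<omega> = path i) = rw_prob lam (path n) u)"

definition abs_vec :: "int ^ 'd \<Rightarrow> real ^ 'd" where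
  "abs_vec x = (\<chi> i. real_of_int \<bar>x $ i\<bar>)"


section \<open>Convergence in distribution\<close>

definition borel_of :: "'b topology \<Rightarrow> 'b measure" where
  "borel_of T = sigma (topspace T) {U. openin T U}"

definition weakly_converges :: "'b topology \<Rightarrow> (nat \<Rightarrow> 'b measure) \<Rightarrow> 'b measure \<Rightarrow> bool" where
  "weakly_converges T \<mu> \<nu> \<longleftrightarrow>
     (\<forall>n. prob_space (\<mu> n) \<and> sets (\<mu> n) = sets (borel_of T)) \<and>
     prob_space \<nu> \<and> sets \<nu> = sets (borel_of T) \<and>
     (\<forall>f :: 'b \<Rightarrow> real. continuous_map T euclideanreal f \<and> bounded (f ` topspace T) \<longrightarrow>
        (\<lambda>n. integral\<^sup>L (\<mu> n) f) \<longlonglongrightarrow> integral\<^sup>L \<nu> f)"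

definition converges_in_distribution ::
  "'b topology \<Rightarrow> 'a measure \<Rightarrow> (nat \<Rightarrow> 'a \<Rightarrow> 'b) \<Rightarrow> 'w measure \<Rightarrow> ('w \<Rightarrow> 'b) \<Rightarrow> bool" where
  "converges_in_distribution T M Y N Z \<longleftrightarrow>
     (\<forall>n. Y n \<in> measurable M (borel_of T)) \<and> Z \<in> measurable N (borel_of T) \<and>
     weakly_converges T (\<lambda>n. distr M (borel_of T) (Y n)) (distr N (borel_of T) Z)"


section \<open>Skorohod space\<close>

text \<open>
  Paths are functions on \<open>[0,\<infinity>)\<close>, encoded as functions on the reals that are extensional
  on \<open>{0..}\<close>, so that a path has exactly one representative.
\<close>

definition skorohod_space :: "(real \<Rightarrow> 'b::metric_space) set" where
  "skorohod_space = {f \<in> extensional {0..}.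
     (\<forall>t\<ge>0. continuous (at_right t) f) \<and> (\<forall>t>0. \<exists>l. (f \<longlongrightarrow> l) (at_left t))}"

definition time_change :: "(real \<Rightarrow> real) \<Rightarrow> bool" where
  "time_change l \<longleftrightarrow>
     l 0 = 0 \<and> strict_mono_on {0..} l \<and> continuous_on {0..} l \<and> filterlim l at_top at_top"

text \<open>
  Convergence in the (J1) Skorohod topology on \<open>D([0,\<infinity>))\<close>, as in Jacod and Shiryaev,
  Limit Theorems for Stochastic Processes, Theorem VI.1.14: up to time changes which
  converge to the identity uniformly, the paths converge locally uniformly.
\<close>

definition skorohod_converges ::
  "(nat \<Rightarrow> real \<Rightarrow> 'b::metric_space) \<Rightarrow> (real \<Rightarrow> 'b) \<Rightarrow> bool" where
  "skorohod_converges g f \<longleftrightarrow>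
     (\<exists>l. (\<forall>n. time_change (l n)) \<and>
          uniform_limit {0..} l (\<lambda>s. s) sequentially \<and>
          (\<forall>K\<ge>0. uniform_limit {0..K} (\<lambda>n s. g n (l n s)) f sequentially))"

text \<open>
  The Skorohod topology is metrizable, hence determined by its convergent sequences: its
  open sets are the sequentially open ones.
\<close>

definition skorohod_topology :: "(real \<Rightarrow> 'b::metric_space) topology" where
  "skorohod_topology = topology (\<lambda>U. U \<subseteq> skorohod_space \<and>
     (\<forall>f\<in>U. \<forall>g. range g \<subseteq> skorohod_space \<and> skorohod_converges g f \<longrightarrow>
        (\<forall>\<^sub>F n in sequentially. g n \<in> U)))"

lemma openin_skorohod_topology:
  "openin skorohod_topology U \<longleftrightarrow> U \<subseteq> skorohod_space \<and>
     (\<forall>f\<in>U. \<forall>g. range g \<subseteq> skorohod_space \<and> skorohod_converges g f \<longrightarrow>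
        (\<forall>\<^sub>F n in sequentially. g n \<in> U))"
proof -
  have "istopology (\<lambda>U. U \<subseteq> skorohod_space \<and>
     (\<forall>f\<in>U. \<forall>g. range g \<subseteq> skorohod_space \<and> skorohod_converges g f \<longrightarrow>
        (\<forall>\<^sub>F n in sequentially. g n \<in> U)))" (is "istopology ?P")
    unfolding istopology_def
  proof (intro conjI allI impI)
    fix S T assume "?P S" "?P T"
    then show "S \<inter> T \<subseteq> skorohod_space" by blast
    show "\<forall>f\<in>S \<inter> T. \<forall>g. range g \<subseteq> skorohod_space \<and> skorohod_converges g f \<longrightarrow>
        (\<forall>\<^sub>F n in sequentially. g n \<in> S \<inter> T)"
      using \<open>?P S\<close> \<open>?P T\<close> by (simp add: eventually_conj_iff) blast
  next
    fix \<K> assume K: "\<forall>K\<in>\<K>. ?P K"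
    then show "\<Union> \<K> \<subseteq> skorohod_space" by blast
    show "\<forall>f\<in>\<Union> \<K>. \<forall>g. range g \<subseteq> skorohod_space \<and> skorohod_converges g f \<longrightarrow>
        (\<forall>\<^sub>F n in sequentially. g n \<in> \<Union> \<K>)"
    proof (intro ballI allI impI)
      fix f g assume "f \<in> \<Union> \<K>" and g: "range g \<subseteq> skorohod_space \<and> skorohod_converges g f"
      then obtain K where "K \<in> \<K>" "f \<in> K" by blast
      with K g have "\<forall>\<^sub>F n in sequentially. g n \<in> K" by blast
      then show "\<forall>\<^sub>F n in sequentially. g n \<in> \<Union> \<K>"
        by (rule eventually_mono) (use \<open>K \<in> \<K>\<close> in blast)
    qed
  qed
  then show ?thesis
    unfolding skorohod_topology_def by (subst topology_inverse') auto
qed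

lemma topspace_skorohod_topology: "topspace skorohod_topology = skorohod_space"
proof
  show "topspace skorohod_topology \<subseteq> skorohod_space"
    using openin_topspace openin_skorohod_topology by blast
  have "openin skorohod_topology skorohod_space"
    unfolding openin_skorohod_topology
    by (intro conjI ballI allI impI always_eventually) auto
  then show "skorohod_space \<subseteq> topspace skorohod_topology"
    by (rule openin_subset)
qed

lemma limitin_skorohod_topology:
  assumes "f \<in> skorohod_space" "range g \<subseteq> skorohod_space" "skorohod_converges g f"
  shows "limitin skorohod_topology g f sequentially"
  using assms unfolding limitin_def topspace_skorohod_topology openin_skorohod_topology by blast


section \<open>Gaussian laws and Brownian motion\<close>

definition normal_law :: "real \<Rightarrow> real measure" where
  "normal_law var = (if var > 0 then density lborel (normal_density 0 (sqrt var)) else return borel 0)"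

text \<open>
  A possibly degenerate centred Gaussian law with covariance matrix \<open>A\<close>: every linear
  functional \<open>u \<bullet> x\<close> is a centred normal variable with variance \<open>u \<bullet> A u\<close>.
\<close>

definition centred_gaussian :: "real ^ 'd ^ 'd \<Rightarrow> (real ^ 'd) measure \<Rightarrow> bool" where
  "centred_gaussian A \<mu> \<longleftrightarrow>
     transpose A = A \<and> (\<forall>u. 0 \<le> u \<bullet> (A *v u)) \<and>
     prob_space \<mu> \<and> sets \<mu> = sets borel \<and>
     (\<forall>u. distr \<mu> borel (\<lambda>x. u \<bullet> x) = normal_law (u \<bullet> (A *v u)))"

definition brownian_motion :: "'w measure \<Rightarrow> (real \<Rightarrow> 'w \<Rightarrow> real ^ 'd) \<Rightarrow> bool" where
  "brownian_motion N W \<longleftrightarrow>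
     prob_space N \<and>
     (\<forall>t\<ge>0. W t \<in> borel_measurable N) \<and>
     (\<forall>\<omega>\<in>space N. W 0 \<omega> = 0 \<and> continuous_on {0..} (\<lambda>t. W t \<omega>)) \<and>
     (\<forall>s t. 0 \<le> s \<and> s < t \<longrightarrow>
        centred_gaussian (mat (t - s)) (distr N borel (\<lambda>\<omega>. W t \<omega> - W s \<omega>))) \<and>
     (\<forall>(t :: nat \<Rightarrow> real) n. 0 \<le> t 0 \<and> mono t \<longrightarrow>
        prob_space.indep_vars N (\<lambda>_. borel) (\<lambda>i \<omega>. W (t (Suc i)) \<omega> - W (t i) \<omega>) {..<n})"

end

theory Submission
  imports Defs
begin

text \<open>
  The time spent on the coordinate hyperplanes is negligible. While a coordinate of the walk is
  nonzero, \<open>lam ^ \<bar>v\<^sub>i\<bar>\<close> is harmonic for it, and each visit of the coordinate to \<open>0\<close> lowers the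
  expectation of this bounded function by at least a fixed amount. Hence the expected number of times at
  which some coordinate vanishes is finite (\<open>coordinate_zero_sum\<close>, \<open>boundary_summable\<close>). At all other
  times the vector of absolute values moves by \<open>+e\<^sub>i\<close> with probability \<open>1 / (d (1 + lam))\<close> and by
  \<open>-e\<^sub>i\<close> with probability \<open>lam / (d (1 + lam))\<close>; this step has mean \<open>v\<close> and covariance
  \<open>\<Sigma> = I / d - v v\<^sup>T\<close>. So \<open>(\<bar>X\<^sub>n\<^sup>1\<bar>, \<dots>, \<bar>X\<^sub>n\<^sup>d\<bar>) - n v\<close> is a martingale with bounded increments up to an
  error of bounded expectation, and the conditional covariance of the increments is \<open>\<Sigma>\<close> outside
  events with summable probabilities.

  For such martingales the invariance principle is proved directly, without relative compactness
  of laws on path space. Replacing one increment at a time, a Taylor expansion of the cosine shows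
  that expectations of \<open>cos (\<phi> + \<theta> \<bullet> S)\<close> converge to their Gaussian values, jointly for the increments
  over a grid of times (\<open>blocks_cos_tendsto\<close>). Functions that are continuous in finitely many vectors
  are approximated by trigonometric polynomials, by the Stone-Weierstrass theorem
  (\<open>expectation_continuous_tendsto\<close>). A maximal inequality with fourth moments bounds the oscillation
  between grid times (\<open>oscillates_prob\<close>). Together these give convergence of the expectations of all
  bounded path functionals that are Lipschitz for a uniform distance on a compact time interval
  (\<open>scaled_path_functional_tendsto\<close>).

  The passage from these functionals to Skorohod-continuous ones uses only that locally uniform
  convergence implies Skorohod convergence. A bounded function that is lower semicontinuous for
  locally uniform convergence is the increasing limit of its inf-convolutions with \<open>L\<close> times the
  uniform distance on \<open>[0, L]\<close>, and these are Lipschitz functionals. Applied to \<open>f\<close> and \<open>- f\<close> this gives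
  convergence of the expectations of \<open>f\<close>, and applied to indicators of open sets it gives Borel
  measurability (\<open>converges_in_distribution_skorohodI\<close>).

  Finally \<open>T = (I - ((1 - \<rho>) / d) E) / \<surd>d\<close> is symmetric with \<open>T\<^sup>2 = \<Sigma>\<close>. Therefore \<open>T W\<close> has the
  limiting increments, and the image under \<open>T\<close> of a product of standard normal laws is the Gaussian
  law with covariance \<open>\<Sigma>\<close>.
\<close>

section \<open>Weak convergence of random vectors via trigonometric polynomials\<close>

text \<open>
  Sums of waves in the first \<open>k\<close> entries of a sequence of vectors. The number \<open>k\<close> of entries is a
  parameter rather than a dimension, so that it can depend on the grid of times.
\<close>

inductive_set trig_sums :: "nat \<Rightarrow> ((nat \<Rightarrow> 'b::euclidean_space) \<Rightarrow> real) set" for k where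
  wave: "(\<lambda>y. c * cos (\<phi> + (\<Sum>i<k. \<theta> i \<bullet> y i))) \<in> trig_sums k"
| add: "f \<in> trig_sums k \<Longrightarrow> g \<in> trig_sums k \<Longrightarrow> (\<lambda>y. f y + g y) \<in> trig_sums k"

text \<open>
  The product formula for cosines keeps products of waves inside the linear span of waves. Thus
  convergence of expectations has to be checked for single waves only.
\<close>

lemma trig_sums_mult_wave:
  fixes \<theta> :: "nat \<Rightarrow> 'b::euclidean_space"
  assumes "g \<in> trig_sums k"
  shows "(\<lambda>y. (c * cos (\<phi> + (\<Sum>i<k. \<theta> i \<bullet> y i))) * g y) \<in> trig_sums k"
  using assms
proof induction
  case (wave c' \<phi>' \<theta>')
  have "(\<lambda>y. (c * c' / 2) * cos ((\<phi> - \<phi>') + (\<Sum>i<k. (\<theta> i - \<theta>' i) \<bullet> y i))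
           + (c * c' / 2) * cos ((\<phi> + \<phi>') + (\<Sum>i<k. (\<theta> i + \<theta>' i) \<bullet> y i))) \<in> trig_sums k"
    by (rule trig_sums.add; rule trig_sums.wave)
  moreover have "(c * cos (\<phi> + (\<Sum>i<k. \<theta> i \<bullet> y i))) * (c' * cos (\<phi>' + (\<Sum>i<k. \<theta>' i \<bullet> y i)))
      = (c * c' / 2) * cos ((\<phi> - \<phi>') + (\<Sum>i<k. (\<theta> i - \<theta>' i) \<bullet> y i))
           + (c * c' / 2) * cos ((\<phi> + \<phi>') + (\<Sum>i<k. (\<theta> i + \<theta>' i) \<bullet> y i))" for y :: "nat \<Rightarrow> 'b"
  proof -
    define a b where "a = \<phi> + (\<Sum>i<k. \<theta> i \<bullet> y i)" and "b = \<phi>' + (\<Sum>i<k. \<theta>' i \<bullet> y i)"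
    have "(\<phi> - \<phi>') + (\<Sum>i<k. (\<theta> i - \<theta>' i) \<bullet> y i) = a - b"
         "(\<phi> + \<phi>') + (\<Sum>i<k. (\<theta> i + \<theta>' i) \<bullet> y i) = a + b"
      by (simp_all add: a_def b_def inner_diff_left inner_add_left sum.distrib sum_subtractf)
    then show ?thesis
      unfolding a_def[symmetric] b_def[symmetric] by (simp only: cos_add cos_diff) (simp add: field_simps)
  qed
  ultimately show ?case by simp
next
  case (add f g)
  then show ?case
    using trig_sums.add[OF add.IH] by (simp add: distrib_left)
qed

lemma trig_sums_mult:
  assumes "f \<in> trig_sums k" "g \<in> trig_sums k"
  shows "(\<lambda>y. f y * g y) \<in> trig_sums k"
  using assms(1)
proof induction
  case (wave c \<phi> \<theta>)
  show ?case by (rule trig_sums_mult_wave[OF assms(2)])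
next
  case (add f1 f2)
  then show ?case
    using trig_sums.add[OF add.IH] by (simp add: distrib_right)
qed

lemma trig_sums_const: "(\<lambda>_. c) \<in> trig_sums k"
  using trig_sums.wave[where c = c and \<phi> = 0 and \<theta> = "\<lambda>_. 0"] by simp

lemma trig_sums_continuous:
  assumes "f \<in> trig_sums k" shows "continuous_on UNIV f"
  using assms
proof induction
  case (wave c \<phi> \<theta>)
  show ?case by (intro continuous_intros continuous_on_product_coordinates)
qed (intro continuous_intros)

lemma trig_sums_bounded:
  assumes "f \<in> trig_sums k" shows "\<exists>B. \<forall>y. \<bar>f y\<bar> \<le> B"
  using assms
proof induction
  case (wave c \<phi> \<theta>)
  have "\<bar>c * cos (\<phi> + (\<Sum>i<k. \<theta> i \<bullet> y i))\<bar> \<le> \<bar>c\<bar>" for y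
    unfolding abs_mult by (rule mult_left_le) auto
  then show ?case by blast
next
  case (add f g)
  then obtain A B where "\<And>y. \<bar>f y\<bar> \<le> A" "\<And>y. \<bar>g y\<bar> \<le> B" by blast
  then have "\<bar>f y + g y\<bar> \<le> A + B" for y
    using abs_triangle_ineq[of "f y" "g y"] by (meson add_mono order_trans)
  then show ?case by blast
qed

lemma trig_sums_polynomial:
  assumes "real_polynomial_function (q :: real \<Rightarrow> real)" "f \<in> trig_sums k"
  shows "(\<lambda>y. q (f y)) \<in> trig_sums k"
  using assms(1)
proof induction
  case (linear h)
  then have "h (f y) = h 1 * f y" for y
    using linear_cmul[OF bounded_linear.linear[OF linear], of "f y" 1] by (simp add: mult.commute)
  then have "(\<lambda>y. h (f y)) = (\<lambda>y. h 1 * f y)" by (rule ext)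
  then show ?case
    using trig_sums_mult[OF trig_sums_const assms(2), of "h 1"] by simp
next
  case (const c)
  then show ?case by (rule trig_sums_const)
next
  case (add f g)
  then show ?case by (intro trig_sums.add)
next
  case (mult f g)
  then show ?case by (intro trig_sums_mult)
qed

text \<open>
  A compact set of sequences: the entries from \<open>k\<close> on are frozen at zero, so that the first \<open>k\<close> entries
  separate its points.
\<close>

definition cube :: "nat \<Rightarrow> real \<Rightarrow> (nat \<Rightarrow> 'b::euclidean_space) set" where
  "cube k R = {y. \<forall>i. if i < k then norm (y i) \<le> R else y i = 0}"

lemma compact_cube: "compact (cube k R :: (nat \<Rightarrow> 'b::euclidean_space) set)"
proof -
  define S :: "nat \<Rightarrow> 'b set" where "S i = (if i < k then cball 0 R else {0})" for i
  have "compactin (product_topology (\<lambda>_. euclidean) UNIV) (PiE UNIV S)"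
    unfolding compactin_PiE by (auto simp: S_def)
  moreover have "PiE UNIV S = cube k R"
    by (auto simp: cube_def S_def PiE_def extensional_def split: if_splits)
  ultimately show ?thesis
    by (simp add: euclidean_product_topology)
qed

text \<open>
  Along the direction \<open>x i - y i\<close> a frequency can be chosen for which the phases at \<open>x\<close> and \<open>y\<close> differ by
  a quarter of a period.
\<close>

lemma trig_sums_separate:
  fixes x y :: "nat \<Rightarrow> 'b::euclidean_space"
  assumes "i < k" "x i \<noteq> y i"
  shows "\<exists>f\<in>trig_sums k. f x \<noteq> f y"
proof -
  define w where "w = x i - y i"
  define s where "s = pi / (2 * (norm w)\<^sup>2)"
  define \<theta> where "\<theta> = (\<lambda>j. if j = i then s *\<^sub>R w else 0)"
  have lin: "(\<Sum>j<k. \<theta> j \<bullet> z j) = s * (w \<bullet> z i)" for z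
  proof -
    have "(\<Sum>j<k. \<theta> j \<bullet> z j) = (\<Sum>j<k. if j = i then s * (w \<bullet> z i) else 0)"
      by (rule sum.cong) (auto simp: \<theta>_def)
    then show ?thesis using assms(1) by simp
  qed
  have "w \<noteq> 0" using assms by (simp add: w_def)
  have "s * (w \<bullet> x i) - s * (w \<bullet> y i) = s * (w \<bullet> w)"
    by (simp add: w_def inner_diff_right algebra_simps)
  also have "\<dots> = pi / 2"
    using \<open>w \<noteq> 0\<close> by (simp add: s_def power2_norm_eq_inner)
  finally have *: "cos (s * (w \<bullet> x i) - s * (w \<bullet> y i)) = 0" by (simp only: cos_pi_half)
  show ?thesis
    by (rule bexI[OF _ trig_sums.wave[where c = 1 and \<phi> = "- (s * (w \<bullet> y i))" and \<theta> = \<theta>]])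
       (simp add: lin *)
qed

lemma trig_sums_function_ring: "function_ring_on (trig_sums k) (cube k R)"
proof
  show "compact (cube k R)" by (rule compact_cube)
  show "continuous_on (cube k R) f" if "f \<in> trig_sums k" for f :: "(nat \<Rightarrow> 'a) \<Rightarrow> real"
    using trig_sums_continuous[OF that] continuous_on_subset by blast
  show "\<exists>f\<in>trig_sums k. f x \<noteq> f y" if "x \<in> cube k R" "y \<in> cube k R" "x \<noteq> y" for x y :: "nat \<Rightarrow> 'a"
  proof -
    obtain i where "x i \<noteq> y i" using \<open>x \<noteq> y\<close> by auto
    moreover have "i < k"
      by (rule ccontr) (use that(1,2) \<open>x i \<noteq> y i\<close> in \<open>auto simp: cube_def dest!: spec[of _ i]\<close>)
    ultimately show ?thesis by (rule trig_sums_separate[rotated])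
  qed
qed (auto intro: trig_sums.add trig_sums_mult trig_sums_const)

text \<open>
  Stone-Weierstrass controls the approximating polynomial on the compact set only, while weak
  convergence needs a bound everywhere. Composing with a one-variable polynomial that is close to
  the clamping function on the range of the first approximation restores the bound, and the result
  is still a sum of waves.
\<close>

lemma trig_approximation:
  fixes G :: "(nat \<Rightarrow> 'b::euclidean_space) \<Rightarrow> real"
  assumes "continuous_on UNIV G" "\<And>y. \<bar>G y\<bar> \<le> C" "0 < e"
  obtains T where "T \<in> trig_sums k" "\<And>y. y \<in> cube k R \<Longrightarrow> \<bar>G y - T y\<bar> \<le> e" "\<And>y. \<bar>T y\<bar> \<le> C + e"
proof -
  interpret function_ring_on "trig_sums k" "cube k R :: (nat \<Rightarrow> 'b) set"
    by (rule trig_sums_function_ring)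
  have "0 \<le> C" using assms(2) abs_ge_zero order_trans by blast
  have "continuous_on (cube k R) G" using assms(1) continuous_on_subset by blast
  with assms(3) obtain P where P: "P \<in> trig_sums k" "\<And>y. y \<in> cube k R \<Longrightarrow> \<bar>G y - P y\<bar> < e / 3"
    using Stone_Weierstrass_basic[of G "e / 3"] by auto
  obtain B where B: "\<And>y. \<bar>P y\<bar> \<le> B" using trig_sums_bounded[OF P(1)] by blast
  define clamp where "clamp x = max (- C) (min C x)" for x :: real
  have "continuous_on {-B..B} clamp" unfolding clamp_def by (intro continuous_intros)
  then obtain q where q: "real_polynomial_function q" "\<And>x. x \<in> {-B..B} \<Longrightarrow> \<bar>clamp x - q x\<bar> < e / 3"
    using Stone_Weierstrass_real_polynomial_function[of "{-B..B}" clamp "e / 3"] assms(3) by auto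
  have qP: "\<bar>clamp (P y) - q (P y)\<bar> < e / 3" for y
    using B[of y] by (intro q(2)) auto
  show thesis
  proof (rule that[of "\<lambda>y. q (P y)"])
    show "(\<lambda>y. q (P y)) \<in> trig_sums k" by (rule trig_sums_polynomial[OF q(1) P(1)])
    show "\<bar>G y - q (P y)\<bar> \<le> e" if "y \<in> cube k R" for y
    proof -
      have "\<bar>clamp (P y) - P y\<bar> \<le> e / 3"
        using P(2)[OF that] assms(2)[of y] \<open>0 \<le> C\<close> assms(3) unfolding clamp_def max_def min_def by (smt (verit))
      then show ?thesis using P(2)[OF that] qP[of y] by linarith
    qed
    show "\<bar>q (P y)\<bar> \<le> C + e" for y
    proof -
      have "\<bar>clamp (P y)\<bar> \<le> C" using \<open>0 \<le> C\<close> by (auto simp: clamp_def max_def min_def)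
      then show ?thesis using qP[of y] assms(3) by linarith
    qed
  qed
qed

lemma (in prob_space) expectation_diff_le:
  fixes f g :: "'a \<Rightarrow> real"
  assumes "integrable M f" "integrable M g" "A \<in> events" "0 \<le> b"
    and "\<And>\<omega>. \<omega> \<in> space M \<Longrightarrow> \<omega> \<notin> A \<Longrightarrow> \<bar>f \<omega> - g \<omega>\<bar> \<le> a"
    and "\<And>\<omega>. \<omega> \<in> space M \<Longrightarrow> \<omega> \<in> A \<Longrightarrow> \<bar>f \<omega> - g \<omega>\<bar> \<le> a + b"
  shows "\<bar>expectation f - expectation g\<bar> \<le> a + b * prob A"
proof -
  have int: "integrable M (\<lambda>\<omega>. b * indicat_real A \<omega>)"
    using assms(3) by (intro integrable_mult_right integrable_real_indicator) (auto simp: less_top[symmetric])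
  have "\<bar>expectation f - expectation g\<bar> = \<bar>expectation (\<lambda>\<omega>. f \<omega> - g \<omega>)\<bar>"
    using assms(1,2) by simp
  also have "\<dots> \<le> expectation (\<lambda>\<omega>. \<bar>f \<omega> - g \<omega>\<bar>)" by (rule integral_abs_bound)
  also have "\<dots> \<le> expectation (\<lambda>\<omega>. a + b * indicat_real A \<omega>)"
  proof (rule integral_mono)
    show "integrable M (\<lambda>\<omega>. \<bar>f \<omega> - g \<omega>\<bar>)" using assms(1,2) by simp
    show "integrable M (\<lambda>\<omega>. a + b * indicat_real A \<omega>)" using int by simp
    show "\<bar>f \<omega> - g \<omega>\<bar> \<le> a + b * indicat_real A \<omega>" if "\<omega> \<in> space M" for \<omega>
      using assms(5)[OF that] assms(6)[OF that] by (auto simp: indicator_def)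
  qed
  also have "\<dots> = expectation (\<lambda>\<omega>. a) + expectation (\<lambda>\<omega>. b * indicat_real A \<omega>)"
    using int by (intro Bochner_Integration.integral_add) auto
  also have "\<dots> = a + b * prob A"
    using assms(3) by (simp add: prob_space)
  finally show ?thesis .
qed

lemma (in prob_space) trig_sums_integral_tendsto:
  assumes "prob_space N"
    and V: "\<And>n i. V n i \<in> borel_measurable M" and U: "\<And>i. U i \<in> borel_measurable N"
    and conv: "\<And>\<theta> \<phi>. (\<lambda>n. \<integral>\<omega>. cos (\<phi> + (\<Sum>i<k. \<theta> i \<bullet> V n i \<omega>)) \<partial>M)
           \<longlonglongrightarrow> (\<integral>\<omega>. cos (\<phi> + (\<Sum>i<k. \<theta> i \<bullet> U i \<omega>)) \<partial>N)"
    and T: "T \<in> trig_sums k"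
  shows "(\<lambda>n. \<integral>\<omega>. T (\<lambda>i. V n i \<omega>) \<partial>M) \<longlonglongrightarrow> (\<integral>\<omega>. T (\<lambda>i. U i \<omega>) \<partial>N)"
  using T
proof induction
  case (wave c \<phi> \<theta>)
  show ?case using tendsto_mult[OF tendsto_const[of c] conv[of \<phi> \<theta>]] by simp
next
  case (add f g)
  interpret N: prob_space N by fact
  have int: "integrable M (\<lambda>\<omega>. h (\<lambda>i. V n i \<omega>))" "integrable N (\<lambda>\<omega>. h (\<lambda>i. U i \<omega>))"
    if h: "h \<in> trig_sums k" for h n
  proof -
    obtain B where B: "\<And>y. \<bar>h y\<bar> \<le> B" using trig_sums_bounded[OF h] by blast
    have [measurable]: "h \<in> borel_measurable borel"
      using trig_sums_continuous[OF h] by (rule borel_measurable_continuous_onI)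
    have [measurable]: "(\<lambda>\<omega> i. V n i \<omega>) \<in> borel_measurable M"
      using V by (intro measurable_coordinatewise_then_product) simp
    have [measurable]: "(\<lambda>\<omega> i. U i \<omega>) \<in> borel_measurable N"
      using U by (intro measurable_coordinatewise_then_product) simp
    show "integrable M (\<lambda>\<omega>. h (\<lambda>i. V n i \<omega>))"
      by (rule integrable_const_bound[of _ B]) (auto simp: B)
    show "integrable N (\<lambda>\<omega>. h (\<lambda>i. U i \<omega>))"
      by (rule N.integrable_const_bound[of _ B]) (auto simp: B)
  qed
  show ?case
    using tendsto_add[OF add.IH] by (simp add: int[OF add.hyps(1)] int[OF add.hyps(2)])
qed

lemma (in prob_space) prob_outside_cube_le:
  assumes [measurable]: "\<And>i. V i \<in> borel_measurable M"
    and zero: "\<And>i \<omega>. k \<le> i \<Longrightarrow> V i \<omega> = 0"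
    and tail: "\<And>i. i < k \<Longrightarrow> prob {\<omega> \<in> space M. R < norm (V i \<omega>)} \<le> e"
  shows "{\<omega> \<in> space M. (\<lambda>i. V i \<omega>) \<notin> cube k R} \<in> events"
    "prob {\<omega> \<in> space M. (\<lambda>i. V i \<omega>) \<notin> cube k R} \<le> real k * e"
proof -
  have eq: "{\<omega> \<in> space M. (\<lambda>i. V i \<omega>) \<notin> cube k R} = (\<Union>i<k. {\<omega> \<in> space M. R < norm (V i \<omega>)})"
    using zero by (auto simp: cube_def not_le)
  show "{\<omega> \<in> space M. (\<lambda>i. V i \<omega>) \<notin> cube k R} \<in> events" unfolding eq by measurable
  have "prob (\<Union>i<k. {\<omega> \<in> space M. R < norm (V i \<omega>)})
     \<le> (\<Sum>i<k. prob {\<omega> \<in> space M. R < norm (V i \<omega>)})"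
    by (rule finite_measure_subadditive_finite) auto
  also have "\<dots> \<le> (\<Sum>i<k. e)" by (intro sum_mono tail) auto
  finally show "prob {\<omega> \<in> space M. (\<lambda>i. V i \<omega>) \<notin> cube k R} \<le> real k * e"
    unfolding eq by simp
qed

lemma (in prob_space) norm_tail_small:
  assumes [measurable]: "(X :: 'a \<Rightarrow> 'b::euclidean_space) \<in> borel_measurable M" and "0 < e"
  obtains R0 where "\<And>R. R0 \<le> R \<Longrightarrow> prob {\<omega> \<in> space M. R < norm (X \<omega>)} \<le> e"
proof -
  define A where "A n = {\<omega> \<in> space M. real n < norm (X \<omega>)}" for n :: nat
  have "range A \<subseteq> events" by (auto simp: A_def)
  moreover have "decseq A"
    unfolding A_def by (rule decseq_SucI) auto
  ultimately have "(\<lambda>n. prob (A n)) \<longlonglongrightarrow> prob (\<Inter>n. A n)"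
    by (rule finite_Lim_measure_decseq)
  moreover have "(\<Inter>n. A n) = {}"
  proof (intro equals0I)
    fix \<omega> assume "\<omega> \<in> (\<Inter>n. A n)"
    moreover obtain n where "norm (X \<omega>) < real n"
      using reals_Archimedean2 by blast
    ultimately have "real n < norm (X \<omega>)" by (simp add: A_def)
    with \<open>norm (X \<omega>) < real n\<close> show False by linarith
  qed
  ultimately have "(\<lambda>n. prob (A n)) \<longlonglongrightarrow> 0" by simp
  from order_tendstoD(2)[OF this \<open>0 < e\<close>] obtain n where n: "prob (A n) < e"
    unfolding eventually_sequentially by blast
  have "prob {\<omega> \<in> space M. R < norm (X \<omega>)} \<le> e" if "real n \<le> R" for R
  proof -
    have "prob {\<omega> \<in> space M. R < norm (X \<omega>)} \<le> prob (A n)"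
      by (rule finite_measure_mono) (use that in \<open>auto simp: A_def\<close>)
    with n show ?thesis by linarith
  qed
  then show thesis by (rule that)
qed

text \<open>
  A tail bound confines the vectors to a cube up to a small probability; on the cube \<open>G\<close> is close to a sum
  of waves \<open>T\<close>, and off the cube both \<open>G\<close> and \<open>T\<close> are bounded by about \<open>C\<close>.
\<close>

lemma (in prob_space) expectation_continuous_tendsto:
  fixes V :: "nat \<Rightarrow> nat \<Rightarrow> 'a \<Rightarrow> 'b::euclidean_space" and G :: "(nat \<Rightarrow> 'b) \<Rightarrow> real"
  assumes N: "prob_space N"
    and V [measurable]: "\<And>n i. V n i \<in> borel_measurable M" and U [measurable]: "\<And>i. U i \<in> borel_measurable N"
    and V0: "\<And>n i \<omega>. k \<le> i \<Longrightarrow> V n i \<omega> = 0" and U0: "\<And>i \<omega>. k \<le> i \<Longrightarrow> U i \<omega> = 0"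
    and conv: "\<And>\<theta> \<phi>. (\<lambda>n. \<integral>\<omega>. cos (\<phi> + (\<Sum>i<k. \<theta> i \<bullet> V n i \<omega>)) \<partial>M)
           \<longlonglongrightarrow> (\<integral>\<omega>. cos (\<phi> + (\<Sum>i<k. \<theta> i \<bullet> U i \<omega>)) \<partial>N)"
    and tight: "\<And>e. 0 < e \<Longrightarrow> \<exists>R. \<forall>\<^sub>F n in sequentially. \<forall>i<k. prob {\<omega> \<in> space M. R < norm (V n i \<omega>)} \<le> e"
    and G: "continuous_on UNIV G" "\<And>y. \<bar>G y\<bar> \<le> C"
  shows "(\<lambda>n. \<integral>\<omega>. G (\<lambda>i. V n i \<omega>) \<partial>M) \<longlonglongrightarrow> (\<integral>\<omega>. G (\<lambda>i. U i \<omega>) \<partial>N)"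
proof (rule LIMSEQ_I)
  interpret N: prob_space N by fact
  fix r :: real assume "0 < r"
  have "0 \<le> C" using G(2)[of undefined] abs_ge_zero[of "G undefined"] by linarith
  define e where "e = min 1 (r / 5)"
  have e: "0 < e" "e \<le> 1" "e \<le> r / 5" using \<open>0 < r\<close> by (auto simp: e_def)
  define D where "D = 2 * C + 1"
  have "0 < D" using \<open>0 \<le> C\<close> by (simp add: D_def)
  \<comment> \<open>Each of the \<open>k\<close> entries may leave the cube with probability \<open>e'\<close>, at a total cost of \<open>D * k * e' \<le> e\<close>.\<close>
  define e' where "e' = e / (D * (real k + 1))"
  have "0 < e'" using e \<open>0 < D\<close> by (simp add: e'_def)
  have "D * (real k * e') = e * (real k / (real k + 1))"
  proof -
    have "D \<noteq> 0" "real k + 1 \<noteq> 0" using \<open>0 < D\<close> by auto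
    then show ?thesis unfolding e'_def by (simp add: divide_simps)
  qed
  also have "\<dots> \<le> e" using e by (intro mult_left_le) auto
  finally have small: "D * (real k * e') \<le> e" .
  obtain R1 where R1: "\<forall>\<^sub>F n in sequentially. \<forall>i<k. prob {\<omega> \<in> space M. R1 < norm (V n i \<omega>)} \<le> e'"
    using tight[OF \<open>0 < e'\<close>] by blast
  have "\<exists>R0. \<forall>R\<ge>R0. measure N {\<omega> \<in> space N. R < norm (U i \<omega>)} \<le> e'" for i
    by (rule N.norm_tail_small[OF U \<open>0 < e'\<close>, of i]) blast
  then have "\<forall>i. \<exists>R0. \<forall>R\<ge>R0. measure N {\<omega> \<in> space N. R < norm (U i \<omega>)} \<le> e'" by blast
  from choice[OF this] obtain R0
    where R0: "\<And>i R. R0 i \<le> R \<Longrightarrow> measure N {\<omega> \<in> space N. R < norm (U i \<omega>)} \<le> e'"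
    by blast
  define R where "R = Max (insert R1 (R0 ` {..<k}))"
  have "R1 \<le> R" and "\<And>i. i < k \<Longrightarrow> R0 i \<le> R" by (auto simp: R_def)
  obtain T where T: "T \<in> trig_sums k" "\<And>y. y \<in> cube k R \<Longrightarrow> \<bar>G y - T y\<bar> \<le> e" "\<And>y. \<bar>T y\<bar> \<le> C + e"
    by (rule trig_approximation[OF G e(1), of k R]) (rule that)
  have [measurable]: "T \<in> borel_measurable borel" "G \<in> borel_measurable borel"
    using trig_sums_continuous[OF T(1)] G(1) by (auto intro: borel_measurable_continuous_onI)
  have [measurable]: "(\<lambda>\<omega> i. V n i \<omega>) \<in> borel_measurable M" for n
    using V by (intro measurable_coordinatewise_then_product) simp
  have [measurable]: "(\<lambda>\<omega> i. U i \<omega>) \<in> borel_measurable N"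
    using U by (intro measurable_coordinatewise_then_product) simp
  have GT: "\<bar>G y - T y\<bar> \<le> e + D" for y
    using G(2)[of y] T(3)[of y] e by (auto simp: D_def)
  have int_V: "integrable M (\<lambda>\<omega>. G (\<lambda>i. V n i \<omega>))" "integrable M (\<lambda>\<omega>. T (\<lambda>i. V n i \<omega>))" for n
    by (rule integrable_const_bound[of _ C], simp add: G(2), measurable)
       (rule integrable_const_bound[of _ "C + e"], simp add: T(3), measurable)
  have int_U: "integrable N (\<lambda>\<omega>. G (\<lambda>i. U i \<omega>))" "integrable N (\<lambda>\<omega>. T (\<lambda>i. U i \<omega>))"
    by (rule N.integrable_const_bound[of _ C], simp add: G(2), measurable)
       (rule N.integrable_const_bound[of _ "C + e"], simp add: T(3), measurable)
  have close_U: "\<bar>N.expectation (\<lambda>\<omega>. G (\<lambda>i. U i \<omega>)) - N.expectation (\<lambda>\<omega>. T (\<lambda>i. U i \<omega>))\<bar> \<le> 2 * e"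
  proof -
    have tail: "measure N {\<omega> \<in> space N. R < norm (U i \<omega>)} \<le> e'" if "i < k" for i
      using R0[of i R] \<open>i < k \<Longrightarrow> R0 i \<le> R\<close> that by simp
    note out = N.prob_outside_cube_le[of U, OF U U0 tail]
    have "\<bar>N.expectation (\<lambda>\<omega>. G (\<lambda>i. U i \<omega>)) - N.expectation (\<lambda>\<omega>. T (\<lambda>i. U i \<omega>))\<bar>
       \<le> e + D * measure N {\<omega> \<in> space N. (\<lambda>i. U i \<omega>) \<notin> cube k R}"
      by (rule N.expectation_diff_le[OF int_U out(1)]) (use T(2) GT \<open>0 < D\<close> in auto)
    also have "D * measure N {\<omega> \<in> space N. (\<lambda>i. U i \<omega>) \<notin> cube k R} \<le> D * (real k * e')"
      using out(2) \<open>0 < D\<close> by (intro mult_left_mono) auto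
    finally show ?thesis using small by linarith
  qed
  have close_V: "\<forall>\<^sub>F n in sequentially. \<bar>expectation (\<lambda>\<omega>. G (\<lambda>i. V n i \<omega>)) - expectation (\<lambda>\<omega>. T (\<lambda>i. V n i \<omega>))\<bar> \<le> 2 * e"
    using R1
  proof eventually_elim
    case (elim n)
    have tail: "prob {\<omega> \<in> space M. R < norm (V n i \<omega>)} \<le> e'" if "i < k" for i
    proof -
      have "prob {\<omega> \<in> space M. R < norm (V n i \<omega>)} \<le> prob {\<omega> \<in> space M. R1 < norm (V n i \<omega>)}"
        using \<open>R1 \<le> R\<close> by (intro finite_measure_mono) auto
      with elim that show ?thesis by force
    qed
    note out = prob_outside_cube_le[of "V n", OF V V0 tail]
    have "\<bar>expectation (\<lambda>\<omega>. G (\<lambda>i. V n i \<omega>)) - expectation (\<lambda>\<omega>. T (\<lambda>i. V n i \<omega>))\<bar>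
       \<le> e + D * prob {\<omega> \<in> space M. (\<lambda>i. V n i \<omega>) \<notin> cube k R}"
      by (rule expectation_diff_le[OF int_V out(1)]) (use T(2) GT \<open>0 < D\<close> in auto)
    also have "D * prob {\<omega> \<in> space M. (\<lambda>i. V n i \<omega>) \<notin> cube k R} \<le> D * (real k * e')"
      using out(2) \<open>0 < D\<close> by (intro mult_left_mono) auto
    finally show ?case using small by linarith
  qed
  have "(\<lambda>n. expectation (\<lambda>\<omega>. T (\<lambda>i. V n i \<omega>))) \<longlonglongrightarrow> N.expectation (\<lambda>\<omega>. T (\<lambda>i. U i \<omega>))"
    by (rule trig_sums_integral_tendsto[OF N V U conv T(1)])
  from tendstoD[OF this e(1)]
  have "\<forall>\<^sub>F n in sequentially. \<bar>expectation (\<lambda>\<omega>. T (\<lambda>i. V n i \<omega>)) - N.expectation (\<lambda>\<omega>. T (\<lambda>i. U i \<omega>))\<bar> < e"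
    by (simp only: dist_real_def)
  with close_V have "\<forall>\<^sub>F n in sequentially. norm (expectation (\<lambda>\<omega>. G (\<lambda>i. V n i \<omega>)) - N.expectation (\<lambda>\<omega>. G (\<lambda>i. U i \<omega>))) < r"
  proof eventually_elim
    case (elim n)
    then show ?case using close_U e by (simp add: real_norm_def)
  qed
  then show "\<exists>no. \<forall>n\<ge>no. norm (expectation (\<lambda>\<omega>. G (\<lambda>i. V n i \<omega>)) - N.expectation (\<lambda>\<omega>. G (\<lambda>i. U i \<omega>))) < r"
    by (simp add: eventually_sequentially)
qed

section \<open>Weak convergence on Skorohod space via Lipschitz functionals\<close>

text \<open>
  The two roles of \<open>L\<close>, Lipschitz constant and time horizon, are merged because both tend to infinity
  together in the approximation below. Taking \<open>\<delta> = 0\<close> shows that such a functional depends on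
  the path on \<open>[0, L]\<close> only.
\<close>

definition loc_lip :: "real \<Rightarrow> ((real \<Rightarrow> 'b::metric_space) \<Rightarrow> real) \<Rightarrow> bool" where
  "loc_lip L \<Phi> \<longleftrightarrow> (\<forall>g h \<delta>. 0 \<le> \<delta> \<longrightarrow> (\<forall>t\<in>{0..L}. dist (g t) (h t) \<le> \<delta>) \<longrightarrow> \<bar>\<Phi> g - \<Phi> h\<bar> \<le> L * \<delta>)"

lemma loc_lipD:
  "loc_lip L \<Phi> \<Longrightarrow> 0 \<le> \<delta> \<Longrightarrow> (\<And>t. 0 \<le> t \<Longrightarrow> t \<le> L \<Longrightarrow> dist (g t) (h t) \<le> \<delta>) \<Longrightarrow> \<bar>\<Phi> g - \<Phi> h\<bar> \<le> L * \<delta>"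
  unfolding loc_lip_def by (metis atLeastAtMost_iff)

text \<open>
  Truncation at \<open>1\<close> makes the supremum finite without any boundedness assumption on the paths.
\<close>

definition path_dist :: "real \<Rightarrow> (real \<Rightarrow> 'b::metric_space) \<Rightarrow> (real \<Rightarrow> 'b) \<Rightarrow> real" where
  "path_dist L g h = (SUP t\<in>{0..L}. min 1 (dist (g t) (h t)))"

lemma path_dist_upper:
  assumes "0 \<le> t" "t \<le> L"
  shows "min 1 (dist (g t) (h t)) \<le> path_dist L g h"
  unfolding path_dist_def using assms by (intro cSUP_upper bdd_aboveI[of _ 1]) auto

lemma path_dist_least:
  assumes "0 \<le> L" "\<And>t. 0 \<le> t \<Longrightarrow> t \<le> L \<Longrightarrow> min 1 (dist (g t) (h t)) \<le> c"
  shows "path_dist L g h \<le> c"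
  unfolding path_dist_def using assms by (intro cSUP_least) auto

lemma path_dist_nonneg: "0 \<le> L \<Longrightarrow> 0 \<le> path_dist L g h"
  using path_dist_upper[of 0 L g h] by (rule order_trans[rotated]) auto

lemma path_dist_shift:
  assumes "0 \<le> L" "\<And>t. 0 \<le> t \<Longrightarrow> t \<le> L \<Longrightarrow> dist (g t) (g' t) \<le> \<delta>"
  shows "path_dist L g h \<le> path_dist L g' h + \<delta>"
proof (rule path_dist_least[OF assms(1)])
  fix t assume t: "0 \<le> t" "t \<le> L"
  show "min 1 (dist (g t) (h t)) \<le> path_dist L g' h + \<delta>"
    using path_dist_upper[OF t, of g' h] assms(2)[OF t] dist_triangle[of "g t" "h t" "g' t"] zero_le_dist[of "g t" "g' t"]
    by linarith
qed

text \<open>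
  The inf-convolution of \<open>f\<close> with \<open>L\<close> times the distance on \<open>[0, L]\<close>: the largest minorant of \<open>f\<close> on the
  Skorohod space that has this modulus of continuity.
\<close>

definition infconv :: "real \<Rightarrow> ((real \<Rightarrow> 'b::metric_space) \<Rightarrow> real) \<Rightarrow> (real \<Rightarrow> 'b) \<Rightarrow> real" where
  "infconv L f g = (INF h\<in>skorohod_space. f h + L * path_dist L g h)"

lemma skorohod_space_not_empty: "(skorohod_space :: (real \<Rightarrow> 'b::metric_space) set) \<noteq> {}"
proof -
  have "(\<lambda>t\<in>{0..}. undefined) \<in> (skorohod_space :: (real \<Rightarrow> 'b::metric_space) set)"
    unfolding skorohod_space_def
  proof (intro CollectI conjI allI impI)
    have eq: "(\<lambda>t\<in>{0..}. undefined) = (\<lambda>_. undefined :: 'b)" by (auto simp: restrict_def)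
    show "continuous (at_right t) (\<lambda>t\<in>{0..}. undefined :: 'b)" for t unfolding eq by simp
    show "\<exists>l. ((\<lambda>t\<in>{0..}. undefined :: 'b) \<longlongrightarrow> l) (at_left t)" for t unfolding eq by (blast intro: tendsto_const)
  qed auto
  then show ?thesis by blast
qed

context
  fixes f :: "(real \<Rightarrow> 'b::metric_space) \<Rightarrow> real" and B :: real
  assumes f0: "\<And>h. h \<in> skorohod_space \<Longrightarrow> 0 \<le> f h" and fB: "\<And>h. h \<in> skorohod_space \<Longrightarrow> f h \<le> B"
begin

lemma infconv_bdd: "0 \<le> L \<Longrightarrow> bdd_below ((\<lambda>h. f h + L * path_dist L g h) ` skorohod_space)"
  by (intro bdd_belowI[of _ 0]) (auto intro!: add_nonneg_nonneg f0 mult_nonneg_nonneg path_dist_nonneg)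

lemma infconv_lower: "0 \<le> L \<Longrightarrow> h \<in> skorohod_space \<Longrightarrow> infconv L f g \<le> f h + L * path_dist L g h"
  unfolding infconv_def by (intro cINF_lower infconv_bdd)

lemma infconv_nonneg: "0 \<le> L \<Longrightarrow> 0 \<le> infconv L f g"
  unfolding infconv_def
  by (intro cINF_greatest skorohod_space_not_empty add_nonneg_nonneg f0 mult_nonneg_nonneg path_dist_nonneg)

lemma infconv_abs_le:
  assumes "0 \<le> L" shows "\<bar>infconv L f g\<bar> \<le> B + L"
proof -
  obtain h :: "real \<Rightarrow> 'b" where h: "h \<in> skorohod_space" using skorohod_space_not_empty by blast
  have "path_dist L g h \<le> 1" by (rule path_dist_least[OF assms]) simp
  then have "L * path_dist L g h \<le> L" using assms by (rule mult_left_le)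
  then show ?thesis
    using infconv_lower[OF assms h, of g] fB[OF h] infconv_nonneg[OF assms, of g] by linarith
qed

lemma infconv_le:
  assumes "0 \<le> L" "g \<in> skorohod_space" shows "infconv L f g \<le> f g"
proof -
  have "path_dist L g g \<le> 0" by (rule path_dist_least[OF assms(1)]) simp
  then have "path_dist L g g = 0" using path_dist_nonneg[OF assms(1), of g g] by simp
  then show ?thesis using infconv_lower[OF assms, of g] by simp
qed

text \<open>
  Each function under the infimum has the required modulus of continuity, by the triangle inequality
  for the distance.
\<close>

lemma infconv_loc_lip:
  assumes "0 \<le> L" shows "loc_lip L (infconv L f)"
proof -
  have *: "infconv L f g \<le> infconv L f g' + L * \<delta>"
    if "\<And>t. 0 \<le> t \<Longrightarrow> t \<le> L \<Longrightarrow> dist (g t) (g' t) \<le> \<delta>" for g g' \<delta>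
  proof -
    have "infconv L f g - L * \<delta> \<le> infconv L f g'"
      unfolding infconv_def[of L f g']
    proof (rule cINF_greatest[OF skorohod_space_not_empty])
      fix h :: "real \<Rightarrow> 'b" assume h: "h \<in> skorohod_space"
      have "L * path_dist L g h \<le> L * (path_dist L g' h + \<delta>)"
        using assms path_dist_shift[OF assms that] by (intro mult_left_mono) auto
      then show "infconv L f g - L * \<delta> \<le> f h + L * path_dist L g' h"
        using infconv_lower[OF assms h, of g] by (simp add: distrib_left)
    qed
    then show ?thesis by simp
  qed
  show ?thesis
    unfolding loc_lip_def
  proof (intro allI impI)
    fix g h :: "real \<Rightarrow> 'b" and \<delta> :: real assume "\<forall>t\<in>{0..L}. dist (g t) (h t) \<le> \<delta>"
    then have d: "dist (g t) (h t) \<le> \<delta>" "dist (h t) (g t) \<le> \<delta>" if "0 \<le> t" "t \<le> L" for t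
      using that by (auto simp: dist_commute)
    show "\<bar>infconv L f g - infconv L f h\<bar> \<le> L * \<delta>"
      using *[of g h, OF d(1)] *[of h g, OF d(2)] by fastforce
  qed
qed

end

text \<open>
  Lower semicontinuity with respect to locally uniform convergence of paths.
\<close>

definition loc_unif_lsc :: "((real \<Rightarrow> 'b::metric_space) \<Rightarrow> real) \<Rightarrow> bool" where
  "loc_unif_lsc f \<longleftrightarrow> (\<forall>g\<in>skorohod_space. \<forall>\<eta>>0. \<exists>K \<epsilon>. 0 < \<epsilon> \<and>
     (\<forall>h\<in>skorohod_space. (\<forall>t\<in>{0..K}. dist (g t) (h t) \<le> \<epsilon>) \<longrightarrow> f g - \<eta> \<le> f h))"

text \<open>
  A competitor \<open>h\<close> in the infimum is either uniformly close to \<open>g\<close> on a long interval, where lower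
  semicontinuity gives \<open>f h \<ge> f g - \<eta>\<close>, or it pays a distance penalty that exceeds the bound \<open>B\<close> of
  \<open>f\<close> as soon as \<open>L\<close> is large.
\<close>

lemma infconv_tendsto:
  assumes f0: "\<And>h. h \<in> skorohod_space \<Longrightarrow> 0 \<le> f h" and fB: "\<And>h. h \<in> skorohod_space \<Longrightarrow> f h \<le> B"
    and lsc: "loc_unif_lsc f" and g: "g \<in> skorohod_space"
  shows "(\<lambda>n. infconv (real n) f g) \<longlonglongrightarrow> f g"
proof (rule LIMSEQ_I)
  fix r :: real assume "0 < r"
  then have "0 < r / 2" by simp
  from lsc[unfolded loc_unif_lsc_def, rule_format, OF g this] obtain K \<epsilon> where "0 < \<epsilon>" and
    K: "\<And>h. h \<in> skorohod_space \<Longrightarrow> \<forall>t\<in>{0..K}. dist (g t) (h t) \<le> \<epsilon> \<Longrightarrow> f g - r / 2 \<le> f h"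
    by blast
  define \<delta> where "\<delta> = min 1 \<epsilon>"
  have "0 < \<delta>" using \<open>0 < \<epsilon>\<close> by (simp add: \<delta>_def)
  obtain n0 where n0: "max K (B / \<delta>) < real n0" using reals_Archimedean2 by blast
  have "norm (infconv (real n) f g - f g) < r" if "n0 \<le> n" for n
  proof -
    have n: "K < real n" "B / \<delta> < real n" using n0 that by (auto simp: less_le_trans)
    have "f g - r / 2 \<le> infconv (real n) f g"
      unfolding infconv_def
    proof (rule cINF_greatest[OF skorohod_space_not_empty])
      fix h :: "real \<Rightarrow> 'a" assume h: "h \<in> skorohod_space"
      have pd: "0 \<le> real n * path_dist (real n) g h"
        by (intro mult_nonneg_nonneg path_dist_nonneg) auto
      show "f g - r / 2 \<le> f h + real n * path_dist (real n) g h"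
      proof (cases "\<forall>t\<in>{0..K}. dist (g t) (h t) \<le> \<epsilon>")
        case True
        with K[OF h] pd show ?thesis by simp
      next
        case False
        then obtain t where t: "0 \<le> t" "t \<le> K" "\<epsilon> < dist (g t) (h t)" by (auto simp: not_le)
        have "\<delta> \<le> min 1 (dist (g t) (h t))" using t by (auto simp: \<delta>_def)
        also have "\<dots> \<le> path_dist (real n) g h" using t n by (intro path_dist_upper) auto
        finally have "real n * \<delta> \<le> real n * path_dist (real n) g h" by (intro mult_left_mono) auto
        moreover have "B < real n * \<delta>" using n(2) \<open>0 < \<delta>\<close> by (simp add: divide_less_eq)
        ultimately show ?thesis using f0[OF h] fB[OF g] \<open>0 < r\<close> by linarith
      qed
    qed
    moreover have "infconv (real n) f g \<le> f g"
      by (rule infconv_le[OF f0 fB _ g]) auto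
    ultimately show ?thesis using \<open>0 < r\<close> by (simp add: real_norm_def)
  qed
  then show "\<exists>no. \<forall>n\<ge>no. norm (infconv (real n) f g - f g) < r" by blast
qed

lemma time_change_ident: "time_change (\<lambda>t. t)"
  unfolding time_change_def by (auto simp: strict_mono_on_def filterlim_ident)

text \<open>
  With the identity as time change, locally uniform convergence is a special case of Skorohod
  convergence, so a sequence of paths outside \<open>U\<close> cannot converge locally uniformly to \<open>g\<close>.
\<close>

lemma skorohod_open_neighbourhood:
  fixes U :: "(real \<Rightarrow> 'b::metric_space) set"
  assumes U: "openin skorohod_topology U" and g: "g \<in> U"
  shows "\<exists>K \<epsilon>. 0 < \<epsilon> \<and> (\<forall>h\<in>skorohod_space. (\<forall>t\<in>{0..K}. dist (g t) (h t) \<le> \<epsilon>) \<longrightarrow> h \<in> U)"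
proof (rule ccontr)
  assume "\<not> ?thesis"
  then have "\<forall>n::nat. \<exists>h. h \<in> skorohod_space \<and> (\<forall>t\<in>{0..real n}. dist (g t) (h t) \<le> 1 / real (Suc n)) \<and> h \<notin> U"
    by (metis of_nat_0_less_iff zero_less_Suc zero_less_divide_1_iff)
  then obtain h where h: "\<And>n. h n \<in> skorohod_space" "\<And>n t. t \<in> {0..real n} \<Longrightarrow> dist (g t) (h n t) \<le> 1 / real (Suc n)"
    "\<And>n. h n \<notin> U"
    by metis
  have "skorohod_converges h g"
    unfolding skorohod_converges_def
  proof (intro exI[of _ "\<lambda>n t. t"] conjI allI impI)
    show "time_change (\<lambda>t. t)" by (rule time_change_ident)
    show "uniform_limit {0..} (\<lambda>n t. t) (\<lambda>s. s) sequentially" by (rule uniform_limit_const)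
    fix K :: real assume "0 \<le> K"
    show "uniform_limit {0..K} (\<lambda>n s. h n s) g sequentially"
    proof (rule uniform_limitI)
      fix e :: real assume "0 < e"
      have "\<forall>\<^sub>F n in sequentially. 1 / real (Suc n) < e"
        using order_tendstoD(2)[OF LIMSEQ_Suc[OF lim_1_over_n] \<open>0 < e\<close>] by simp
      moreover have "\<forall>\<^sub>F n in sequentially. K \<le> real n"
        using eventually_ge_at_top[of "nat \<lceil>K\<rceil>"] by eventually_elim linarith
      ultimately show "\<forall>\<^sub>F n in sequentially. \<forall>t\<in>{0..K}. dist (h n t) (g t) < e"
      proof eventually_elim
        case (elim n)
        show ?case
        proof
          fix t assume "t \<in> {0..K}"
          with elim(2) have "dist (g t) (h n t) \<le> 1 / real (Suc n)" by (intro h(2)) auto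
          with elim(1) show "dist (h n t) (g t) < e" by (simp add: dist_commute)
        qed
      qed
    qed
  qed
  moreover have "range h \<subseteq> skorohod_space" using h(1) by blast
  ultimately have "\<forall>\<^sub>F n in sequentially. h n \<in> U"
    using U g unfolding openin_skorohod_topology by blast
  then show False using h(3) by simp
qed

lemma indicator_loc_unif_lsc:
  assumes "openin skorohod_topology U"
  shows "loc_unif_lsc (indicator U)"
  unfolding loc_unif_lsc_def
proof (intro ballI allI impI)
  fix g :: "real \<Rightarrow> 'a" and \<eta> :: real assume "0 < \<eta>"
  show "\<exists>K \<epsilon>. 0 < \<epsilon> \<and> (\<forall>h\<in>skorohod_space. (\<forall>t\<in>{0..K}. dist (g t) (h t) \<le> \<epsilon>) \<longrightarrow> indicator U g - \<eta> \<le> (indicator U h :: real))"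
  proof (cases "g \<in> U")
    case True
    then obtain K \<epsilon> where "0 < \<epsilon>" "\<And>h. h \<in> skorohod_space \<Longrightarrow> \<forall>t\<in>{0..K}. dist (g t) (h t) \<le> \<epsilon> \<Longrightarrow> h \<in> U"
      using skorohod_open_neighbourhood[OF assms] by metis
    with \<open>0 < \<eta>\<close> show ?thesis by (intro exI[of _ K] exI[of _ \<epsilon>]) (auto simp: indicator_def)
  next
    case False
    with \<open>0 < \<eta>\<close> show ?thesis by (intro exI[of _ 0] exI[of _ 1]) (auto simp: indicator_def)
  qed
qed

lemma continuous_loc_unif_lsc:
  assumes "continuous_map skorohod_topology euclideanreal f"
  shows "loc_unif_lsc f"
  unfolding loc_unif_lsc_def
proof (intro ballI allI impI)
  fix g :: "real \<Rightarrow> 'a" and \<eta> :: real assume "0 < \<eta>" and g: "g \<in> skorohod_space"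
  define U where "U = {h \<in> topspace skorohod_topology. f h \<in> {f g - \<eta><..}}"
  have "openin skorohod_topology U"
    unfolding U_def by (rule openin_continuous_map_preimage[OF assms]) simp
  moreover have "g \<in> U" using g \<open>0 < \<eta>\<close> by (simp add: U_def topspace_skorohod_topology)
  ultimately obtain K \<epsilon> where K: "0 < \<epsilon>" "\<forall>h\<in>skorohod_space. (\<forall>t\<in>{0..K}. dist (g t) (h t) \<le> \<epsilon>) \<longrightarrow> h \<in> U"
    using skorohod_open_neighbourhood by blast
  show "\<exists>K \<epsilon>. 0 < \<epsilon> \<and> (\<forall>h\<in>skorohod_space. (\<forall>t\<in>{0..K}. dist (g t) (h t) \<le> \<epsilon>) \<longrightarrow> f g - \<eta> \<le> f h)"
    using K by (intro exI[of _ K] exI[of _ \<epsilon>]) (auto simp: U_def)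
qed

lemma space_borel_of: "space (borel_of T) = topspace T"
  unfolding borel_of_def by (rule space_measure_of) (auto dest: openin_subset)

lemma sets_borel_of: "sets (borel_of T) = sigma_sets (topspace T) {U. openin T U}"
  unfolding borel_of_def by (rule sets_measure_of) (auto dest: openin_subset)

lemma continuous_map_borel_of:
  assumes "continuous_map T euclidean f"
  shows "f \<in> borel_measurable (borel_of T)"
proof (rule borel_measurableI)
  fix S :: "'b set" assume "open S"
  then have "openin T {x \<in> topspace T. f x \<in> S}"
    by (intro openin_continuous_map_preimage[OF assms]) simp
  moreover have "f -` S \<inter> space (borel_of T) = {x \<in> topspace T. f x \<in> S}"
    by (auto simp: space_borel_of)
  ultimately show "f -` S \<inter> space (borel_of T) \<in> sets (borel_of T)"
    by (simp add: sets_borel_of sigma_sets.Basic)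
qed

text \<open>
  Measurability in terms of locally Lipschitz functionals. For step paths and continuous paths it reduces to
  measurability at fixed times, and it implies measurability for the Borel sets of the Skorohod topology.
\<close>

definition path_measurable :: "'a measure \<Rightarrow> ('a \<Rightarrow> real \<Rightarrow> 'b::metric_space) \<Rightarrow> bool" where
  "path_measurable M Y \<longleftrightarrow> (\<forall>\<omega>\<in>space M. Y \<omega> \<in> skorohod_space) \<and>
     (\<forall>L \<Phi>. 0 \<le> L \<longrightarrow> loc_lip L \<Phi> \<longrightarrow> (\<lambda>\<omega>. \<Phi> (Y \<omega>)) \<in> borel_measurable M)"

lemma path_measurableD:
  assumes "path_measurable M Y"
  shows "\<omega> \<in> space M \<Longrightarrow> Y \<omega> \<in> skorohod_space"
    and "0 \<le> L \<Longrightarrow> loc_lip L \<Phi> \<Longrightarrow> (\<lambda>\<omega>. \<Phi> (Y \<omega>)) \<in> borel_measurable M"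
  using assms unfolding path_measurable_def by blast+

lemma path_measurable_lsc:
  assumes Y: "path_measurable M Y"
    and f0: "\<And>h. h \<in> skorohod_space \<Longrightarrow> 0 \<le> f h" and fB: "\<And>h. h \<in> skorohod_space \<Longrightarrow> f h \<le> B"
    and lsc: "loc_unif_lsc f"
  shows "(\<lambda>\<omega>. f (Y \<omega>)) \<in> borel_measurable M"
proof (rule borel_measurable_LIMSEQ_real)
  show "(\<lambda>i. infconv (real i) f (Y \<omega>)) \<longlonglongrightarrow> f (Y \<omega>)" if "\<omega> \<in> space M" for \<omega>
    using Y that by (intro infconv_tendsto[OF f0 fB lsc]) (auto simp: path_measurable_def)
  show "(\<lambda>\<omega>. infconv (real i) f (Y \<omega>)) \<in> borel_measurable M" for i
    by (rule path_measurableD(2)[OF Y _ infconv_loc_lip[OF f0 fB]]) auto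
qed

text \<open>
  The indicator of an open set is lower semicontinuous, hence a limit of locally Lipschitz
  functionals.
\<close>

lemma path_measurable_borel_of:
  assumes Y: "path_measurable M Y"
  shows "Y \<in> measurable M (borel_of skorohod_topology)"
  unfolding borel_of_def
proof (rule measurable_measure_of)
  show "{U. openin skorohod_topology U} \<subseteq> Pow (topspace skorohod_topology)"
    by (auto dest: openin_subset)
  show "Y \<in> space M \<rightarrow> topspace skorohod_topology"
    using Y by (auto simp: path_measurable_def topspace_skorohod_topology)
  fix U assume "U \<in> {U. openin (skorohod_topology :: (real \<Rightarrow> 'b) topology) U}"
  then have "loc_unif_lsc (indicator U)" by (intro indicator_loc_unif_lsc) auto
  then have "(\<lambda>\<omega>. indicator U (Y \<omega>) :: real) \<in> borel_measurable M"
    by (rule path_measurable_lsc[OF Y, rotated 2, of _ 1]) (auto simp: indicator_def)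
  then have "(\<lambda>\<omega>. indicator U (Y \<omega>) :: real) -` {1} \<inter> space M \<in> sets M"
    by (rule measurable_sets) simp
  moreover have "(\<lambda>\<omega>. indicator U (Y \<omega>) :: real) -` {1} \<inter> space M = Y -` U \<inter> space M"
    by (auto simp: indicator_def split: if_splits)
  ultimately show "Y -` U \<inter> space M \<in> sets M" by simp
qed

text \<open>
  For large \<open>L\<close> the inf-convolution has almost the same expectation under the limit as \<open>f\<close>; its
  expectations converge, and it lies below \<open>f\<close>.
\<close>

lemma lsc_expectation_liminf:
  fixes Y :: "nat \<Rightarrow> 'a \<Rightarrow> real \<Rightarrow> 'b::metric_space"
  assumes M: "prob_space M" and N: "prob_space N"
    and Y: "\<And>n. path_measurable M (Y n)" and Z: "path_measurable N Z"
    and conv: "\<And>L C \<Phi>. 0 \<le> L \<Longrightarrow> loc_lip L \<Phi> \<Longrightarrow> (\<And>g. \<bar>\<Phi> g\<bar> \<le> C) \<Longrightarrow>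
        (\<lambda>n. \<integral>\<omega>. \<Phi> (Y n \<omega>) \<partial>M) \<longlonglongrightarrow> (\<integral>\<omega>. \<Phi> (Z \<omega>) \<partial>N)"
    and f0: "\<And>h. h \<in> skorohod_space \<Longrightarrow> 0 \<le> f h" and fB: "\<And>h. h \<in> skorohod_space \<Longrightarrow> f h \<le> B"
    and lsc: "loc_unif_lsc f" and \<eta>: "0 < \<eta>"
  shows "\<forall>\<^sub>F n in sequentially. (\<integral>\<omega>. f (Z \<omega>) \<partial>N) - \<eta> < (\<integral>\<omega>. f (Y n \<omega>) \<partial>M)"
proof -
  interpret M: prob_space M by fact
  interpret N: prob_space N by fact
  have pm: "(\<lambda>\<omega>. infconv (real L) f (Y n \<omega>)) \<in> borel_measurable M"
    "(\<lambda>\<omega>. infconv (real L) f (Z \<omega>)) \<in> borel_measurable N" for n L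
    by (rule path_measurableD(2)[OF Y _ infconv_loc_lip[OF f0 fB]], auto)
       (rule path_measurableD(2)[OF Z _ infconv_loc_lip[OF f0 fB]], auto)
  have fm: "(\<lambda>\<omega>. f (Y n \<omega>)) \<in> borel_measurable M" "(\<lambda>\<omega>. f (Z \<omega>)) \<in> borel_measurable N" for n
    using path_measurable_lsc[OF _ f0 fB lsc] Y Z by blast+
  have D: "Y n \<omega> \<in> skorohod_space" if "\<omega> \<in> space M" for n \<omega>
    using Y that unfolding path_measurable_def by blast
  have DZ: "Z \<omega> \<in> skorohod_space" if "\<omega> \<in> space N" for \<omega>
    using Z that unfolding path_measurable_def by blast
  have "(\<lambda>L. \<integral>\<omega>. infconv (real L) f (Z \<omega>) \<partial>N) \<longlonglongrightarrow> (\<integral>\<omega>. f (Z \<omega>) \<partial>N)"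
  proof (rule integral_dominated_convergence[where w = "\<lambda>_. B"])
    show "AE \<omega> in N. (\<lambda>L. infconv (real L) f (Z \<omega>)) \<longlonglongrightarrow> f (Z \<omega>)"
      by (rule AE_I2) (rule infconv_tendsto[OF f0 fB lsc DZ])
    show "AE \<omega> in N. norm (infconv (real L) f (Z \<omega>)) \<le> B" for L
      by (rule AE_I2) (use infconv_le[of f B "real L", OF f0 fB _ DZ] infconv_nonneg[of f B "real L", OF f0 fB] fB[OF DZ] in
           \<open>force simp: real_norm_def\<close>)
  qed (use pm fm in auto)
  from order_tendstoD(1)[OF this, of "(\<integral>\<omega>. f (Z \<omega>) \<partial>N) - \<eta> / 2"] \<eta>
  obtain L where L: "(\<integral>\<omega>. f (Z \<omega>) \<partial>N) - \<eta> / 2 < (\<integral>\<omega>. infconv (real L) f (Z \<omega>) \<partial>N)"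
    unfolding eventually_sequentially by auto
  have "(\<lambda>n. \<integral>\<omega>. infconv (real L) f (Y n \<omega>) \<partial>M) \<longlonglongrightarrow> (\<integral>\<omega>. infconv (real L) f (Z \<omega>) \<partial>N)"
    by (rule conv[of "real L" _ "B + real L"])
       (auto intro!: infconv_loc_lip infconv_abs_le f0 fB)
  from order_tendstoD(1)[OF this, of "(\<integral>\<omega>. infconv (real L) f (Z \<omega>) \<partial>N) - \<eta> / 2"] \<eta>
  have "\<forall>\<^sub>F n in sequentially. (\<integral>\<omega>. infconv (real L) f (Z \<omega>) \<partial>N) - \<eta> / 2 < (\<integral>\<omega>. infconv (real L) f (Y n \<omega>) \<partial>M)"
    by simp
  then show ?thesis
  proof eventually_elim
    case (elim n)
    have "(\<integral>\<omega>. infconv (real L) f (Y n \<omega>) \<partial>M) \<le> (\<integral>\<omega>. f (Y n \<omega>) \<partial>M)"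
    proof (rule integral_mono)
      show "integrable M (\<lambda>\<omega>. infconv (real L) f (Y n \<omega>))"
        by (rule M.integrable_const_bound[of _ "B + real L"]) (auto intro!: infconv_abs_le f0 fB pm)
      show "integrable M (\<lambda>\<omega>. f (Y n \<omega>))"
        by (rule M.integrable_const_bound[of _ B]) (auto intro!: AE_I2 simp: fm abs_of_nonneg[OF f0[OF D]] fB[OF D])
      show "infconv (real L) f (Y n \<omega>) \<le> f (Y n \<omega>)" if "\<omega> \<in> space M" for \<omega>
        by (rule infconv_le[OF f0 fB _ D[OF that]]) auto
    qed
    with elim L show ?case by linarith
  qed
qed

text \<open>
  Expectations of bounded continuous functions converge because both \<open>B + f\<close> and \<open>B - f\<close> are nonnegative
  and lower semicontinuous: the first gives the lower bound, the second the upper bound.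
\<close>

theorem converges_in_distribution_skorohodI:
  fixes Y :: "nat \<Rightarrow> 'a \<Rightarrow> real \<Rightarrow> 'b::metric_space"
  assumes M: "prob_space M" and N: "prob_space N"
    and Y: "\<And>n. path_measurable M (Y n)" and Z: "path_measurable N Z"
    and conv: "\<And>L C \<Phi>. 0 \<le> L \<Longrightarrow> loc_lip L \<Phi> \<Longrightarrow> (\<And>g. \<bar>\<Phi> g\<bar> \<le> C) \<Longrightarrow>
        (\<lambda>n. \<integral>\<omega>. \<Phi> (Y n \<omega>) \<partial>M) \<longlonglongrightarrow> (\<integral>\<omega>. \<Phi> (Z \<omega>) \<partial>N)"
  shows "converges_in_distribution skorohod_topology M Y N Z"
proof -
  interpret M: prob_space M by fact
  interpret N: prob_space N by fact
  have Ym: "Y n \<in> measurable M (borel_of skorohod_topology)" for n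
    by (rule path_measurable_borel_of[OF Y])
  have Zm: "Z \<in> measurable N (borel_of skorohod_topology)"
    by (rule path_measurable_borel_of[OF Z])
  have lim: "(\<lambda>n. \<integral>g. f g \<partial>distr M (borel_of skorohod_topology) (Y n)) \<longlonglongrightarrow> (\<integral>g. f g \<partial>distr N (borel_of skorohod_topology) Z)"
    if f: "continuous_map skorohod_topology euclideanreal f" and bdd: "bounded (f ` topspace skorohod_topology)" for f
  proof -
    have fm: "f \<in> borel_measurable (borel_of skorohod_topology)"
      by (rule continuous_map_borel_of[OF f])
    obtain B where "\<And>g. g \<in> skorohod_space \<Longrightarrow> \<bar>f g\<bar> \<le> B"
      using bdd unfolding bounded_iff topspace_skorohod_topology by (auto simp: real_norm_def)
    then have B: "- B \<le> f g" "f g \<le> B" if "g \<in> skorohod_space" for g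
      using that abs_le_iff[of "f g" B] by force+
    have D: "Y n \<omega> \<in> skorohod_space" if "\<omega> \<in> space M" for n \<omega>
      using Y that unfolding path_measurable_def by blast
    have DZ: "Z \<omega> \<in> skorohod_space" if "\<omega> \<in> space N" for \<omega>
      using Z that unfolding path_measurable_def by blast
    have iY: "integrable M (\<lambda>\<omega>. f (Y n \<omega>))" for n
      by (rule M.integrable_const_bound[of _ B])
         (use B D measurable_compose[OF Ym fm] in \<open>auto simp: abs_le_iff minus_le_iff\<close>)
    have iZ: "integrable N (\<lambda>\<omega>. f (Z \<omega>))"
      by (rule N.integrable_const_bound[of _ B])
         (use B DZ measurable_compose[OF Zm fm] in \<open>auto simp: abs_le_iff minus_le_iff\<close>)
    have "(\<lambda>n. \<integral>\<omega>. f (Y n \<omega>) \<partial>M) \<longlonglongrightarrow> (\<integral>\<omega>. f (Z \<omega>) \<partial>N)"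
    proof (rule LIMSEQ_I)
      fix r :: real assume "0 < r"
      have "loc_unif_lsc (\<lambda>g. B + f g)" "loc_unif_lsc (\<lambda>g. B - f g)"
        by (rule continuous_loc_unif_lsc, intro continuous_intros f)+
      note lsc = this
      have "\<forall>\<^sub>F n in sequentially. (\<integral>\<omega>. B + f (Z \<omega>) \<partial>N) - r < (\<integral>\<omega>. B + f (Y n \<omega>) \<partial>M)"
        by (rule lsc_expectation_liminf[OF M N Y Z conv _ _ lsc(1) \<open>0 < r\<close>, where B = "2 * B"]) (use B in force)+
      moreover have "\<forall>\<^sub>F n in sequentially. (\<integral>\<omega>. B - f (Z \<omega>) \<partial>N) - r < (\<integral>\<omega>. B - f (Y n \<omega>) \<partial>M)"
        by (rule lsc_expectation_liminf[OF M N Y Z conv _ _ lsc(2) \<open>0 < r\<close>, where B = "2 * B"]) (use B in force)+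
      ultimately have "\<forall>\<^sub>F n in sequentially. norm ((\<integral>\<omega>. f (Y n \<omega>) \<partial>M) - (\<integral>\<omega>. f (Z \<omega>) \<partial>N)) < r"
        by eventually_elim (auto simp: iY iZ M.prob_space N.prob_space real_norm_def abs_less_iff)
      then show "\<exists>no. \<forall>n\<ge>no. norm ((\<integral>\<omega>. f (Y n \<omega>) \<partial>M) - (\<integral>\<omega>. f (Z \<omega>) \<partial>N)) < r"
        by (simp add: eventually_sequentially)
    qed
    then show ?thesis by (simp add: integral_distr[OF Ym fm] integral_distr[OF Zm fm])
  qed
  show ?thesis
    unfolding converges_in_distribution_def weakly_converges_def
    using Ym Zm lim by (auto intro: M.prob_space_distr N.prob_space_distr)
qed

section \<open>Step paths and continuous paths\<close>

lemma loc_lip_cong: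
  assumes "loc_lip L \<Phi>" "\<And>t. 0 \<le> t \<Longrightarrow> t \<le> L \<Longrightarrow> g t = h t"
  shows "\<Phi> g = \<Phi> h"
  using loc_lipD[OF assms(1), of 0 g h] assms(2) by simp

text \<open>
  A path that only takes the values \<open>y 0, \<dots>, y k\<close> on \<open>[0, L]\<close> depends uniformly on these values.
\<close>

lemma loc_lip_step_continuous:
  fixes c :: "real \<Rightarrow> 'b::real_normed_vector"
  assumes lip: "loc_lip L \<Phi>" and "0 \<le> L" and r: "\<And>t. 0 \<le> t \<Longrightarrow> t \<le> L \<Longrightarrow> r t \<le> (k::nat)"
  shows "continuous_on UNIV (\<lambda>y. \<Phi> (\<lambda>t. y (r t) + c t))"
  unfolding continuous_on_def
proof
  fix z :: "nat \<Rightarrow> 'b"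
  have "continuous_on UNIV (\<lambda>y. L * (\<Sum>i\<le>k. dist (y i) (z i)))"
    by (intro continuous_intros continuous_on_product_coordinates)
  then have "((\<lambda>y. L * (\<Sum>i\<le>k. dist (y i) (z i))) \<longlongrightarrow> L * (\<Sum>i\<le>k. dist (z i) (z i))) (at z within UNIV)"
    unfolding continuous_on_def by blast
  then have lim: "((\<lambda>y. L * (\<Sum>i\<le>k. dist (y i) (z i))) \<longlongrightarrow> 0) (at z within UNIV)" by simp
  have "dist (\<Phi> (\<lambda>t. y (r t) + c t)) (\<Phi> (\<lambda>t. z (r t) + c t)) \<le> L * (\<Sum>i\<le>k. dist (y i) (z i))" for y
    unfolding dist_real_def
  proof (rule loc_lipD[OF lip])
    show "0 \<le> (\<Sum>i\<le>k. dist (y i) (z i))" by (intro sum_nonneg) auto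
    fix t assume "0 \<le> t" "t \<le> L"
    then have "r t \<in> {..k}" using r by simp
    then show "dist (y (r t) + c t) (z (r t) + c t) \<le> (\<Sum>i\<le>k. dist (y i) (z i))"
      by (simp only: dist_add_cancel2) (rule member_le_sum, auto)
  qed
  then show "((\<lambda>y. \<Phi> (\<lambda>t. y (r t) + c t)) \<longlongrightarrow> \<Phi> (\<lambda>t. z (r t) + c t)) (at z within UNIV)"
    by (subst tendsto_dist_iff) (rule tendsto_sandwich[OF _ _ tendsto_const lim], auto)
qed

lemma nat_floor_mult_mono:
  assumes "0 \<le> a" "t \<le> L"
  shows "nat \<lfloor>a * t\<rfloor> \<le> nat \<lfloor>a * L\<rfloor>"
  using assms by (intro nat_mono floor_mono mult_left_mono) auto

lemma loc_lip_step_measurable: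
  fixes y :: "nat \<Rightarrow> 'a \<Rightarrow> 'b::euclidean_space"
  assumes lip: "loc_lip L \<Phi>" and L: "0 \<le> L" and a: "0 \<le> a" and y: "\<And>i. y i \<in> borel_measurable M"
  shows "(\<lambda>\<omega>. \<Phi> (\<lambda>t. y (nat \<lfloor>a * t\<rfloor>) \<omega> + c t)) \<in> borel_measurable M"
proof -
  have 1: "(\<lambda>\<omega> i. y i \<omega>) \<in> borel_measurable M"
    using y by (intro measurable_coordinatewise_then_product) simp
  have 2: "(\<lambda>y. \<Phi> (\<lambda>t. y (nat \<lfloor>a * t\<rfloor>) + c t)) \<in> borel_measurable borel"
    by (rule borel_measurable_continuous_onI, rule loc_lip_step_continuous[OF lip L])
       (rule nat_floor_mult_mono[OF a])
  show ?thesis using measurable_compose[OF 1 2] by simp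
qed

text \<open>
  A continuous path is uniformly continuous on \<open>[0, L]\<close>, so it is uniformly close to its discretisations.
\<close>

lemma grid_discretisation_tendsto:
  fixes z :: "real \<Rightarrow> 'b::metric_space"
  assumes lip: "loc_lip L \<Phi>" and L: "0 \<le> L" and cont: "continuous_on {0..} z"
  shows "(\<lambda>m. \<Phi> (\<lambda>t. z (real (nat \<lfloor>real m * t\<rfloor>) / real m))) \<longlonglongrightarrow> \<Phi> z"
proof (rule LIMSEQ_I)
  fix r :: real assume "0 < r"
  define \<delta> where "\<delta> = r / 2 / (L + 1)"
  have "0 < \<delta>" using \<open>0 < r\<close> L by (simp add: \<delta>_def)
  have "L * \<delta> \<le> (L + 1) * \<delta>" using \<open>0 < \<delta>\<close> by simp
  also have "(L + 1) * \<delta> = r / 2"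
  proof -
    have "L + 1 \<noteq> 0" using L by simp
    then have "\<delta> * (L + 1) = r / 2" unfolding \<delta>_def by (rule nonzero_eq_divide_eq[THEN iffD1]) (rule refl)
    then show ?thesis by (simp only: mult.commute)
  qed
  finally have L\<delta>: "L * \<delta> < r" using \<open>0 < r\<close> by linarith
  have "uniformly_continuous_on {0..L} z"
    by (rule compact_uniformly_continuous) (auto intro: continuous_on_subset[OF cont])
  then obtain d where d: "0 < d"
    "\<And>s t. s \<in> {0..L} \<Longrightarrow> t \<in> {0..L} \<Longrightarrow> dist s t < d \<Longrightarrow> dist (z s) (z t) < \<delta>"
    using \<open>0 < \<delta>\<close> unfolding uniformly_continuous_on_def by metis
  obtain m0 where m0: "1 / d < real m0" using reals_Archimedean2 by blast
  have "norm (\<Phi> (\<lambda>t. z (real (nat \<lfloor>real m * t\<rfloor>) / real m)) - \<Phi> z) < r" if "m0 \<le> m" for m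
  proof -
    have "1 / d < real m" using m0 that by simp
    then have m: "0 < real m" using d(1) by (meson less_trans zero_less_divide_1_iff)
    with \<open>1 / d < real m\<close> have md: "1 / real m < d" using d(1) by (simp add: field_simps)
    have "dist (z (real (nat \<lfloor>real m * t\<rfloor>) / real m)) (z t) \<le> \<delta>" if t: "0 \<le> t" "t \<le> L" for t
    proof -
      define u where "u = real (nat \<lfloor>real m * t\<rfloor>) / real m"
      have "real (nat \<lfloor>real m * t\<rfloor>) \<le> real m * t" "real m * t < real (nat \<lfloor>real m * t\<rfloor>) + 1"
        using t m by (simp_all add: of_nat_nat)
      then have u: "u \<le> t" "t < u + 1 / real m" "0 \<le> u"
        using m by (simp_all add: u_def field_simps)
      then have "dist u t < d" using md by (simp add: dist_real_def)
      then show ?thesis unfolding u_def[symmetric] using t u by (intro less_imp_le d(2)) auto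
    qed
    then have "\<bar>\<Phi> (\<lambda>t. z (real (nat \<lfloor>real m * t\<rfloor>) / real m)) - \<Phi> z\<bar> \<le> L * \<delta>"
      using \<open>0 < \<delta>\<close> by (intro loc_lipD[OF lip]) auto
    with L\<delta> show ?thesis by simp
  qed
  then show "\<exists>no. \<forall>n\<ge>no. norm (\<Phi> (\<lambda>t. z (real (nat \<lfloor>real n * t\<rfloor>) / real n)) - \<Phi> z) < r" by blast
qed

lemma continuous_functional_measurable:
  fixes Z :: "real \<Rightarrow> 'w \<Rightarrow> 'b::euclidean_space"
  assumes Zm: "\<And>t. 0 \<le> t \<Longrightarrow> Z t \<in> borel_measurable N"
    and Zc: "\<And>\<omega>. \<omega> \<in> space N \<Longrightarrow> continuous_on {0..} (\<lambda>t. Z t \<omega>)"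
    and L: "0 \<le> L" and lip: "loc_lip L \<Phi>"
  shows "(\<lambda>\<omega>. \<Phi> (\<lambda>t. Z t \<omega>)) \<in> borel_measurable N"
    and "(\<lambda>\<omega>. \<Phi> (\<lambda>t. Z (real (nat \<lfloor>real m * t\<rfloor>) / real m) \<omega>)) \<in> borel_measurable N"
proof -
  show grid: "(\<lambda>\<omega>. \<Phi> (\<lambda>t. Z (real (nat \<lfloor>real m * t\<rfloor>) / real m) \<omega>)) \<in> borel_measurable N" for m
    using loc_lip_step_measurable[OF lip L, of "real m" "\<lambda>i. Z (real i / real m)" N "\<lambda>_. 0"] Zm by simp
  show "(\<lambda>\<omega>. \<Phi> (\<lambda>t. Z t \<omega>)) \<in> borel_measurable N"
    by (rule borel_measurable_LIMSEQ_real[OF grid_discretisation_tendsto[OF lip L Zc] grid])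
qed

text \<open>
  The index \<open>\<lfloor>a * t\<rfloor>\<close> is constant immediately to the right of every time, and constant with value
  \<open>\<lceil>a * t\<rceil> - 1\<close> immediately to the left of every positive time (when \<open>a > 0\<close>).
\<close>

lemma step_path_in_skorohod_space:
  fixes h :: "real \<Rightarrow> 'b::real_normed_vector"
  assumes a: "0 \<le> a" and h: "continuous_on UNIV h"
  shows "(\<lambda>t\<in>{0..}. y (nat \<lfloor>a * t\<rfloor>) + h t) \<in> skorohod_space"
proof -
  let ?F = "\<lambda>t\<in>{0..}. y (nat \<lfloor>a * t\<rfloor>) + h t"
  have lim: "((\<lambda>s. y k + h s) \<longlongrightarrow> y k + h t) (at t within A)" for k t A
    using h by (intro tendsto_add tendsto_const) (meson UNIV_I continuous_on_def subset_UNIV tendsto_within_subset)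
  have right: "continuous (at_right t) ?F" if t: "0 \<le> t" for t
  proof -
    have "\<forall>\<^sub>F s in at_right t. \<lfloor>a * s\<rfloor> = \<lfloor>a * t\<rfloor>"
    proof (cases "a = 0")
      case False
      with a have "0 < a" by simp
      then have "t < (real_of_int \<lfloor>a * t\<rfloor> + 1) / a"
        by (simp add: pos_less_divide_eq mult.commute)
      then have "\<forall>\<^sub>F s in at_right t. s \<in> {t<..<(real_of_int \<lfloor>a * t\<rfloor> + 1) / a}"
        by (rule eventually_at_right_real)
      then show ?thesis
      proof eventually_elim
        case (elim s)
        have "a * t \<le> a * s" "a * s < real_of_int \<lfloor>a * t\<rfloor> + 1"
          using elim \<open>0 < a\<close> by (simp_all add: pos_less_divide_eq mult.commute)
        then show ?case by (intro floor_unique) (auto intro: order_trans[OF of_int_floor_le])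
      qed
    qed simp
    then have "\<forall>\<^sub>F s in at_right t. y (nat \<lfloor>a * t\<rfloor>) + h s = ?F s"
      using eventually_at_right_less[of t] by eventually_elim (use t in auto)
    from Lim_transform_eventually[OF lim this]
    have "(?F \<longlongrightarrow> y (nat \<lfloor>a * t\<rfloor>) + h t) (at_right t)" .
    moreover have Ft: "?F t = y (nat \<lfloor>a * t\<rfloor>) + h t" using t by simp
    ultimately show ?thesis unfolding continuous_within Ft by blast
  qed
  have left: "\<exists>l. (?F \<longlongrightarrow> l) (at_left t)" if t: "0 < t" for t
  proof -
    have "\<exists>k. \<forall>\<^sub>F s in at_left t. nat \<lfloor>a * s\<rfloor> = k"
    proof (cases "a = 0")
      case False
      with a have "0 < a" by simp
      have "real_of_int (\<lceil>a * t\<rceil> - 1) / a < t"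
        using \<open>0 < a\<close> ceiling_correct[of "a * t"] by (simp add: pos_divide_less_eq mult.commute)
      then have "\<forall>\<^sub>F s in at_left t. s \<in> {real_of_int (\<lceil>a * t\<rceil> - 1) / a<..<t}"
        by (rule eventually_at_left_real)
      then have "\<forall>\<^sub>F s in at_left t. \<lfloor>a * s\<rfloor> = \<lceil>a * t\<rceil> - 1"
      proof eventually_elim
        case (elim s)
        have "real_of_int (\<lceil>a * t\<rceil> - 1) < a * s" "a * s < a * t"
          using elim \<open>0 < a\<close> by (simp_all add: pos_divide_less_eq mult.commute)
        moreover have "a * s < real_of_int \<lceil>a * t\<rceil>"
          using calculation(2) le_of_int_ceiling[of "a * t"] by linarith
        ultimately show ?case by (intro floor_unique) auto
      qed
      then show ?thesis by (intro exI[of _ "nat (\<lceil>a * t\<rceil> - 1)"]) (auto elim: eventually_mono)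
    qed auto
    then obtain k where "\<forall>\<^sub>F s in at_left t. nat \<lfloor>a * s\<rfloor> = k" by blast
    then have "\<forall>\<^sub>F s in at_left t. y k + h s = ?F s"
      using eventually_at_left_real[OF t] by eventually_elim auto
    from Lim_transform_eventually[OF lim this] show ?thesis by blast
  qed
  show ?thesis unfolding skorohod_space_def using right left by simp
qed

lemma continuous_path_in_skorohod_space:
  fixes z :: "real \<Rightarrow> 'b::metric_space"
  assumes z: "continuous_on {0..} z"
  shows "(\<lambda>t\<in>{0..}. z t) \<in> skorohod_space"
proof -
  let ?F = "\<lambda>t\<in>{0..}. z t"
  have lim: "(z \<longlongrightarrow> z t) (at t within {0..})" if "0 \<le> t" for t
    using z that by (simp add: continuous_on_def)
  have right: "continuous (at_right t) ?F" if t: "0 \<le> t" for t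
  proof -
    have "(z \<longlongrightarrow> z t) (at_right t)" by (rule tendsto_within_subset[OF lim[OF t]]) (use t in auto)
    moreover have "\<forall>\<^sub>F s in at_right t. z s = ?F s"
      using eventually_at_right_less[of t] by eventually_elim (use t in auto)
    ultimately have "(?F \<longlongrightarrow> z t) (at_right t)" by (rule Lim_transform_eventually)
    moreover have Ft: "?F t = z t" using t by simp
    ultimately show ?thesis unfolding continuous_within Ft by blast
  qed
  have left: "\<exists>l. (?F \<longlongrightarrow> l) (at_left t)" if t: "0 < t" for t
  proof -
    have "at t within {0..} = at t" by (rule at_within_interior, rule interiorI[of "{0<..}"]) (use t in auto)
    then have "(z \<longlongrightarrow> z t) (at_left t)" using lim[of t] t by (simp add: filterlim_at_split)
    moreover have "\<forall>\<^sub>F s in at_left t. z s = ?F s"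
      using eventually_at_left_real[OF t] by eventually_elim auto
    ultimately have "(?F \<longlongrightarrow> z t) (at_left t)" by (rule Lim_transform_eventually)
    then show ?thesis by blast
  qed
  show ?thesis unfolding skorohod_space_def using right left by simp
qed

lemma step_path_measurable:
  fixes y :: "nat \<Rightarrow> 'a \<Rightarrow> 'b::euclidean_space"
  assumes a: "0 \<le> a" and h: "continuous_on UNIV h" and y: "\<And>i. y i \<in> borel_measurable M"
  shows "path_measurable M (\<lambda>\<omega>. \<lambda>t\<in>{0..}. y (nat \<lfloor>a * t\<rfloor>) \<omega> + h t)"
  unfolding path_measurable_def
proof (intro conjI ballI allI impI)
  show "(\<lambda>t\<in>{0..}. y (nat \<lfloor>a * t\<rfloor>) \<omega> + h t) \<in> skorohod_space" for \<omega>
    using step_path_in_skorohod_space[OF a h, where y = "\<lambda>i. y i \<omega>"] .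
  fix L and \<Phi> :: "(real \<Rightarrow> 'b) \<Rightarrow> real" assume L: "0 \<le> L" and lip: "loc_lip L \<Phi>"
  have "\<Phi> (\<lambda>t\<in>{0..}. y (nat \<lfloor>a * t\<rfloor>) \<omega> + h t) = \<Phi> (\<lambda>t. y (nat \<lfloor>a * t\<rfloor>) \<omega> + h t)" for \<omega>
    by (rule loc_lip_cong[OF lip]) simp
  moreover have "(\<lambda>\<omega>. \<Phi> (\<lambda>t. y (nat \<lfloor>a * t\<rfloor>) \<omega> + h t)) \<in> borel_measurable M"
    by (rule loc_lip_step_measurable[OF lip L a y])
  ultimately show "(\<lambda>\<omega>. \<Phi> (\<lambda>t\<in>{0..}. y (nat \<lfloor>a * t\<rfloor>) \<omega> + h t)) \<in> borel_measurable M" by simp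
qed

text \<open>
  A functional of a continuous process is the limit of the functional of its discretisations, which
  involve countably many random vectors.
\<close>

lemma continuous_process_measurable:
  fixes Z :: "real \<Rightarrow> 'w \<Rightarrow> 'b::euclidean_space"
  assumes Zm: "\<And>t. 0 \<le> t \<Longrightarrow> Z t \<in> borel_measurable N"
    and Zc: "\<And>\<omega>. \<omega> \<in> space N \<Longrightarrow> continuous_on {0..} (\<lambda>t. Z t \<omega>)"
  shows "path_measurable N (\<lambda>\<omega>. \<lambda>t\<in>{0..}. Z t \<omega>)"
  unfolding path_measurable_def
proof (intro conjI ballI allI impI)
  show "(\<lambda>t\<in>{0..}. Z t \<omega>) \<in> skorohod_space" if "\<omega> \<in> space N" for \<omega>
    by (rule continuous_path_in_skorohod_space[OF Zc[OF that]])
  fix L and \<Phi> :: "(real \<Rightarrow> 'b) \<Rightarrow> real" assume L: "0 \<le> L" and lip: "loc_lip L \<Phi>"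
  have "\<Phi> (\<lambda>t\<in>{0..}. Z t \<omega>) = \<Phi> (\<lambda>t. Z t \<omega>)" for \<omega>
    by (rule loc_lip_cong[OF lip]) simp
  then show "(\<lambda>\<omega>. \<Phi> (\<lambda>t\<in>{0..}. Z t \<omega>)) \<in> borel_measurable N"
    using continuous_functional_measurable[OF Zm Zc L lip] by simp
qed

section \<open>Martingales with bounded increments\<close>

lemma cos_add_taylor:
  fixes a z :: real
  shows "\<bar>cos (a + z) - (cos a - z * sin a - z\<^sup>2 / 2 * cos a)\<bar> \<le> \<bar>z\<bar> ^ 3"
proof -
  have sum: "(\<Sum>k\<le>2. (\<i> * complex_of_real z) ^ k / fact k) = 1 + \<i> * z - (z\<^sup>2 / 2)"
    by (simp add: eval_nat_numeral power_mult_distrib field_simps)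
  have "cos (a + z) - (cos a - z * sin a - z\<^sup>2 / 2 * cos a)
      = Re (cis a * (iexp z - (\<Sum>k\<le>2. (\<i> * complex_of_real z) ^ k / fact k)))"
    unfolding sum by (simp add: cis_conv_exp[symmetric] cos_add algebra_simps power2_eq_square)
  also have "\<bar>\<dots>\<bar> \<le> cmod (cis a * (iexp z - (\<Sum>k\<le>2. (\<i> * complex_of_real z) ^ k / fact k)))"
    by (rule abs_Re_le_cmod)
  also have "\<dots> \<le> \<bar>z\<bar> ^ 3 / fact 3"
    using iexp_approx1[of z 2] by (simp add: norm_mult eval_nat_numeral)
  also have "\<dots> \<le> \<bar>z\<bar> ^ 3"
    by (simp add: fact_numeral divide_le_eq)
  finally show ?thesis .
qed

lemma exp_minus_quadratic:
  fixes x :: real assumes "0 \<le> x"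
  shows "\<bar>exp (- x) - (1 - x)\<bar> \<le> x\<^sup>2"
proof -
  have "1 \<le> (1 - x + x\<^sup>2) * (1 + x)" using assms by (simp add: algebra_simps power2_eq_square)
  moreover have "exp (- x) * (1 + x) \<le> exp (- x) * exp x"
    by (intro mult_left_mono exp_ge_add_one_self) auto
  ultimately have "exp (- x) * (1 + x) \<le> (1 - x + x\<^sup>2) * (1 + x)"
    by (simp add: mult_exp_exp)
  then have "exp (- x) \<le> 1 - x + x\<^sup>2" using assms by (simp add: mult_le_cancel_right)
  then show ?thesis using exp_ge_add_one_self[of "- x"] by simp
qed

text \<open>
  Convexity of the fourth power of the norm: \<open>4 * (norm p)\<^sup>2 *\<^sub>R p\<close> is its gradient at \<open>p\<close>.
\<close>

lemma norm_pow4_add_lower: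
  fixes p z :: "'b::real_inner"
  shows "norm p ^ 4 + 4 * (norm p)\<^sup>2 * (p \<bullet> z) \<le> norm (p + z) ^ 4"
proof -
  define a b where "a = (norm p)\<^sup>2" and "b = 2 * (p \<bullet> z) + (norm z)\<^sup>2"
  have "(norm (p + z))\<^sup>2 = a + b"
    by (simp add: a_def b_def power2_norm_eq_inner inner_simps inner_commute)
  then have "norm (p + z) ^ 4 = (a + b)\<^sup>2"
    by (metis power_mult num_double numeral_times_numeral)
  moreover have "a\<^sup>2 + 4 * a * (p \<bullet> z) \<le> (a + b)\<^sup>2"
  proof -
    have "0 \<le> b\<^sup>2" "0 \<le> a * (norm z)\<^sup>2" by (auto simp: a_def)
    then show ?thesis by (simp add: b_def power2_eq_square algebra_simps)
  qed
  moreover have "norm p ^ 4 = a\<^sup>2" by (simp add: a_def flip: power_mult)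
  ultimately have "norm p ^ 4 + 4 * a * (p \<bullet> z) \<le> norm (p + z) ^ 4" by linarith
  then show ?thesis unfolding a_def .
qed

lemma norm_pow4_add_upper:
  fixes p z :: "'b::real_inner"
  assumes z: "norm z \<le> B"
  shows "norm (p + z) ^ 4 \<le> norm p ^ 4 + 4 * (norm p)\<^sup>2 * (p \<bullet> z) + 8 * B\<^sup>2 * (norm p)\<^sup>2 + 3 * B ^ 4"
proof -
  define a b c where "a = norm p" and "b = norm z" and "c = p \<bullet> z"
  have "norm (p + z) ^ 4 = (a\<^sup>2 + 2 * c + b\<^sup>2)\<^sup>2"
  proof -
    have "(norm (p + z))\<^sup>2 = a\<^sup>2 + 2 * c + b\<^sup>2"
      by (simp add: a_def b_def c_def power2_norm_eq_inner inner_simps inner_commute)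
    then show ?thesis by (metis power_mult num_double numeral_times_numeral)
  qed
  also have "\<dots> = a ^ 4 + 4 * a\<^sup>2 * c + (4 * c\<^sup>2 + 2 * a\<^sup>2 * b\<^sup>2 + 4 * c * b\<^sup>2 + b ^ 4)"
    by (simp add: power2_eq_square power4_eq_xxxx algebra_simps)
  also have "4 * c\<^sup>2 + 2 * a\<^sup>2 * b\<^sup>2 + 4 * c * b\<^sup>2 + b ^ 4 \<le> 8 * a\<^sup>2 * b\<^sup>2 + 3 * b ^ 4"
  proof -
    have "\<bar>c\<bar> \<le> a * b" unfolding a_def b_def c_def by (rule Cauchy_Schwarz_ineq2)
    then have "\<bar>c\<bar>\<^sup>2 \<le> (a * b)\<^sup>2" by (intro power_mono) auto
    moreover have "0 \<le> (c - b\<^sup>2)\<^sup>2" by simp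
    ultimately show ?thesis by (simp add: power2_eq_square power4_eq_xxxx algebra_simps)
  qed
  also have "8 * a\<^sup>2 * b\<^sup>2 + 3 * b ^ 4 \<le> 8 * a\<^sup>2 * B\<^sup>2 + 3 * B ^ 4"
    using z by (intro add_mono mult_left_mono power_mono) (auto simp: b_def)
  finally show ?thesis by (simp add: a_def c_def mult.commute mult.left_commute add.assoc)
qed

text \<open>
  The differences \<open>D j\<close> are bounded by \<open>B\<close>. Conditional expectations given \<open>F j\<close> are expressed by
  integrating against bounded \<open>F j\<close>-measurable weights. The conditional variance of \<open>\<theta> \<bullet> D j\<close> is \<open>q \<theta>\<close>
  off the event \<open>bad j\<close>, and the probabilities of these events are summable.
\<close>

locale bounded_martingale_differences = prob_space M for M :: "'a measure" +
  fixes F :: "nat \<Rightarrow> 'a measure" and D :: "nat \<Rightarrow> 'a \<Rightarrow> 'b::euclidean_space"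
    and B :: real and bad :: "nat \<Rightarrow> 'a set" and q :: "'b \<Rightarrow> real"
  assumes subalg: "subalgebra M (F j)"
    and filtration: "subalgebra (F (Suc j)) (F j)"
    and adapted: "D j \<in> borel_measurable (F (Suc j))"
    and bounded: "\<omega> \<in> space M \<Longrightarrow> norm (D j \<omega>) \<le> B"
    and martingale: "g \<in> borel_measurable (F j) \<Longrightarrow> (\<And>\<omega>. \<omega> \<in> space M \<Longrightarrow> norm (g \<omega>) \<le> C) \<Longrightarrow>
        (\<integral>\<omega>. g \<omega> \<bullet> D j \<omega> \<partial>M) = 0"
    and bad_sets: "bad j \<in> sets (F j)"
    and bad_summable: "summable (\<lambda>j. prob (bad j))"
    and variance: "h \<in> borel_measurable (F j) \<Longrightarrow> (\<And>\<omega>. \<omega> \<in> space M \<Longrightarrow> \<bar>h \<omega>\<bar> \<le> C) \<Longrightarrow>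
        (\<And>\<omega>. \<omega> \<in> bad j \<Longrightarrow> h \<omega> = 0) \<Longrightarrow>
        (\<integral>\<omega>. h \<omega> * (\<theta> \<bullet> D j \<omega>)\<^sup>2 \<partial>M) = q \<theta> * (\<integral>\<omega>. h \<omega> \<partial>M)"
    and q_nonneg: "0 \<le> q \<theta>"
begin

lemma B_nonneg: "0 \<le> B"
  using bounded[of _ 0] not_empty norm_ge_zero by (meson all_not_in_conv order_trans)

lemma filtration_mono: "i \<le> j \<Longrightarrow> subalgebra (F j) (F i)"
proof (induction j rule: dec_induct)
  case base
  show ?case by (simp add: subalgebra_def)
next
  case (step j)
  then show ?case using filtration[of j] by (auto simp: subalgebra_def)
qed

lemma measurable_M: "f \<in> borel_measurable (F j) \<Longrightarrow> f \<in> borel_measurable M"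
  using measurable_from_subalg[OF subalg] by blast

lemma measurable_mono: "f \<in> borel_measurable (F i) \<Longrightarrow> i \<le> j \<Longrightarrow> f \<in> borel_measurable (F j)"
  using measurable_from_subalg[OF filtration_mono] by blast

lemma space_F: "space (F j) = space M"
  using subalg[of j] by (simp add: subalgebra_def)

lemma D_measurable [measurable]: "D j \<in> borel_measurable M"
  by (rule measurable_M[OF adapted])

lemma bad_events [measurable]: "bad j \<in> events"
  using bad_sets[of j] subalg[of j] by (auto simp: subalgebra_def)

lemma bounded_integrable:
  fixes g :: "'a \<Rightarrow> 'c::{banach, second_countable_topology}"
  assumes "g \<in> borel_measurable M" "\<And>\<omega>. \<omega> \<in> space M \<Longrightarrow> norm (g \<omega>) \<le> C"
  shows "integrable M g"
  using assms by (intro integrable_const_bound[of _ C]) auto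

definition S :: "nat \<Rightarrow> 'a \<Rightarrow> 'b" where
  "S k \<omega> = (\<Sum>l<k. D l \<omega>)"

text \<open>
  The increment of the partial sums over the \<open>k\<close> steps that follow time \<open>b\<close>.
\<close>

definition incr :: "nat \<Rightarrow> nat \<Rightarrow> 'a \<Rightarrow> 'b" where
  "incr b k \<omega> = (\<Sum>l<k. D (b + l) \<omega>)"

lemma incr_Suc: "incr b (Suc k) \<omega> = incr b k \<omega> + D (b + k) \<omega>"
  by (simp add: incr_def)

lemma incr_0 [simp]: "incr b 0 \<omega> = 0"
  by (simp add: incr_def)

lemma S_add: "S (b + k) \<omega> = S b \<omega> + incr b k \<omega>"
  by (induction k) (simp_all add: S_def incr_def add.assoc)

lemma S_adapted: "S k \<in> borel_measurable (F k)"
  unfolding S_def by (intro borel_measurable_sum measurable_mono[OF adapted]) auto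

lemma S_measurable [measurable]: "S k \<in> borel_measurable M"
  by (rule measurable_M[OF S_adapted])

lemma incr_adapted: "incr b k \<in> borel_measurable (F (b + k))"
  unfolding incr_def by (intro borel_measurable_sum measurable_mono[OF adapted]) auto

lemma incr_measurable [measurable]: "incr b k \<in> borel_measurable M"
  by (rule measurable_M[OF incr_adapted])

lemma incr_bounded: "\<omega> \<in> space M \<Longrightarrow> norm (incr b k \<omega>) \<le> real k * B"
  unfolding incr_def using sum_norm_bound[of "{..<k}" "\<lambda>l. D (b + l) \<omega>" B] bounded by simp

lemma incr_norm_pow_integrable: "integrable M (\<lambda>\<omega>. norm (incr b k \<omega>) ^ p)"
proof (rule bounded_integrable[of _ "(real k * B) ^ p"])
  show "norm (norm (incr b k \<omega>) ^ p) \<le> (real k * B) ^ p" if "\<omega> \<in> space M" for \<omega>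
    using incr_bounded[OF that, of b k] by (simp add: power_mono)
qed measurable

lemma weighted_incr_orthogonal:
  assumes h: "h \<in> borel_measurable (F (b + k))" "\<And>\<omega>. \<omega> \<in> space M \<Longrightarrow> \<bar>h \<omega>\<bar> \<le> C"
  shows "integrable M (\<lambda>\<omega>. h \<omega> * (incr b k \<omega> \<bullet> D (b + k) \<omega>))"
    and "(\<integral>\<omega>. h \<omega> * (incr b k \<omega> \<bullet> D (b + k) \<omega>) \<partial>M) = 0"
proof -
  have [measurable]: "h \<in> borel_measurable M" by (rule measurable_M[OF h(1)])
  have gm: "(\<lambda>\<omega>. h \<omega> *\<^sub>R incr b k \<omega>) \<in> borel_measurable (F (b + k))"
    by (intro borel_measurable_scaleR h incr_adapted)
  have gb: "norm (h \<omega> *\<^sub>R incr b k \<omega>) \<le> C * (real k * B)" if "\<omega> \<in> space M" for \<omega>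
    using h(2)[OF that] incr_bounded[OF that, of b k] by (auto intro!: mult_mono order_trans[OF abs_ge_zero h(2)[OF that]])
  show "(\<integral>\<omega>. h \<omega> * (incr b k \<omega> \<bullet> D (b + k) \<omega>) \<partial>M) = 0"
    using martingale[OF gm gb] by simp
  have "integrable M (\<lambda>\<omega>. (h \<omega> *\<^sub>R incr b k \<omega>) \<bullet> D (b + k) \<omega>)"
  proof (rule bounded_integrable[of _ "(C * (real k * B)) * B"])
    show "norm ((h \<omega> *\<^sub>R incr b k \<omega>) \<bullet> D (b + k) \<omega>) \<le> (C * (real k * B)) * B" if "\<omega> \<in> space M" for \<omega>
      unfolding real_norm_def
      by (rule order_trans[OF Cauchy_Schwarz_ineq2 mult_mono[OF gb[OF that] bounded[OF that]]])
         (use gb[OF that] norm_ge_zero order_trans in blast)+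
  qed measurable
  then show "integrable M (\<lambda>\<omega>. h \<omega> * (incr b k \<omega> \<bullet> D (b + k) \<omega>))" by simp
qed

lemma incr_moment2: "(\<integral>\<omega>. (norm (incr b k \<omega>))\<^sup>2 \<partial>M) \<le> B\<^sup>2 * real k"
proof (induction k)
  case (Suc k)
  note orth = weighted_incr_orthogonal[of "\<lambda>_. 2" b k 2, simplified]
  have "(\<integral>\<omega>. (norm (incr b (Suc k) \<omega>))\<^sup>2 \<partial>M) \<le> (\<integral>\<omega>. (norm (incr b k \<omega>))\<^sup>2 + 2 * (incr b k \<omega> \<bullet> D (b + k) \<omega>) + B\<^sup>2 \<partial>M)"
  proof (rule integral_mono)
    fix \<omega> assume \<omega>: "\<omega> \<in> space M"
    have "(norm (D (b + k) \<omega>))\<^sup>2 \<le> B\<^sup>2" using bounded[OF \<omega>] by (intro power_mono) auto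
    moreover have "(norm (incr b (Suc k) \<omega>))\<^sup>2 = (norm (incr b k \<omega>))\<^sup>2 + 2 * (incr b k \<omega> \<bullet> D (b + k) \<omega>) + (norm (D (b + k) \<omega>))\<^sup>2"
      by (simp add: incr_Suc power2_norm_eq_inner inner_simps inner_commute)
    ultimately show "(norm (incr b (Suc k) \<omega>))\<^sup>2 \<le> (norm (incr b k \<omega>))\<^sup>2 + 2 * (incr b k \<omega> \<bullet> D (b + k) \<omega>) + B\<^sup>2"
      by simp
  qed (use orth incr_norm_pow_integrable in simp_all)
  also have "\<dots> = (\<integral>\<omega>. (norm (incr b k \<omega>))\<^sup>2 \<partial>M) + B\<^sup>2"
    using orth incr_norm_pow_integrable by (simp add: prob_space)
  finally show ?case using Suc by (simp add: distrib_left)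
qed simp

text \<open>
  Expanding the fourth power, the term that is linear in the new difference has mean zero and the
  others are controlled by the second moment, which grows linearly; summation gives quadratic growth.
\<close>

lemma incr_moment4: "(\<integral>\<omega>. norm (incr b k \<omega>) ^ 4 \<partial>M) \<le> 7 * B ^ 4 * (real k)\<^sup>2"
proof (induction k)
  case (Suc k)
  have wm: "(\<lambda>\<omega>. 4 * (norm (incr b k \<omega>))\<^sup>2) \<in> borel_measurable (F (b + k))"
    using incr_adapted[of b k] by simp
  have wb: "\<bar>4 * (norm (incr b k \<omega>))\<^sup>2\<bar> \<le> 4 * (real k * B)\<^sup>2" if "\<omega> \<in> space M" for \<omega>
    using incr_bounded[OF that, of b k] by (simp add: power_mono)
  note orth = weighted_incr_orthogonal[OF wm wb]
  have "(\<integral>\<omega>. norm (incr b (Suc k) \<omega>) ^ 4 \<partial>M) \<le>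
     (\<integral>\<omega>. norm (incr b k \<omega>) ^ 4 + 4 * (norm (incr b k \<omega>))\<^sup>2 * (incr b k \<omega> \<bullet> D (b + k) \<omega>)
       + 8 * B\<^sup>2 * (norm (incr b k \<omega>))\<^sup>2 + 3 * B ^ 4 \<partial>M)"
    using orth(1) incr_norm_pow_integrable incr_norm_pow_integrable[of b "Suc k" 4, unfolded incr_Suc]
    by (intro integral_mono) (simp_all add: incr_Suc norm_pow4_add_upper bounded)
  also have "\<dots> = (\<integral>\<omega>. norm (incr b k \<omega>) ^ 4 \<partial>M) + 8 * B\<^sup>2 * (\<integral>\<omega>. (norm (incr b k \<omega>))\<^sup>2 \<partial>M) + 3 * B ^ 4"
    using orth incr_norm_pow_integrable by (simp add: prob_space)
  also have "\<dots> \<le> 7 * B ^ 4 * (real k)\<^sup>2 + 8 * B\<^sup>2 * (B\<^sup>2 * real k) + 3 * B ^ 4"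
    using Suc incr_moment2[of b k] by (intro add_mono mult_left_mono) auto
  also have "\<dots> = B ^ 4 * (7 * (real k)\<^sup>2 + 8 * real k + 3)"
    by (simp add: algebra_simps power2_eq_square power4_eq_xxxx)
  also have "\<dots> \<le> B ^ 4 * (7 * (real (Suc k))\<^sup>2)"
    by (intro mult_left_mono) (auto simp: power2_eq_square algebra_simps)
  finally show ?case by (simp add: mult.commute mult.left_commute)
qed simp

definition exceeds :: "nat \<Rightarrow> real \<Rightarrow> nat \<Rightarrow> 'a set" where
  "exceeds b a k = {\<omega> \<in> space M. \<exists>j\<le>k. a \<le> norm (incr b j \<omega>)}"

lemma exceeds_adapted: "exceeds b a k \<in> sets (F (b + k))"
proof -
  have "exceeds b a k = (\<Union>j\<le>k. {\<omega> \<in> space (F (b + k)). a \<le> norm (incr b j \<omega>)})"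
    by (auto simp: exceeds_def space_F)
  also have "\<dots> \<in> sets (F (b + k))"
  proof (intro sets.finite_UN)
    fix j assume "j \<in> {..k}"
    then have [measurable]: "incr b j \<in> borel_measurable (F (b + k))"
      by (intro measurable_mono[OF incr_adapted]) auto
    show "{\<omega> \<in> space (F (b + k)). a \<le> norm (incr b j \<omega>)} \<in> sets (F (b + k))" by measurable
  qed simp
  finally show ?thesis .
qed

lemma exceeds_events [measurable]: "exceeds b a k \<in> events"
  using exceeds_adapted[of b a k] subalg[of "b + k"] by (auto simp: subalgebra_def)

text \<open>
  Doob's argument for the submartingale \<open>norm (incr b k) ^ 4\<close>, as an induction on \<open>k\<close>: on the event that
  the level has been exceeded before, convexity lets the expectation grow, and on the event that it is
  exceeded for the first time the integrand is at least \<open>a ^ 4\<close>.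
\<close>

lemma doob_exceeds:
  assumes "0 < a"
  shows "a ^ 4 * prob (exceeds b a k) \<le> (\<integral>\<omega>. indicator (exceeds b a k) \<omega> * norm (incr b k \<omega>) ^ 4 \<partial>M)"
proof (induction k)
  case 0
  have "exceeds b a 0 = {}" using assms by (auto simp: exceeds_def)
  then show ?case by simp
next
  case (Suc k)
  let ?H = "\<lambda>k. indicat_real (exceeds b a k)"
  have int_ind: "integrable M (\<lambda>\<omega>. ?H j \<omega> * norm (incr b l \<omega>) ^ 4)" for j l
    by (rule Bochner_Integration.integrable_bound[OF incr_norm_pow_integrable[of b l 4]]) (auto simp: indicator_def)
  have int_H: "integrable M (?H j)" for j
    by (rule bounded_integrable[of _ 1]) (auto simp: indicator_def)
  have wm: "(\<lambda>\<omega>. ?H k \<omega> * (4 * (norm (incr b k \<omega>))\<^sup>2)) \<in> borel_measurable (F (b + k))"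
    using incr_adapted[of b k] exceeds_adapted[of b a k] by simp
  have wb: "\<bar>?H k \<omega> * (4 * (norm (incr b k \<omega>))\<^sup>2)\<bar> \<le> 4 * (real k * B)\<^sup>2" if "\<omega> \<in> space M" for \<omega>
    using incr_bounded[OF that, of b k] by (auto simp: power_mono indicator_def)
  note orth = weighted_incr_orthogonal[OF wm wb]
  have "a ^ 4 * prob (exceeds b a (Suc k)) = a ^ 4 * prob (exceeds b a k) + a ^ 4 * (prob (exceeds b a (Suc k)) - prob (exceeds b a k))"
    by (simp add: algebra_simps)
  \<comment> \<open>The middle integral is zero; it is inserted so that the three integrands can be compared pointwise.\<close>
  also have "\<dots> \<le> (\<integral>\<omega>. ?H k \<omega> * norm (incr b k \<omega>) ^ 4 \<partial>M)
     + (\<integral>\<omega>. (?H k \<omega> * (4 * (norm (incr b k \<omega>))\<^sup>2)) * (incr b k \<omega> \<bullet> D (b + k) \<omega>) \<partial>M)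
     + (\<integral>\<omega>. a ^ 4 * (?H (Suc k) \<omega> - ?H k \<omega>) \<partial>M)"
    using Suc int_H orth(2) by simp
  also have "\<dots> = (\<integral>\<omega>. ?H k \<omega> * norm (incr b k \<omega>) ^ 4
     + (?H k \<omega> * (4 * (norm (incr b k \<omega>))\<^sup>2)) * (incr b k \<omega> \<bullet> D (b + k) \<omega>)
     + a ^ 4 * (?H (Suc k) \<omega> - ?H k \<omega>) \<partial>M)"
    using int_ind orth(1) int_H by simp
  also have "\<dots> \<le> (\<integral>\<omega>. ?H (Suc k) \<omega> * norm (incr b (Suc k) \<omega>) ^ 4 \<partial>M)"
  proof (rule integral_mono)
    fix \<omega> assume \<omega>: "\<omega> \<in> space M"
    show "?H k \<omega> * norm (incr b k \<omega>) ^ 4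
     + (?H k \<omega> * (4 * (norm (incr b k \<omega>))\<^sup>2)) * (incr b k \<omega> \<bullet> D (b + k) \<omega>)
     + a ^ 4 * (?H (Suc k) \<omega> - ?H k \<omega>) \<le> ?H (Suc k) \<omega> * norm (incr b (Suc k) \<omega>) ^ 4"
    proof (cases "\<omega> \<in> exceeds b a k")
      case True
      then have "\<omega> \<in> exceeds b a (Suc k)" by (auto simp: exceeds_def intro: le_SucI)
      with True show ?thesis
        using norm_pow4_add_lower[of "incr b k \<omega>" "D (b + k) \<omega>"] by (simp add: incr_Suc)
    next
      case False
      show ?thesis
      proof (cases "\<omega> \<in> exceeds b a (Suc k)")
        case True
        with False have "a \<le> norm (incr b (Suc k) \<omega>)" by (auto simp: exceeds_def le_Suc_eq)
        then have "a ^ 4 \<le> norm (incr b (Suc k) \<omega>) ^ 4" using assms by (intro power_mono) auto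
        with True False show ?thesis by simp
      qed (use False in simp)
    qed
  qed (use int_ind orth(1) int_H in simp_all)
  finally show ?case .
qed

lemma maximal_inequality:
  assumes "0 < a"
  shows "prob (exceeds b a k) \<le> 7 * B ^ 4 * (real k)\<^sup>2 / a ^ 4"
proof -
  have "a ^ 4 * prob (exceeds b a k) \<le> (\<integral>\<omega>. indicator (exceeds b a k) \<omega> * norm (incr b k \<omega>) ^ 4 \<partial>M)"
    by (rule doob_exceeds[OF assms])
  also have "\<dots> \<le> (\<integral>\<omega>. norm (incr b k \<omega>) ^ 4 \<partial>M)"
    by (rule integral_mono[OF Bochner_Integration.integrable_bound[OF incr_norm_pow_integrable[of b k 4]] incr_norm_pow_integrable])
       (auto simp: indicator_def)
  also have "\<dots> \<le> 7 * B ^ 4 * (real k)\<^sup>2" by (rule incr_moment4)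
  finally show ?thesis using assms by (simp add: pos_le_divide_eq mult.commute)
qed

text \<open>
  A constant that dominates all error terms of one replacement step below.
\<close>

definition cos_error :: "'b \<Rightarrow> real" where
  "cos_error \<theta> = (norm \<theta> * B) ^ 3 + (norm \<theta> * B)\<^sup>2 + q \<theta> + (q \<theta>)\<^sup>2"

lemma cos_error_nonneg: "0 \<le> cos_error \<theta>"
  unfolding cos_error_def using B_nonneg q_nonneg[of \<theta>] by (intro add_nonneg_nonneg) auto

text \<open>
  Replacing one difference \<open>D j\<close> by its Gaussian effect. In the second-order expansion of the cosine the
  linear term vanishes by the martingale property and the quadratic term is \<open>q \<theta>\<close> up to the contribution of
  \<open>bad j\<close>; the result is compared with the expansion of the exponential. The phase \<open>\<Phi>\<close> collects
  everything that happened before.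
\<close>

lemma cos_step:
  assumes \<Phi>: "\<Phi> \<in> borel_measurable (F j)" and s: "0 < s" "s \<le> 1"
  shows "\<bar>(\<integral>\<omega>. cos (\<Phi> \<omega> + s * (\<theta> \<bullet> D j \<omega>)) \<partial>M) - exp (- (s\<^sup>2 * q \<theta> / 2)) * (\<integral>\<omega>. cos (\<Phi> \<omega>) \<partial>M)\<bar>
    \<le> cos_error \<theta> * (s ^ 3 + s\<^sup>2 * prob (bad j))"
proof -
  have [measurable]: "\<Phi> \<in> borel_measurable M" by (rule measurable_M[OF \<Phi>])
  define c where "c = norm \<theta> * B"
  have "0 \<le> c" using B_nonneg by (simp add: c_def)
  have \<theta>D: "\<bar>\<theta> \<bullet> D j \<omega>\<bar> \<le> c" if "\<omega> \<in> space M" for \<omega>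
    unfolding c_def using bounded[OF that, of j]
    by (intro order_trans[OF Cauchy_Schwarz_ineq2] mult_left_mono) auto
  then have \<theta>D2: "(\<theta> \<bullet> D j \<omega>)\<^sup>2 \<le> c\<^sup>2" if "\<omega> \<in> space M" for \<omega>
    using that by (metis abs_ge_zero power2_abs power_mono)
  define E0 where "E0 = (\<integral>\<omega>. cos (\<Phi> \<omega>) \<partial>M)"
  define E2 where "E2 = (\<integral>\<omega>. cos (\<Phi> \<omega>) * (\<theta> \<bullet> D j \<omega>)\<^sup>2 \<partial>M)"
  have int0: "integrable M (\<lambda>\<omega>. cos (\<Phi> \<omega>))"
    by (rule bounded_integrable[of _ 1]) auto
  have int1: "integrable M (\<lambda>\<omega>. sin (\<Phi> \<omega>) * (\<theta> \<bullet> D j \<omega>))"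
    by (rule bounded_integrable[of _ c], measurable)
       (auto simp: abs_mult intro!: order_trans[OF mult_left_le_one_le] \<theta>D)
  have int2: "integrable M (\<lambda>\<omega>. cos (\<Phi> \<omega>) * (\<theta> \<bullet> D j \<omega>)\<^sup>2)"
    by (rule bounded_integrable[of _ "c\<^sup>2"], measurable)
       (auto simp: abs_mult intro!: order_trans[OF mult_left_le_one_le] \<theta>D2)
  have intc: "integrable M (\<lambda>\<omega>. cos (\<Phi> \<omega> + s * (\<theta> \<bullet> D j \<omega>)))"
    by (rule bounded_integrable[of _ 1]) auto
  have E1: "(\<integral>\<omega>. sin (\<Phi> \<omega>) * (\<theta> \<bullet> D j \<omega>) \<partial>M) = 0"
  proof -
    have "(\<integral>\<omega>. (sin (\<Phi> \<omega>) *\<^sub>R \<theta>) \<bullet> D j \<omega> \<partial>M) = 0"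
    proof (rule martingale[of _ _ "norm \<theta>"])
      show "(\<lambda>\<omega>. sin (\<Phi> \<omega>) *\<^sub>R \<theta>) \<in> borel_measurable (F j)" using \<Phi> by measurable
      show "norm (sin (\<Phi> \<omega>) *\<^sub>R \<theta>) \<le> norm \<theta>" for \<omega> by (simp add: mult_left_le_one_le)
    qed
    then show ?thesis by simp
  qed
  have taylor: "\<bar>(\<integral>\<omega>. cos (\<Phi> \<omega> + s * (\<theta> \<bullet> D j \<omega>)) \<partial>M) - (E0 - s\<^sup>2 / 2 * E2)\<bar> \<le> s ^ 3 * c ^ 3"
  proof -
    have "(\<integral>\<omega>. cos (\<Phi> \<omega> + s * (\<theta> \<bullet> D j \<omega>)) \<partial>M) - (E0 - s\<^sup>2 / 2 * E2)
      = (\<integral>\<omega>. cos (\<Phi> \<omega> + s * (\<theta> \<bullet> D j \<omega>)) - (cos (\<Phi> \<omega>) - s * (sin (\<Phi> \<omega>) * (\<theta> \<bullet> D j \<omega>)) - s\<^sup>2 / 2 * (cos (\<Phi> \<omega>) * (\<theta> \<bullet> D j \<omega>)\<^sup>2)) \<partial>M)"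
      using int0 int1 int2 intc E1 by (simp add: E0_def E2_def)
    also have "\<bar>\<dots>\<bar> \<le> (\<integral>\<omega>. s ^ 3 * c ^ 3 \<partial>M)"
    proof (rule order_trans[OF integral_abs_bound integral_mono])
      fix \<omega> assume \<omega>: "\<omega> \<in> space M"
      let ?z = "s * (\<theta> \<bullet> D j \<omega>)"
      have "\<bar>cos (\<Phi> \<omega> + ?z) - (cos (\<Phi> \<omega>) - ?z * sin (\<Phi> \<omega>) - ?z\<^sup>2 / 2 * cos (\<Phi> \<omega>))\<bar> \<le> \<bar>?z\<bar> ^ 3"
        by (rule cos_add_taylor)
      also have "\<dots> \<le> (s * c) ^ 3"
        using s \<theta>D[OF \<omega>] by (intro power_mono) (auto simp: abs_mult)
      finally show "\<bar>cos (\<Phi> \<omega> + s * (\<theta> \<bullet> D j \<omega>)) - (cos (\<Phi> \<omega>) - s * (sin (\<Phi> \<omega>) * (\<theta> \<bullet> D j \<omega>)) - s\<^sup>2 / 2 * (cos (\<Phi> \<omega>) * (\<theta> \<bullet> D j \<omega>)\<^sup>2))\<bar> \<le> s ^ 3 * c ^ 3"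
        by (simp add: power_mult_distrib mult_ac)
    qed (use int0 int1 int2 intc in simp_all)
    finally show ?thesis by (simp add: prob_space)
  qed
  have second: "\<bar>E2 - q \<theta> * E0\<bar> \<le> (c\<^sup>2 + q \<theta>) * prob (bad j)"
  proof -
    have "space M - bad j \<in> sets (F j)"
      using sets.compl_sets[OF bad_sets[of j]] by (simp add: space_F)
    then have hm: "(\<lambda>\<omega>. indicator (space M - bad j) \<omega> * cos (\<Phi> \<omega>)) \<in> borel_measurable (F j)"
      by (intro borel_measurable_times borel_measurable_indicator measurable_compose[OF \<Phi>]) auto
    have good: "(\<integral>\<omega>. (indicator (space M - bad j) \<omega> * cos (\<Phi> \<omega>)) * (\<theta> \<bullet> D j \<omega>)\<^sup>2 \<partial>M)
      = q \<theta> * (\<integral>\<omega>. indicator (space M - bad j) \<omega> * cos (\<Phi> \<omega>) \<partial>M)"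
      by (rule variance[OF hm, of 1]) (auto simp: indicator_def)
    have intb: "integrable M (\<lambda>\<omega>. indicator (bad j) \<omega> * (cos (\<Phi> \<omega>) * ((\<theta> \<bullet> D j \<omega>)\<^sup>2 - q \<theta>)))"
      using int0 int2 by (intro integrable_mult_indicator[where 'b = real, unfolded real_scaleR_def])
         (auto simp: algebra_simps)
    have split: "cos (\<Phi> \<omega>) * (\<theta> \<bullet> D j \<omega>)\<^sup>2 - q \<theta> * cos (\<Phi> \<omega>) =
       (indicator (space M - bad j) \<omega> * cos (\<Phi> \<omega>)) * (\<theta> \<bullet> D j \<omega>)\<^sup>2
       - q \<theta> * (indicator (space M - bad j) \<omega> * cos (\<Phi> \<omega>)) + indicator (bad j) \<omega> * (cos (\<Phi> \<omega>) * ((\<theta> \<bullet> D j \<omega>)\<^sup>2 - q \<theta>))"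
      if "\<omega> \<in> space M" for \<omega> using that by (auto simp: indicator_def algebra_simps)
    have intg: "integrable M (\<lambda>\<omega>. indicator (space M - bad j) \<omega> * cos (\<Phi> \<omega>))"
      "integrable M (\<lambda>\<omega>. (indicator (space M - bad j) \<omega> * cos (\<Phi> \<omega>)) * (\<theta> \<bullet> D j \<omega>)\<^sup>2)"
      using integrable_mult_indicator[where 'b = real, unfolded real_scaleR_def, OF _ int0, of "space M - bad j"]
            integrable_mult_indicator[where 'b = real, unfolded real_scaleR_def, OF _ int2, of "space M - bad j"] by (simp_all add: mult.assoc)
    have "E2 - q \<theta> * E0 = (\<integral>\<omega>. cos (\<Phi> \<omega>) * (\<theta> \<bullet> D j \<omega>)\<^sup>2 - q \<theta> * cos (\<Phi> \<omega>) \<partial>M)"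
      using int0 int2 by (simp add: E0_def E2_def)
    also have "\<dots> = (\<integral>\<omega>. (indicator (space M - bad j) \<omega> * cos (\<Phi> \<omega>)) * (\<theta> \<bullet> D j \<omega>)\<^sup>2
       - q \<theta> * (indicator (space M - bad j) \<omega> * cos (\<Phi> \<omega>)) + indicator (bad j) \<omega> * (cos (\<Phi> \<omega>) * ((\<theta> \<bullet> D j \<omega>)\<^sup>2 - q \<theta>)) \<partial>M)"
      by (rule Bochner_Integration.integral_cong[OF refl split])
    also have "\<dots> = (\<integral>\<omega>. indicator (bad j) \<omega> * (cos (\<Phi> \<omega>) * ((\<theta> \<bullet> D j \<omega>)\<^sup>2 - q \<theta>)) \<partial>M)"
      using intg intb good by simp
    also have "\<bar>\<dots>\<bar> \<le> (\<integral>\<omega>. (c\<^sup>2 + q \<theta>) * indicator (bad j) \<omega> \<partial>M)"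
    proof (rule order_trans[OF integral_abs_bound integral_mono])
      fix \<omega> assume \<omega>: "\<omega> \<in> space M"
      have "\<bar>(\<theta> \<bullet> D j \<omega>)\<^sup>2 - q \<theta>\<bar> \<le> c\<^sup>2 + q \<theta>"
        using \<theta>D2[OF \<omega>] q_nonneg[of \<theta>] zero_le_power2[of "\<theta> \<bullet> D j \<omega>"] by linarith
      then have "\<bar>cos (\<Phi> \<omega>) * ((\<theta> \<bullet> D j \<omega>)\<^sup>2 - q \<theta>)\<bar> \<le> 1 * (c\<^sup>2 + q \<theta>)"
        unfolding abs_mult by (intro mult_mono) auto
      then show "\<bar>indicator (bad j) \<omega> * (cos (\<Phi> \<omega>) * ((\<theta> \<bullet> D j \<omega>)\<^sup>2 - q \<theta>))\<bar> \<le> (c\<^sup>2 + q \<theta>) * indicator (bad j) \<omega>"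
        by (auto simp: indicator_def)
    qed (use intb in \<open>auto simp: less_top[symmetric]\<close>)
    finally show ?thesis by simp
  qed
  define x where "x = s\<^sup>2 * q \<theta> / 2"
  have "0 \<le> x" using q_nonneg[of \<theta>] by (simp add: x_def)
  have E0_le: "\<bar>E0\<bar> \<le> 1"
  proof -
    have "\<bar>E0\<bar> \<le> (\<integral>\<omega>. 1 \<partial>M)"
      unfolding E0_def by (rule order_trans[OF integral_abs_bound integral_mono]) (use int0 in auto)
    then show ?thesis by (simp add: prob_space)
  qed
  have "x\<^sup>2 \<le> s ^ 3 * (q \<theta>)\<^sup>2"
  proof -
    have "x\<^sup>2 = s ^ 4 * (q \<theta>)\<^sup>2 / 4" by (simp add: x_def power_mult_distrib power_divide flip: power_mult)
    also have "\<dots> \<le> s ^ 4 * (q \<theta>)\<^sup>2" by simp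
    also have "\<dots> \<le> s ^ 3 * (q \<theta>)\<^sup>2"
      using s by (intro mult_right_mono power_decreasing) auto
    finally show ?thesis .
  qed
  then have "\<bar>exp (- x) - (1 - x)\<bar> * \<bar>E0\<bar> \<le> s ^ 3 * (q \<theta>)\<^sup>2 * 1"
    using exp_minus_quadratic[OF \<open>0 \<le> x\<close>] E0_le by (intro mult_mono) auto
  then have third: "\<bar>exp (- x) * E0 - (1 - x) * E0\<bar> \<le> s ^ 3 * (q \<theta>)\<^sup>2"
    by (simp add: abs_mult[symmetric] left_diff_distrib)
  have "s\<^sup>2 / 2 * E2 - x * E0 = s\<^sup>2 / 2 * (E2 - q \<theta> * E0)"
    by (simp add: x_def algebra_simps)
  then have "\<bar>s\<^sup>2 / 2 * E2 - x * E0\<bar> = s\<^sup>2 / 2 * \<bar>E2 - q \<theta> * E0\<bar>"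
    by (simp only: abs_mult) simp
  also have "\<dots> \<le> s\<^sup>2 / 2 * ((c\<^sup>2 + q \<theta>) * prob (bad j))"
    using second by (intro mult_left_mono) auto
  also have "\<dots> \<le> s\<^sup>2 * prob (bad j) * (c\<^sup>2 + q \<theta>)"
    using q_nonneg[of \<theta>] by (simp add: mult_nonneg_nonneg)
  finally have fourth: "\<bar>s\<^sup>2 / 2 * E2 - x * E0\<bar> \<le> s\<^sup>2 * prob (bad j) * (c\<^sup>2 + q \<theta>)" .
  have pos: "0 \<le> s\<^sup>2 * prob (bad j)" "0 \<le> s ^ 3" using s by auto
  have "s ^ 3 * c ^ 3 + s ^ 3 * (q \<theta>)\<^sup>2 + s\<^sup>2 * prob (bad j) * (c\<^sup>2 + q \<theta>) \<le> cos_error \<theta> * (s ^ 3 + s\<^sup>2 * prob (bad j))"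
  proof -
    have "cos_error \<theta> * (s ^ 3 + s\<^sup>2 * prob (bad j)) - (s ^ 3 * c ^ 3 + s ^ 3 * (q \<theta>)\<^sup>2 + s\<^sup>2 * prob (bad j) * (c\<^sup>2 + q \<theta>))
      = s ^ 3 * (c\<^sup>2 + q \<theta>) + s\<^sup>2 * prob (bad j) * (c ^ 3 + (q \<theta>)\<^sup>2)"
      by (simp add: cos_error_def c_def algebra_simps)
    moreover have "0 \<le> s ^ 3 * (c\<^sup>2 + q \<theta>) + s\<^sup>2 * prob (bad j) * (c ^ 3 + (q \<theta>)\<^sup>2)"
      using pos \<open>0 \<le> c\<close> q_nonneg[of \<theta>] by (intro add_nonneg_nonneg mult_nonneg_nonneg) auto
    ultimately show ?thesis by linarith
  qed
  moreover have "(1 - x) * E0 = E0 - x * E0" by (simp add: left_diff_distrib)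
  ultimately have "\<bar>(\<integral>\<omega>. cos (\<Phi> \<omega> + s * (\<theta> \<bullet> D j \<omega>)) \<partial>M) - exp (- x) * E0\<bar> \<le> cos_error \<theta> * (s ^ 3 + s\<^sup>2 * prob (bad j))"
    using taylor third fourth by (simp add: abs_le_iff)
  then show ?thesis by (simp add: x_def E0_def)
qed

text \<open>
  Iterating the previous estimate. Since the exponential factors are at most \<open>1\<close>, the errors of the single
  steps add up.
\<close>

lemma cos_block:
  assumes \<Phi>: "\<Phi> \<in> borel_measurable (F b)" and s: "0 < s" "s \<le> 1"
  shows "\<bar>(\<integral>\<omega>. cos (\<Phi> \<omega> + s * (\<theta> \<bullet> incr b k \<omega>)) \<partial>M) - exp (- (s\<^sup>2 * real k * q \<theta> / 2)) * (\<integral>\<omega>. cos (\<Phi> \<omega>) \<partial>M)\<bar>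
    \<le> cos_error \<theta> * (s ^ 3 * real k + s\<^sup>2 * (\<Sum>l<k. prob (bad (b + l))))"
proof (induction k)
  case (Suc k)
  define I where "I k = (\<integral>\<omega>. cos (\<Phi> \<omega> + s * (\<theta> \<bullet> incr b k \<omega>)) \<partial>M)" for k
  define E0 where "E0 = (\<integral>\<omega>. cos (\<Phi> \<omega>) \<partial>M)"
  define u where "u = exp (- (s\<^sup>2 * q \<theta> / 2))"
  define w where "w = exp (- (s\<^sup>2 * real k * q \<theta> / 2))"
  have u: "0 \<le> u" "u \<le> 1" using q_nonneg[of \<theta>] by (auto simp: u_def)
  have "(\<lambda>\<omega>. \<Phi> \<omega> + s * (\<theta> \<bullet> incr b k \<omega>)) \<in> borel_measurable (F (b + k))"
    using measurable_mono[OF \<Phi>, of "b + k"] incr_adapted[of b k] by simp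
  from cos_step[OF this s, of \<theta>]
  have step: "\<bar>I (Suc k) - u * I k\<bar> \<le> cos_error \<theta> * (s ^ 3 + s\<^sup>2 * prob (bad (b + k)))"
    by (simp add: I_def u_def incr_Suc inner_add_right distrib_left add.assoc)
  have IH: "\<bar>I k - w * E0\<bar> \<le> cos_error \<theta> * (s ^ 3 * real k + s\<^sup>2 * (\<Sum>l<k. prob (bad (b + l))))"
    using Suc by (simp add: I_def w_def E0_def)
  have "\<bar>u * I k - u * (w * E0)\<bar> = u * \<bar>I k - w * E0\<bar>"
    using u by (simp add: abs_mult right_diff_distrib[symmetric])
  also have "\<dots> \<le> \<bar>I k - w * E0\<bar>" using u by (intro mult_left_le_one_le) auto
  finally have "\<bar>I (Suc k) - u * (w * E0)\<bar> \<le> cos_error \<theta> * (s ^ 3 + s\<^sup>2 * prob (bad (b + k)))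
     + cos_error \<theta> * (s ^ 3 * real k + s\<^sup>2 * (\<Sum>l<k. prob (bad (b + l))))"
    using step IH by linarith
  also have "\<dots> = cos_error \<theta> * (s ^ 3 * real (Suc k) + s\<^sup>2 * (\<Sum>l<Suc k. prob (bad (b + l))))"
    by (simp add: algebra_simps)
  also have "u * (w * E0) = exp (- (s\<^sup>2 * real (Suc k) * q \<theta> / 2)) * E0"
    unfolding u_def w_def mult.assoc[symmetric] exp_add[symmetric] by (simp add: field_simps)
  finally show ?case by (simp add: I_def E0_def)
qed simp

lemma sum_bad_le: "(\<Sum>l<k. prob (bad (b + l))) \<le> (\<Sum>l. prob (bad l))"
proof -
  have "(\<Sum>l<k. prob (bad (b + l))) = (\<Sum>l\<in>(+) b ` {..<k}. prob (bad l))"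
    by (subst sum.reindex) (auto simp: o_def)
  also have "\<dots> \<le> (\<Sum>l. prob (bad l))"
    by (intro sum_le_suminf bad_summable) auto
  finally show ?thesis .
qed

end

section \<open>The functional central limit theorem for bounded martingale differences\<close>

lemma nat_div_bounds:
  assumes "0 < m"
  shows "real (x div m) \<le> real x / real m" "real x / real m < real (x div m) + 1"
proof -
  have "real_of_int \<lfloor>real x / real m\<rfloor> = real (x div m)" by (simp add: floor_divide_of_nat_eq)
  then show "real (x div m) \<le> real x / real m" "real x / real m < real (x div m) + 1"
    using floor_correct[of "real x / real m"] by linarith+
qed

text \<open>
  The number of steps made by time \<open>i / m\<close> when \<open>n\<close> steps are made per unit of time.
\<close>

definition gridpt :: "nat \<Rightarrow> nat \<Rightarrow> nat \<Rightarrow> nat" where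
  "gridpt m n i = n * i div m"

lemma gridpt_0 [simp]: "gridpt m n 0 = 0" by (simp add: gridpt_def)

lemma gridpt_Suc_le: "gridpt m n i \<le> gridpt m n (Suc i)"
  unfolding gridpt_def by (intro div_le_mono mult_le_mono2) simp

lemma gridpt_bounds:
  assumes "0 < m"
  shows "real (gridpt m n i) \<le> real n * real i / real m" "real n * real i / real m - 1 \<le> real (gridpt m n i)"
  using nat_div_bounds[OF assms, of "n * i"] by (simp_all add: gridpt_def)

lemma gridpt_diff:
  assumes "0 < m"
  shows "\<bar>real (gridpt m n (Suc i) - gridpt m n i) - real n / real m\<bar> \<le> 1"
proof -
  have "real n * real (Suc i) / real m = real n * real i / real m + real n / real m"
    by (simp add: algebra_simps add_divide_distrib)
  then show ?thesis
    using gridpt_bounds[OF assms, of n i] gridpt_bounds[OF assms, of n "Suc i"] gridpt_Suc_le[of m n i]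
    by (simp add: of_nat_diff abs_le_iff)
qed

lemma gridpt_density:
  assumes "0 < m"
  shows "(\<lambda>n. real (gridpt m n (Suc i) - gridpt m n i) / real n) \<longlonglongrightarrow> 1 / real m"
proof (subst tendsto_dist_iff, rule tendsto_sandwich[OF _ _ tendsto_const lim_1_over_n])
  show "\<forall>\<^sub>F n in sequentially. dist (real (gridpt m n (Suc i) - gridpt m n i) / real n) (1 / real m) \<le> 1 / real n"
    using eventually_gt_at_top[of 0]
  proof eventually_elim
    case (elim n)
    have "real (gridpt m n (Suc i) - gridpt m n i) / real n - 1 / real m = (real (gridpt m n (Suc i) - gridpt m n i) - real n / real m) / real n"
      using elim by (simp add: diff_divide_distrib)
    then show ?case
      using gridpt_diff[OF assms, of n i] elim by (simp add: dist_real_def divide_right_mono)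
  qed
qed auto

context bounded_martingale_differences
begin

text \<open>
  The rescaled increment of the partial sums over the time interval from \<open>i / m\<close> to \<open>(i + 1) / m\<close>.
\<close>

definition block :: "nat \<Rightarrow> nat \<Rightarrow> nat \<Rightarrow> 'a \<Rightarrow> 'b" where
  "block m n i \<omega> = (1 / sqrt (real n)) *\<^sub>R incr (gridpt m n i) (gridpt m n (Suc i) - gridpt m n i) \<omega>"

lemma block_measurable [measurable]: "block m n i \<in> borel_measurable M"
  unfolding block_def by measurable

lemma sum_block: "(\<Sum>i<k. block m n i \<omega>) = (1 / sqrt (real n)) *\<^sub>R S (gridpt m n k) \<omega>"
proof (induction k)
  case (Suc k)
  have "S (gridpt m n (Suc k)) \<omega> = S (gridpt m n k) \<omega> + incr (gridpt m n k) (gridpt m n (Suc k) - gridpt m n k) \<omega>"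
    using S_add[of "gridpt m n k" "gridpt m n (Suc k) - gridpt m n k" \<omega>] gridpt_Suc_le[of m n k] by simp
  with Suc show ?case by (simp add: block_def scaleR_add_right)
qed (simp add: S_def)

lemma block_phase_adapted:
  "(\<lambda>\<omega>. \<phi> + (\<Sum>i<k. \<theta> i \<bullet> block m n i \<omega>)) \<in> borel_measurable (F (gridpt m n k))"
proof (induction k)
  case (Suc k)
  have 1: "(\<lambda>\<omega>. \<phi> + (\<Sum>i<k. \<theta> i \<bullet> block m n i \<omega>)) \<in> borel_measurable (F (gridpt m n (Suc k)))"
    by (rule measurable_mono[OF Suc gridpt_Suc_le])
  have 2: "incr (gridpt m n k) (gridpt m n (Suc k) - gridpt m n k) \<in> borel_measurable (F (gridpt m n (Suc k)))"
    using incr_adapted[of "gridpt m n k" "gridpt m n (Suc k) - gridpt m n k"] gridpt_Suc_le[of m n k] by simp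
  show ?case
    using borel_measurable_add[OF 1 borel_measurable_inner[OF borel_measurable_const borel_measurable_scaleR[OF borel_measurable_const 2]],
        of "\<theta> k" "1 / sqrt (real n)"]
    by (simp add: block_def add.assoc)
qed simp

text \<open>
  The limit is the expectation for independent centred Gaussian vectors in which \<open>\<theta> \<bullet> \<cdot>\<close> has variance
  \<open>q \<theta> / m\<close>. The blocks are added one by one: the phase of the earlier blocks is measurable at the beginning
  of the next one, so \<open>cos_block\<close> applies with \<open>s = 1 / sqrt n\<close> and about \<open>n / m\<close> steps.
\<close>

lemma blocks_cos_tendsto:
  assumes m: "0 < m"
  shows "(\<lambda>n. \<integral>\<omega>. cos (\<phi> + (\<Sum>i<k. \<theta> i \<bullet> block m n i \<omega>)) \<partial>M) \<longlonglongrightarrow> cos \<phi> * exp (- ((\<Sum>i<k. q (\<theta> i)) / (2 * real m)))"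
proof (induction k)
  case 0
  show ?case by (simp add: prob_space)
next
  case (Suc k)
  define a where "a n = (\<integral>\<omega>. cos (\<phi> + (\<Sum>i<k. \<theta> i \<bullet> block m n i \<omega>)) \<partial>M)" for n
  define a' where "a' n = (\<integral>\<omega>. cos (\<phi> + (\<Sum>i<Suc k. \<theta> i \<bullet> block m n i \<omega>)) \<partial>M)" for n
  define s where "s n = 1 / sqrt (real n)" for n
  define c where "c n = gridpt m n (Suc k) - gridpt m n k" for n
  define T where "T = (\<Sum>l. prob (bad l))"
  have s2: "(s n)\<^sup>2 = 1 / real n" for n by (simp add: s_def power_divide)
  have s0: "s \<longlonglongrightarrow> 0"
  proof -
    have "(\<lambda>n. sqrt (1 / real n)) \<longlonglongrightarrow> sqrt 0" by (intro tendsto_real_sqrt lim_1_over_n)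
    then show ?thesis by (simp add: s_def[abs_def] real_sqrt_divide)
  qed
  have sc: "(\<lambda>n. (s n)\<^sup>2 * real (c n)) \<longlonglongrightarrow> 1 / real m"
    using gridpt_density[OF m, of k] by (simp add: s2 c_def)
  have e: "(\<lambda>n. exp (- ((s n)\<^sup>2 * real (c n) * q (\<theta> k) / 2))) \<longlonglongrightarrow> exp (- (1 / real m * q (\<theta> k) / 2))"
    by (intro tendsto_intros sc) simp
  have main: "(\<lambda>n. exp (- ((s n)\<^sup>2 * real (c n) * q (\<theta> k) / 2)) * a n) \<longlonglongrightarrow>
      exp (- (1 / real m * q (\<theta> k) / 2)) * (cos \<phi> * exp (- ((\<Sum>i<k. q (\<theta> i)) / (2 * real m))))"
    using Suc by (intro tendsto_mult e) (simp add: a_def)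
  have err: "(\<lambda>n. cos_error (\<theta> k) * (s n * ((s n)\<^sup>2 * real (c n)) + (s n)\<^sup>2 * T)) \<longlonglongrightarrow> cos_error (\<theta> k) * (0 * (1 / real m) + 0\<^sup>2 * T)"
    by (intro tendsto_intros s0 sc)
  have "(\<lambda>n. a' n - exp (- ((s n)\<^sup>2 * real (c n) * q (\<theta> k) / 2)) * a n) \<longlonglongrightarrow> 0"
  proof (rule Lim_null_comparison)
    show "(\<lambda>n. cos_error (\<theta> k) * (s n * ((s n)\<^sup>2 * real (c n)) + (s n)\<^sup>2 * T)) \<longlonglongrightarrow> 0"
      using err by simp
    show "\<forall>\<^sub>F n in sequentially. norm (a' n - exp (- ((s n)\<^sup>2 * real (c n) * q (\<theta> k) / 2)) * a n)
        \<le> cos_error (\<theta> k) * (s n * ((s n)\<^sup>2 * real (c n)) + (s n)\<^sup>2 * T)"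
      using eventually_gt_at_top[of 0]
    proof eventually_elim
      case (elim n)
      have s: "0 < s n" "s n \<le> 1" using elim by (auto simp: s_def)
      have "\<bar>a' n - exp (- ((s n)\<^sup>2 * real (c n) * q (\<theta> k) / 2)) * a n\<bar>
        \<le> cos_error (\<theta> k) * ((s n) ^ 3 * real (c n) + (s n)\<^sup>2 * (\<Sum>l<c n. prob (bad (gridpt m n k + l))))"
        using cos_block[OF block_phase_adapted[where \<phi> = \<phi> and \<theta> = \<theta> and k = k and m = m and n = n] s, of "\<theta> k" "c n"]
        by (simp add: a_def a'_def block_def c_def s_def add.assoc)
      also have "\<dots> \<le> cos_error (\<theta> k) * ((s n) ^ 3 * real (c n) + (s n)\<^sup>2 * T)"
        unfolding T_def by (intro mult_left_mono add_left_mono sum_bad_le cos_error_nonneg) auto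
      also have "(s n) ^ 3 * real (c n) = s n * ((s n)\<^sup>2 * real (c n))"
        by (simp add: power3_eq_cube power2_eq_square)
      finally show ?case by (simp only: real_norm_def)
    qed
  qed
  from tendsto_add[OF this main]
  have "a' \<longlonglongrightarrow> exp (- (1 / real m * q (\<theta> k) / 2)) * (cos \<phi> * exp (- ((\<Sum>i<k. q (\<theta> i)) / (2 * real m))))"
    by simp
  also have "exp (- (1 / real m * q (\<theta> k) / 2)) * (cos \<phi> * exp (- ((\<Sum>i<k. q (\<theta> i)) / (2 * real m))))
    = cos \<phi> * (exp (- (1 / real m * q (\<theta> k) / 2)) * exp (- ((\<Sum>i<k. q (\<theta> i)) / (2 * real m))))"
    by simp
  also have "exp (- (1 / real m * q (\<theta> k) / 2)) * exp (- ((\<Sum>i<k. q (\<theta> i)) / (2 * real m))) = exp (- ((\<Sum>i<Suc k. q (\<theta> i)) / (2 * real m)))"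
    unfolding exp_add[symmetric] by (simp add: add_divide_distrib)
  finally show ?case unfolding a'_def .
qed

lemma incr_tail:
  assumes "0 < R"
  shows "prob {\<omega> \<in> space M. R \<le> norm (incr b k \<omega>)} \<le> B\<^sup>2 * real k / R\<^sup>2"
proof -
  have "prob {\<omega> \<in> space M. R \<le> norm (incr b k \<omega>)} \<le> prob {\<omega> \<in> space M. R\<^sup>2 \<le> (norm (incr b k \<omega>))\<^sup>2}"
    using assms by (intro finite_measure_mono) (auto intro: power_mono)
  also have "\<dots> \<le> (\<integral>\<omega>. (norm (incr b k \<omega>))\<^sup>2 \<partial>M) / R\<^sup>2"
    by (rule integral_Markov_inequality_measure[of _ _ "{}"]) (use assms incr_norm_pow_integrable in auto)
  also have "\<dots> \<le> B\<^sup>2 * real k / R\<^sup>2"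
    by (intro divide_right_mono incr_moment2) auto
  finally show ?thesis .
qed

lemma block_tight:
  assumes m: "0 < m" and e: "0 < e"
  shows "\<exists>R. \<forall>\<^sub>F n in sequentially. \<forall>i. prob {\<omega> \<in> space M. R < norm (block m n i \<omega>)} \<le> e"
proof -
  \<comment> \<open>A block has at most \<open>n / m + 1 \<le> 2 * n\<close> steps, hence second moment at most \<open>2 * B\<^sup>2\<close> after rescaling; the
summand \<open>1\<close> keeps \<open>R\<close> positive.\<close>
  define R where "R = sqrt ((2 * B\<^sup>2 + 1) / e)"
  have "0 < R" using e by (auto simp: R_def intro!: divide_pos_pos add_nonneg_pos)
  have "R\<^sup>2 = (2 * B\<^sup>2 + 1) / e" using e unfolding R_def by (subst real_sqrt_pow2) auto
  then have "R\<^sup>2 * e = 2 * B\<^sup>2 + 1" using e by simp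
  then have R2: "2 * B\<^sup>2 / R\<^sup>2 \<le> e" using \<open>0 < R\<close> by (simp add: divide_le_eq mult.commute)
  have "prob {\<omega> \<in> space M. R < norm (block m n i \<omega>)} \<le> e" if n: "0 < n" for n i
  proof -
    define c where "c = gridpt m n (Suc i) - gridpt m n i"
    have "real c \<le> real n / real m + 1" using gridpt_diff[OF m, of n i] by (simp add: c_def abs_le_iff)
    also have "real n / real m \<le> real n"
    proof -
      have "real n * 1 \<le> real n * real m" using m by (intro mult_left_mono) auto
      then show ?thesis using m by (simp add: divide_le_eq)
    qed
    finally have c: "real c \<le> 2 * real n" using n by simp
    have sn: "0 < sqrt (real n)" using n by simp
    have "prob {\<omega> \<in> space M. R < norm (block m n i \<omega>)} \<le> prob {\<omega> \<in> space M. R * sqrt (real n) \<le> norm (incr (gridpt m n i) c \<omega>)}"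
      using sn by (intro finite_measure_mono) (auto simp: block_def c_def field_simps)
    also have "\<dots> \<le> B\<^sup>2 * real c / (R * sqrt (real n))\<^sup>2"
      using \<open>0 < R\<close> sn by (intro incr_tail) auto
    also have "\<dots> \<le> B\<^sup>2 * (2 * real n) / (R * sqrt (real n))\<^sup>2"
      by (intro divide_right_mono mult_left_mono c) auto
    also have "\<dots> = 2 * B\<^sup>2 / R\<^sup>2" using n by (simp add: power_mult_distrib)
    finally show ?thesis using R2 by simp
  qed
  then show ?thesis
    by (intro exI[of _ R] eventually_mono[OF eventually_gt_at_top[of 0]]) auto
qed

definition scaled_path :: "nat \<Rightarrow> 'a \<Rightarrow> real \<Rightarrow> 'b" where
  "scaled_path n \<omega> t = (1 / sqrt (real n)) *\<^sub>R S (nat \<lfloor>real n * t\<rfloor>) \<omega>"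

definition grid_path :: "nat \<Rightarrow> nat \<Rightarrow> 'a \<Rightarrow> real \<Rightarrow> 'b" where
  "grid_path m n \<omega> t = (1 / sqrt (real n)) *\<^sub>R S (gridpt m n (nat \<lfloor>real m * t\<rfloor>)) \<omega>"

text \<open>
  A functional of the discretised path is a continuous function of the finitely many block increments,
  whose partial sums are the values of the path at the grid times.
\<close>

lemma grid_path_functional_tendsto:
  fixes Z :: "real \<Rightarrow> 'w \<Rightarrow> 'b"
  assumes N: "prob_space N" and Zm: "\<And>t. 0 \<le> t \<Longrightarrow> Z t \<in> borel_measurable N"
    and Z0: "\<And>\<omega>. \<omega> \<in> space N \<Longrightarrow> Z 0 \<omega> = 0" and m: "0 < m"
    and Zcos: "\<And>k \<theta> \<phi>. (\<integral>\<omega>. cos (\<phi> + (\<Sum>i<k. \<theta> i \<bullet> (Z (real (Suc i) / real m) \<omega> - Z (real i / real m) \<omega>))) \<partial>N)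
        = cos \<phi> * exp (- ((\<Sum>i<k. q (\<theta> i)) / (2 * real m)))"
    and L: "0 \<le> L" and lip: "loc_lip L \<Phi>" and bdd: "\<And>g. \<bar>\<Phi> g\<bar> \<le> C"
  shows "(\<lambda>n. \<integral>\<omega>. \<Phi> (grid_path m n \<omega>) \<partial>M) \<longlonglongrightarrow> (\<integral>\<omega>. \<Phi> (\<lambda>t. Z (real (nat \<lfloor>real m * t\<rfloor>) / real m) \<omega>) \<partial>N)"
proof -
  define k where "k = nat \<lfloor>real m * L\<rfloor>"
  define V where "V n i \<omega> = (if i < k then block m n i \<omega> else 0)" for n i \<omega>
  define U where "U i \<omega> = (if i < k then Z (real (Suc i) / real m) \<omega> - Z (real i / real m) \<omega> else 0)" for i \<omega>
  define G where "G y = \<Phi> (\<lambda>t. \<Sum>l<nat \<lfloor>real m * t\<rfloor>. y l)" for y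
  have [measurable]: "V n i \<in> borel_measurable M" for n i
    unfolding V_def by (cases "i < k") simp_all
  have [measurable]: "U i \<in> borel_measurable N" for i
  proof (cases "i < k")
    case True
    have "Z (real (Suc i) / real m) \<in> borel_measurable N" "Z (real i / real m) \<in> borel_measurable N" by (auto intro!: Zm)
    with True show ?thesis unfolding U_def by simp
  next
    case False
    then have "U i = (\<lambda>_. 0)" by (auto simp: U_def)
    then show ?thesis by simp
  qed
  have idx: "nat \<lfloor>real m * t\<rfloor> \<le> k" if "0 \<le> t" "t \<le> L" for t
    unfolding k_def using that by (intro nat_floor_mult_mono) auto
  have "continuous_on UNIV (\<lambda>y :: nat \<Rightarrow> 'b. (\<lambda>i. \<Sum>l<i. y l))"
    by (intro continuous_on_coordinatewise_then_product continuous_intros continuous_on_product_coordinates)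
  from continuous_on_compose2[OF loc_lip_step_continuous[OF lip L, where r = "\<lambda>t. nat \<lfloor>real m * t\<rfloor>" and k = k and c = "\<lambda>_. 0", OF idx] this]
  have Gc: "continuous_on UNIV G" unfolding G_def by simp
  have "(\<lambda>n. \<integral>\<omega>. G (\<lambda>i. V n i \<omega>) \<partial>M) \<longlonglongrightarrow> (\<integral>\<omega>. G (\<lambda>i. U i \<omega>) \<partial>N)"
  proof (rule expectation_continuous_tendsto[OF N, where k = k and V = V and U = U and G = G and C = C])
    show "(\<lambda>n. \<integral>\<omega>. cos (\<phi> + (\<Sum>i<k. \<theta> i \<bullet> V n i \<omega>)) \<partial>M) \<longlonglongrightarrow> (\<integral>\<omega>. cos (\<phi> + (\<Sum>i<k. \<theta> i \<bullet> U i \<omega>)) \<partial>N)" for \<theta> \<phi>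
      using blocks_cos_tendsto[OF m, of \<phi> \<theta> k] by (simp add: V_def U_def Zcos del: of_nat_Suc)
    show "\<exists>R. \<forall>\<^sub>F n in sequentially. \<forall>i<k. prob {\<omega> \<in> space M. R < norm (V n i \<omega>)} \<le> e" if "0 < e" for e
    proof -
      obtain R where "\<forall>\<^sub>F n in sequentially. \<forall>i. prob {\<omega> \<in> space M. R < norm (block m n i \<omega>)} \<le> e"
        using block_tight[OF m \<open>0 < e\<close>] by blast
      then show ?thesis by (intro exI[of _ R]) (auto elim!: eventually_mono simp: V_def)
    qed
    show "\<bar>G y\<bar> \<le> C" for y unfolding G_def by (rule bdd)
  qed (use Gc in \<open>auto simp: V_def U_def\<close>)
  moreover have "G (\<lambda>i. V n i \<omega>) = \<Phi> (grid_path m n \<omega>)" for n \<omega>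
    unfolding G_def
  proof (rule loc_lip_cong[OF lip])
    fix t assume "0 \<le> t" "t \<le> L"
    then have "(\<Sum>l<nat \<lfloor>real m * t\<rfloor>. V n l \<omega>) = (\<Sum>l<nat \<lfloor>real m * t\<rfloor>. block m n l \<omega>)"
      using idx[of t] by (intro sum.cong) (auto simp: V_def)
    then show "(\<Sum>l<nat \<lfloor>real m * t\<rfloor>. V n l \<omega>) = grid_path m n \<omega> t"
      by (simp add: sum_block grid_path_def)
  qed
  moreover have "G (\<lambda>i. U i \<omega>) = \<Phi> (\<lambda>t. Z (real (nat \<lfloor>real m * t\<rfloor>) / real m) \<omega>)" if "\<omega> \<in> space N" for \<omega>
    unfolding G_def
  proof (rule loc_lip_cong[OF lip])
    fix t assume "0 \<le> t" "t \<le> L"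
    then have "(\<Sum>l<nat \<lfloor>real m * t\<rfloor>. U l \<omega>) = (\<Sum>l<nat \<lfloor>real m * t\<rfloor>. Z (real (Suc l) / real m) \<omega> - Z (real l / real m) \<omega>)"
      using idx[of t] by (intro sum.cong) (auto simp: U_def)
    then show "(\<Sum>l<nat \<lfloor>real m * t\<rfloor>. U l \<omega>) = Z (real (nat \<lfloor>real m * t\<rfloor>) / real m) \<omega>"
      using Z0[OF that] sum_lessThan_telescope[of "\<lambda>l. Z (real l / real m) \<omega>"] by simp
  qed
  ultimately show ?thesis by (simp cong: Bochner_Integration.integral_cong)
qed

text \<open>
  The event that within one of the grid intervals meeting \<open>[0, L]\<close> the partial sums move by at least
  \<open>\<eta> * sqrt n\<close> from their value at the left end point. One step more than \<open>n div m\<close> is included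
  because the length of a grid interval is rounded.
\<close>

definition oscillates :: "real \<Rightarrow> real \<Rightarrow> nat \<Rightarrow> nat \<Rightarrow> 'a set" where
  "oscillates L \<eta> m n = (\<Union>a\<le>nat \<lfloor>real m * L\<rfloor>. exceeds (gridpt m n a) (\<eta> * sqrt (real n)) (n div m + 1))"

lemma oscillates_events [measurable]: "oscillates L \<eta> m n \<in> events"
  unfolding oscillates_def by measurable

text \<open>
  There are of order \<open>m * L\<close> intervals, and by the maximal inequality each contributes a probability of order
  \<open>(n / m)\<^sup>2 / (\<eta> * sqrt n) ^ 4 = 1 / (\<eta> ^ 4 * m\<^sup>2)\<close>. Fourth moments are needed here:
  second moments would give a total that does not decrease with \<open>m\<close>.
\<close>

lemma oscillates_prob:
  assumes "0 < \<eta>" "0 < m" "m \<le> n" "0 \<le> L"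
  shows "prob (oscillates L \<eta> m n) \<le> 28 * B ^ 4 * (L + 1) / \<eta> ^ 4 / real m"
proof -
  have n: "0 < n" using assms by simp
  define k where "k = nat \<lfloor>real m * L\<rfloor>"
  have "real k \<le> real m * L" using assms unfolding k_def by (intro of_nat_floor) auto
  then have k: "real k + 1 \<le> real m * (L + 1)" using assms(2) by (simp add: distrib_left)
  \<comment> \<open>This is where \<open>m \<le> n\<close> is needed.\<close>
  have N: "real (n div m + 1) \<le> 2 * real n / real m"
  proof -
    have "real (n div m) \<le> real n / real m" using nat_div_bounds[OF assms(2), of n] by simp
    moreover have "1 \<le> real n / real m" using assms by simp
    ultimately show ?thesis by simp
  qed
  have pos: "0 < \<eta> * sqrt (real n)" using assms n by simp
  have "prob (oscillates L \<eta> m n) \<le> (\<Sum>a\<le>k. prob (exceeds (gridpt m n a) (\<eta> * sqrt (real n)) (n div m + 1)))"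
    unfolding oscillates_def k_def by (rule finite_measure_subadditive_finite) auto
  also have "\<dots> \<le> (\<Sum>a\<le>k. 7 * B ^ 4 * (real (n div m + 1))\<^sup>2 / (\<eta> * sqrt (real n)) ^ 4)"
    by (intro sum_mono maximal_inequality pos)
  also have "\<dots> = (real k + 1) * (7 * B ^ 4 * (real (n div m + 1))\<^sup>2 / (\<eta> * sqrt (real n)) ^ 4)"
    by simp
  also have "\<dots> \<le> (real m * (L + 1)) * (7 * B ^ 4 * (2 * real n / real m)\<^sup>2 / (\<eta> * sqrt (real n)) ^ 4)"
    using k N pos B_nonneg by (intro mult_mono divide_right_mono mult_left_mono power_mono) auto
  also have "(\<eta> * sqrt (real n)) ^ 4 = \<eta> ^ 4 * (real n)\<^sup>2"
  proof -
    have "sqrt (real n) ^ 4 = ((sqrt (real n))\<^sup>2)\<^sup>2" unfolding power_mult[symmetric] by simp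
    then show ?thesis by (simp add: power_mult_distrib)
  qed
  also have "(real m * (L + 1)) * (7 * B ^ 4 * (2 * real n / real m)\<^sup>2 / (\<eta> ^ 4 * (real n)\<^sup>2)) = 28 * B ^ 4 * (L + 1) / \<eta> ^ 4 / real m"
    using n assms by (simp add: power_divide power_mult_distrib divide_simps) (simp add: power2_eq_square algebra_simps)
  finally show ?thesis .
qed

lemma path_close_to_grid:
  assumes "0 < \<eta>" "0 < m" "0 < n" "\<omega> \<in> space M" "\<omega> \<notin> oscillates L \<eta> m n" "0 \<le> t" "t \<le> L"
  shows "dist (scaled_path n \<omega> t) (grid_path m n \<omega> t) \<le> \<eta>"
proof -
  define a where "a = nat \<lfloor>real m * t\<rfloor>"
  define u where "u = nat \<lfloor>real n * t\<rfloor>"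
  have a: "real a \<le> real m * t" "real m * t < real a + 1"
    using assms(2,6) unfolding a_def by (simp_all add: of_nat_nat)
  have u: "real u \<le> real n * t" "real n * t < real u + 1"
    using assms(3,6) unfolding u_def by (simp_all add: of_nat_nat)
  have ak: "a \<le> nat \<lfloor>real m * L\<rfloor>" unfolding a_def using assms by (intro nat_floor_mult_mono) auto
  have "real n * real a / real m \<le> real n * t"
  proof -
    have "real n * real a \<le> real n * (real m * t)" using a by (intro mult_left_mono) auto
    then show ?thesis using assms(2) by (simp add: divide_le_eq mult_ac)
  qed
  then have "real (gridpt m n a) < real u + 1" using gridpt_bounds[OF assms(2), of n a] u by linarith
  then have pu: "gridpt m n a \<le> u" by linarith
  have "real n * t < real n * real a / real m + real n / real m"
  proof -
    have "real n * (real m * t) < real n * (real a + 1)" using a assms(3) by simp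
    then show ?thesis using assms(2) by (simp add: field_simps)
  qed
  moreover have "real n / real m < real (n div m) + 1"
    by (rule nat_div_bounds[OF assms(2)])
  ultimately have "real u < real (gridpt m n a) + real (n div m) + 2"
    using gridpt_bounds[OF assms(2), of n a] u by linarith
  then have "u - gridpt m n a \<le> n div m + 1" by linarith
  moreover have "\<omega> \<notin> exceeds (gridpt m n a) (\<eta> * sqrt (real n)) (n div m + 1)"
    using assms(5) ak unfolding oscillates_def by auto
  ultimately have *: "norm (incr (gridpt m n a) (u - gridpt m n a) \<omega>) < \<eta> * sqrt (real n)"
    using assms(4) unfolding exceeds_def by (metis (mono_tags, lifting) mem_Collect_eq not_le)
  have "S u \<omega> = S (gridpt m n a) \<omega> + incr (gridpt m n a) (u - gridpt m n a) \<omega>"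
    using S_add[of "gridpt m n a" "u - gridpt m n a" \<omega>] pu by simp
  then have "scaled_path n \<omega> t - grid_path m n \<omega> t = (1 / sqrt (real n)) *\<^sub>R incr (gridpt m n a) (u - gridpt m n a) \<omega>"
    by (simp add: scaled_path_def grid_path_def a_def[symmetric] u_def[symmetric] scaleR_add_right)
  then have "dist (scaled_path n \<omega> t) (grid_path m n \<omega> t) = norm (incr (gridpt m n a) (u - gridpt m n a) \<omega>) / sqrt (real n)"
    by (simp add: dist_norm)
  also have "\<dots> \<le> \<eta>" using * assms(3) by (simp add: divide_le_eq)
  finally show ?thesis .
qed

lemma scaled_path_functional_integrable:
  assumes "0 \<le> L" "loc_lip L \<Phi>" "\<And>g. \<bar>\<Phi> g\<bar> \<le> C"
  shows "integrable M (\<lambda>\<omega>. \<Phi> (scaled_path n \<omega>))"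
proof (rule bounded_integrable[of _ C])
  show "(\<lambda>\<omega>. \<Phi> (scaled_path n \<omega>)) \<in> borel_measurable M"
    using loc_lip_step_measurable[OF assms(2,1), of "real n" "\<lambda>i \<omega>. (1 / sqrt (real n)) *\<^sub>R S i \<omega>" M "\<lambda>_. 0"]
    by (simp add: scaled_path_def[abs_def])
qed (simp add: assms(3))

lemma grid_path_functional_integrable:
  assumes "0 \<le> L" "loc_lip L \<Phi>" "\<And>g. \<bar>\<Phi> g\<bar> \<le> C"
  shows "integrable M (\<lambda>\<omega>. \<Phi> (grid_path m n \<omega>))"
proof (rule bounded_integrable[of _ C])
  show "(\<lambda>\<omega>. \<Phi> (grid_path m n \<omega>)) \<in> borel_measurable M"
    using loc_lip_step_measurable[OF assms(2,1), of "real m" "\<lambda>i \<omega>. (1 / sqrt (real n)) *\<^sub>R S (gridpt m n i) \<omega>" M "\<lambda>_. 0"]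
    by (simp add: grid_path_def[abs_def])
qed (simp add: assms(3))

text \<open>
  Invariance principle for functionals. The limit process enters only through its continuity and the
  cosine expectations of its increments over grids. First \<open>m\<close> is chosen so that
  discretisation is harmless on both sides, uniformly in \<open>n \<ge> m\<close>; then \<open>n\<close> tends to infinity.
\<close>

theorem scaled_path_functional_tendsto:
  fixes Z :: "real \<Rightarrow> 'w \<Rightarrow> 'b"
  assumes N: "prob_space N" and Zm: "\<And>t. 0 \<le> t \<Longrightarrow> Z t \<in> borel_measurable N"
    and Z0: "\<And>\<omega>. \<omega> \<in> space N \<Longrightarrow> Z 0 \<omega> = 0"
    and Zc: "\<And>\<omega>. \<omega> \<in> space N \<Longrightarrow> continuous_on {0..} (\<lambda>t. Z t \<omega>)"
    and Zcos: "\<And>m k \<theta> \<phi>. 0 < m \<Longrightarrow>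
        (\<integral>\<omega>. cos (\<phi> + (\<Sum>i<k. \<theta> i \<bullet> (Z (real (Suc i) / real m) \<omega> - Z (real i / real m) \<omega>))) \<partial>N)
        = cos \<phi> * exp (- ((\<Sum>i<k. q (\<theta> i)) / (2 * real m)))"
    and L: "0 \<le> L" and lip: "loc_lip L \<Phi>" and bdd: "\<And>g. \<bar>\<Phi> g\<bar> \<le> C"
  shows "(\<lambda>n. \<integral>\<omega>. \<Phi> (scaled_path n \<omega>) \<partial>M) \<longlonglongrightarrow> (\<integral>\<omega>. \<Phi> (\<lambda>t. Z t \<omega>) \<partial>N)"
proof (rule LIMSEQ_I)
  interpret N: prob_space N by fact
  fix r :: real assume "0 < r"
  have "0 \<le> C" using bdd[of undefined] by linarith
  define \<eta> where "\<eta> = r / 4 / (L + 1)"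
  have "0 < \<eta>" using \<open>0 < r\<close> L by (simp add: \<eta>_def)
  have "L * \<eta> \<le> (L + 1) * \<eta>" using \<open>0 < \<eta>\<close> by simp
  also have "(L + 1) * \<eta> = r / 4"
  proof -
    have "L + 1 \<noteq> 0" using L by simp
    then have "\<eta> * (L + 1) = r / 4" unfolding \<eta>_def by (rule nonzero_eq_divide_eq[THEN iffD1]) (rule refl)
    then show ?thesis by (simp only: mult.commute)
  qed
  finally have L\<eta>: "L * \<eta> \<le> r / 4" .
  let ?grid = "\<lambda>m \<omega> t. Z (real (nat \<lfloor>real m * t\<rfloor>) / real m) \<omega>"
  note Z_measurable = continuous_functional_measurable[OF Zm Zc L lip]
  have pointwise: "(\<lambda>m. \<Phi> (?grid m \<omega>)) \<longlonglongrightarrow> \<Phi> (\<lambda>t. Z t \<omega>)" if "\<omega> \<in> space N" for \<omega>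
    by (rule grid_discretisation_tendsto[OF lip L Zc[OF that]])
  have "(\<lambda>m. \<integral>\<omega>. \<Phi> (?grid m \<omega>) \<partial>N) \<longlonglongrightarrow> (\<integral>\<omega>. \<Phi> (\<lambda>t. Z t \<omega>) \<partial>N)"
  proof (rule integral_dominated_convergence[where w = "\<lambda>_. C"])
  qed (use pointwise Z_measurable bdd in auto)
  from LIMSEQ_D[OF this, of "r / 4"] \<open>0 < r\<close>
  obtain m1 where m1: "\<And>m. m1 \<le> m \<Longrightarrow> \<bar>(\<integral>\<omega>. \<Phi> (?grid m \<omega>) \<partial>N) - (\<integral>\<omega>. \<Phi> (\<lambda>t. Z t \<omega>) \<partial>N)\<bar> < r / 4"
    by (auto simp: real_norm_def)
  define A where "A = 2 * C * (28 * B ^ 4 * (L + 1) / \<eta> ^ 4)"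
  have "(\<lambda>m. A / real m) \<longlonglongrightarrow> 0" by (rule lim_const_over_n)
  from LIMSEQ_D[OF this, of "r / 4"] \<open>0 < r\<close>
  obtain m2 where m2: "\<And>m. m2 \<le> m \<Longrightarrow> \<bar>A / real m\<bar> < r / 4"
    by (auto simp: real_norm_def)
  define m where "m = Suc (max m1 m2)"
  have m: "0 < m" "m1 \<le> m" "m2 \<le> m" by (auto simp: m_def)
  have "(\<lambda>n. \<integral>\<omega>. \<Phi> (grid_path m n \<omega>) \<partial>M) \<longlonglongrightarrow> (\<integral>\<omega>. \<Phi> (?grid m \<omega>) \<partial>N)"
    by (rule grid_path_functional_tendsto[OF N Zm Z0 m(1) Zcos[OF m(1)] L lip bdd])
  from LIMSEQ_D[OF this, of "r / 4"] \<open>0 < r\<close>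
  obtain n1 where n1: "\<And>n. n1 \<le> n \<Longrightarrow> \<bar>(\<integral>\<omega>. \<Phi> (grid_path m n \<omega>) \<partial>M) - (\<integral>\<omega>. \<Phi> (?grid m \<omega>) \<partial>N)\<bar> < r / 4"
    by (auto simp: real_norm_def)
  have "norm ((\<integral>\<omega>. \<Phi> (scaled_path n \<omega>) \<partial>M) - (\<integral>\<omega>. \<Phi> (\<lambda>t. Z t \<omega>) \<partial>N)) < r" if n: "max n1 m \<le> n" for n
  proof -
    have "0 < n" "m \<le> n" "n1 \<le> n" using n m by auto
    note int_path = scaled_path_functional_integrable[OF L lip bdd] and int_grid = grid_path_functional_integrable[OF L lip bdd]
    have "\<bar>(\<integral>\<omega>. \<Phi> (scaled_path n \<omega>) \<partial>M) - (\<integral>\<omega>. \<Phi> (grid_path m n \<omega>) \<partial>M)\<bar> \<le> L * \<eta> + 2 * C * prob (oscillates L \<eta> m n)"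
    proof (rule expectation_diff_le[OF int_path int_grid])
      show "\<bar>\<Phi> (scaled_path n \<omega>) - \<Phi> (grid_path m n \<omega>)\<bar> \<le> L * \<eta>" if "\<omega> \<in> space M" "\<omega> \<notin> oscillates L \<eta> m n" for \<omega>
        using that \<open>0 < \<eta>\<close> m \<open>0 < n\<close> by (intro loc_lipD[OF lip] path_close_to_grid) auto
      show "\<bar>\<Phi> (scaled_path n \<omega>) - \<Phi> (grid_path m n \<omega>)\<bar> \<le> L * \<eta> + 2 * C" for \<omega>
        using bdd[of "scaled_path n \<omega>"] bdd[of "grid_path m n \<omega>"] mult_nonneg_nonneg[OF L less_imp_le[OF \<open>0 < \<eta>\<close>]] by linarith
    qed (use \<open>0 \<le> C\<close> in auto)
    also have "2 * C * prob (oscillates L \<eta> m n) \<le> 2 * C * (28 * B ^ 4 * (L + 1) / \<eta> ^ 4 / real m)"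
      using \<open>0 \<le> C\<close> by (intro mult_left_mono oscillates_prob \<open>0 < \<eta>\<close> m \<open>m \<le> n\<close> L) auto
    also have "\<dots> = A / real m" by (simp add: A_def)
    finally show ?thesis
      using L\<eta> m1[OF m(2)] m2[OF m(3)] n1[OF \<open>n1 \<le> n\<close>] unfolding real_norm_def by linarith
  qed
  then show "\<exists>no. \<forall>n\<ge>no. norm ((\<integral>\<omega>. \<Phi> (scaled_path n \<omega>) \<partial>M) - (\<integral>\<omega>. \<Phi> (\<lambda>t. Z t \<omega>) \<partial>N)) < r"
    by blast
qed

end

section \<open>Processes close to a martingale\<close>

context bounded_martingale_differences
begin

lemma expected_bad_count: "(\<integral>\<omega>. (\<Sum>l<k. indicator (bad l) \<omega>) \<partial>M) \<le> (\<Sum>l. prob (bad l))"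
proof -
  have "(\<integral>\<omega>. (\<Sum>l<k. indicator (bad l) \<omega>) \<partial>M) = (\<Sum>l<k. prob (bad l))"
    by (subst Bochner_Integration.integral_sum) (auto simp: less_top[symmetric])
  then show ?thesis using sum_bad_le[of 0 k] by simp
qed

lemma bad_count_integrable: "integrable M (\<lambda>\<omega>. (\<Sum>l<k. indicat_real (bad l) \<omega>))"
  by (intro Bochner_Integration.integrable_sum integrable_real_indicator) (auto simp: less_top[symmetric])

text \<open>
  The deviation from the martingale is at most a constant plus a multiple of the number of bad times. This
  number has bounded expectation, so after division by \<open>sqrt n\<close> the expected uniform distance of the
  two paths on \<open>[0, L]\<close> tends to zero. The summand \<open>norm v\<close> accounts for the difference between
  \<open>n * t\<close> and its integer part.
\<close>

theorem near_martingale_functional_tendsto: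
  fixes Z :: "real \<Rightarrow> 'w \<Rightarrow> 'b" and R :: "nat \<Rightarrow> 'a \<Rightarrow> 'b"
  assumes N: "prob_space N" and Zm: "\<And>t. 0 \<le> t \<Longrightarrow> Z t \<in> borel_measurable N"
    and Z0: "\<And>\<omega>. \<omega> \<in> space N \<Longrightarrow> Z 0 \<omega> = 0"
    and Zc: "\<And>\<omega>. \<omega> \<in> space N \<Longrightarrow> continuous_on {0..} (\<lambda>t. Z t \<omega>)"
    and Zcos: "\<And>m k \<theta> \<phi>. 0 < m \<Longrightarrow>
        (\<integral>\<omega>. cos (\<phi> + (\<Sum>i<k. \<theta> i \<bullet> (Z (real (Suc i) / real m) \<omega> - Z (real i / real m) \<omega>))) \<partial>N)
        = cos \<phi> * exp (- ((\<Sum>i<k. q (\<theta> i)) / (2 * real m)))"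
    and R [measurable]: "\<And>k. R k \<in> borel_measurable M"
    and near: "AE \<omega> in M. \<forall>k. norm (R k \<omega> - S k \<omega> - real k *\<^sub>R v) \<le> c0 + c * (\<Sum>l<k. indicator (bad l) \<omega>)"
    and c: "0 \<le> c0" "0 \<le> c"
    and L: "0 \<le> L" and lip: "loc_lip L \<Phi>" and bdd: "\<And>g. \<bar>\<Phi> g\<bar> \<le> C"
  shows "(\<lambda>n. \<integral>\<omega>. \<Phi> (\<lambda>t. (R (nat \<lfloor>real n * t\<rfloor>) \<omega> - (real n * t) *\<^sub>R v) /\<^sub>R sqrt (real n)) \<partial>M)
    \<longlonglongrightarrow> (\<integral>\<omega>. \<Phi> (\<lambda>t. Z t \<omega>) \<partial>N)"
proof -
  define Y where "Y n \<omega> t = (R (nat \<lfloor>real n * t\<rfloor>) \<omega> - (real n * t) *\<^sub>R v) /\<^sub>R sqrt (real n)" for n \<omega> t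
  define T where "T = (\<Sum>l. prob (bad l))"
  define A where "A = L * (c0 + norm v + c * T)"
  have main: "(\<lambda>n. \<integral>\<omega>. \<Phi> (scaled_path n \<omega>) \<partial>M) \<longlonglongrightarrow> (\<integral>\<omega>. \<Phi> (\<lambda>t. Z t \<omega>) \<partial>N)"
    by (rule scaled_path_functional_tendsto[OF N Zm Z0 Zc Zcos L lip bdd])
  have "(\<lambda>n. (\<integral>\<omega>. \<Phi> (Y n \<omega>) \<partial>M) - (\<integral>\<omega>. \<Phi> (scaled_path n \<omega>) \<partial>M)) \<longlonglongrightarrow> 0"
  proof (rule Lim_null_comparison)
    have "(\<lambda>n. A * sqrt (1 / real n)) \<longlonglongrightarrow> A * sqrt 0" by (intro tendsto_intros lim_1_over_n)
    then show "(\<lambda>n. A * sqrt (1 / real n)) \<longlonglongrightarrow> 0" by simp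
    show "\<forall>\<^sub>F n in sequentially. norm ((\<integral>\<omega>. \<Phi> (Y n \<omega>) \<partial>M) - (\<integral>\<omega>. \<Phi> (scaled_path n \<omega>) \<partial>M)) \<le> A * sqrt (1 / real n)"
      using eventually_gt_at_top[of 0]
    proof eventually_elim
      case (elim n)
      define k where "k = nat \<lfloor>real n * L\<rfloor>"
      have idx: "nat \<lfloor>real n * t\<rfloor> \<le> k" if "0 \<le> t" "t \<le> L" for t
        unfolding k_def using that by (intro nat_floor_mult_mono) auto
      note int_path = scaled_path_functional_integrable[OF L lip bdd]
      have "(\<lambda>\<omega>. \<Phi> (Y n \<omega>)) \<in> borel_measurable M"
        using loc_lip_step_measurable[OF lip L, of "real n" "\<lambda>i \<omega>. R i \<omega> /\<^sub>R sqrt (real n)" M "\<lambda>t. - ((real n * t) *\<^sub>R v /\<^sub>R sqrt (real n))"]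
        by (simp add: Y_def[abs_def] scaleR_diff_right)
      then have int_Y: "integrable M (\<lambda>\<omega>. \<Phi> (Y n \<omega>))"
        by (rule bounded_integrable[of _ C]) (simp add: bdd)
      define err where "err \<omega> = L * ((c0 + norm v + c * (\<Sum>l<k. indicat_real (bad l) \<omega>)) * sqrt (1 / real n))" for \<omega>
      have int_err: "integrable M err" unfolding err_def using bad_count_integrable by simp
      have "AE \<omega> in M. \<bar>\<Phi> (Y n \<omega>) - \<Phi> (scaled_path n \<omega>)\<bar> \<le> err \<omega>"
        using near
      proof eventually_elim
        case (elim \<omega>)
        show ?case
          unfolding err_def
        proof (rule loc_lipD[OF lip])
          fix t assume t: "0 \<le> t" "t \<le> L"
          define u where "u = nat \<lfloor>real n * t\<rfloor>"
          have u: "real u \<le> real n * t" "real n * t \<le> real u + 1"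
            using t unfolding u_def by (simp_all add: of_nat_nat)
          have "(\<Sum>l<u. indicat_real (bad l) \<omega>) \<le> (\<Sum>l<k. indicat_real (bad l) \<omega>)"
            using idx[OF t] by (intro sum_mono2) (auto simp: u_def)
          then have "c * (\<Sum>l<u. indicat_real (bad l) \<omega>) \<le> c * (\<Sum>l<k. indicat_real (bad l) \<omega>)"
            using c by (intro mult_left_mono) auto
          moreover have "norm ((real u - real n * t) *\<^sub>R v) \<le> norm v"
            using u by (simp add: mult_left_le_one_le)
          ultimately have "norm ((R u \<omega> - S u \<omega> - real u *\<^sub>R v) + (real u - real n * t) *\<^sub>R v) \<le> c0 + norm v + c * (\<Sum>l<k. indicat_real (bad l) \<omega>)"
            using elim[rule_format, of u] norm_triangle_ineq[of "R u \<omega> - S u \<omega> - real u *\<^sub>R v" "(real u - real n * t) *\<^sub>R v"] by linarith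
          moreover have "Y n \<omega> t - scaled_path n \<omega> t = ((R u \<omega> - S u \<omega> - real u *\<^sub>R v) + (real u - real n * t) *\<^sub>R v) /\<^sub>R sqrt (real n)"
            unfolding Y_def scaled_path_def u_def[symmetric] by (simp add: algebra_simps inverse_eq_divide)
          ultimately show "dist (Y n \<omega> t) (scaled_path n \<omega> t) \<le> (c0 + norm v + c * (\<Sum>l<k. indicat_real (bad l) \<omega>)) * sqrt (1 / real n)"
            by (simp add: dist_norm real_sqrt_divide divide_right_mono inverse_eq_divide)
        qed (use c in \<open>auto intro!: mult_nonneg_nonneg add_nonneg_nonneg sum_nonneg\<close>)
      qed
      then have "(\<integral>\<omega>. \<bar>\<Phi> (Y n \<omega>) - \<Phi> (scaled_path n \<omega>)\<bar> \<partial>M) \<le> (\<integral>\<omega>. err \<omega> \<partial>M)"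
        using int_Y int_path int_err by (intro integral_mono_AE) auto
      also have "\<dots> = L * ((c0 + norm v + c * (\<integral>\<omega>. (\<Sum>l<k. indicat_real (bad l) \<omega>) \<partial>M)) * sqrt (1 / real n))"
        unfolding err_def using bad_count_integrable by (simp add: prob_space)
      also have "\<dots> \<le> L * ((c0 + norm v + c * T) * sqrt (1 / real n))"
        unfolding T_def using L c by (intro mult_left_mono mult_right_mono add_left_mono expected_bad_count) auto
      also have "\<dots> = A * sqrt (1 / real n)" by (simp add: A_def)
      finally have "(\<integral>\<omega>. \<bar>\<Phi> (Y n \<omega>) - \<Phi> (scaled_path n \<omega>)\<bar> \<partial>M) \<le> A * sqrt (1 / real n)" .
      moreover have "\<bar>(\<integral>\<omega>. \<Phi> (Y n \<omega>) - \<Phi> (scaled_path n \<omega>) \<partial>M)\<bar> \<le> (\<integral>\<omega>. \<bar>\<Phi> (Y n \<omega>) - \<Phi> (scaled_path n \<omega>)\<bar> \<partial>M)"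
        by (rule integral_abs_bound)
      ultimately show ?case using int_Y int_path by simp
    qed
  qed
  from tendsto_add[OF this main] show ?thesis by (simp add: Y_def[abs_def])
qed

end

lemma abs_cos_diff_le: "\<bar>cos a - cos b\<bar> \<le> \<bar>a - b\<bar>" for a b :: real
proof -
  have "\<bar>cos a - cos b\<bar> = 2 * (\<bar>sin ((a + b) / 2)\<bar> * \<bar>sin ((b - a) / 2)\<bar>)"
    by (simp add: cos_diff_cos abs_mult)
  also have "\<dots> \<le> 2 * (1 * \<bar>(b - a) / 2\<bar>)"
    by (intro mult_left_mono mult_mono abs_sin_x_le_abs_x) auto
  finally show ?thesis by simp
qed

context bounded_martingale_differences
begin

context
  fixes R :: "nat \<Rightarrow> 'a \<Rightarrow> 'b" and v :: 'b and c0 c :: real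
  assumes R [measurable]: "\<And>k. R k \<in> borel_measurable M"
    and near: "AE \<omega> in M. \<forall>k. norm (R k \<omega> - S k \<omega> - real k *\<^sub>R v) \<le> c0 + c * (\<Sum>l<k. indicator (bad l) \<omega>)"
    and c: "0 \<le> c0" "0 \<le> c"
begin

definition marginal :: "nat \<Rightarrow> 'a \<Rightarrow> 'b" where
  "marginal n \<omega> = (R n \<omega> - real n *\<^sub>R v) /\<^sub>R sqrt (real n)"

lemma marginal_measurable [measurable]: "marginal n \<in> borel_measurable M"
  unfolding marginal_def by measurable

text \<open>
  For the grid of mesh \<open>1\<close> the first block is the whole rescaled sum, which reduces the convergence at the single
  time \<open>1\<close> to the results on blocks.
\<close>

lemma block_1: "block 1 n 0 \<omega> = S n \<omega> /\<^sub>R sqrt (real n)"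
  using sum_block[where m = 1 and n = n and k = 1 and \<omega> = \<omega>] by (simp add: gridpt_def inverse_eq_divide)

lemma marginal_near_block:
  assumes n: "0 < n"
  shows "integrable M (\<lambda>\<omega>. norm (marginal n \<omega> - block 1 n 0 \<omega>))"
    and "(\<integral>\<omega>. norm (marginal n \<omega> - block 1 n 0 \<omega>) \<partial>M) \<le> (c0 + c * (\<Sum>l. prob (bad l))) * sqrt (1 / real n)"
proof -
  have le: "AE \<omega> in M. norm (marginal n \<omega> - block 1 n 0 \<omega>) \<le> (c0 + c * (\<Sum>l<n. indicat_real (bad l) \<omega>)) * sqrt (1 / real n)"
    using near
  proof eventually_elim
    case (elim \<omega>)
    have "marginal n \<omega> - block 1 n 0 \<omega> = (R n \<omega> - S n \<omega> - real n *\<^sub>R v) /\<^sub>R sqrt (real n)"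
      unfolding marginal_def block_1 by (simp add: algebra_simps)
    then show ?case
      using elim[rule_format, of n] by (simp add: real_sqrt_divide divide_right_mono inverse_eq_divide)
  qed
  have int: "integrable M (\<lambda>\<omega>. (c0 + c * (\<Sum>l<n. indicat_real (bad l) \<omega>)) * sqrt (1 / real n))"
    using bad_count_integrable by simp
  show i: "integrable M (\<lambda>\<omega>. norm (marginal n \<omega> - block 1 n 0 \<omega>))"
    by (rule Bochner_Integration.integrable_bound[OF int]) (use le in \<open>auto elim!: eventually_mono\<close>)
  have "(\<integral>\<omega>. norm (marginal n \<omega> - block 1 n 0 \<omega>) \<partial>M) \<le> (\<integral>\<omega>. (c0 + c * (\<Sum>l<n. indicat_real (bad l) \<omega>)) * sqrt (1 / real n) \<partial>M)"
    by (rule integral_mono_AE[OF i int le])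
  also have "\<dots> = (c0 + c * (\<integral>\<omega>. (\<Sum>l<n. indicat_real (bad l) \<omega>) \<partial>M)) * sqrt (1 / real n)"
    using bad_count_integrable by (simp add: prob_space)
  also have "\<dots> \<le> (c0 + c * (\<Sum>l. prob (bad l))) * sqrt (1 / real n)"
    using c by (intro mult_left_mono mult_right_mono add_left_mono expected_bad_count) auto
  finally show "(\<integral>\<omega>. norm (marginal n \<omega> - block 1 n 0 \<omega>) \<partial>M) \<le> (c0 + c * (\<Sum>l. prob (bad l))) * sqrt (1 / real n)" .
qed

lemma marginal_error_tendsto: "(\<lambda>n. A * sqrt (1 / real n)) \<longlonglongrightarrow> 0"
proof -
  have "(\<lambda>n. A * sqrt (1 / real n)) \<longlonglongrightarrow> A * sqrt 0" by (intro tendsto_intros lim_1_over_n)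
  then show ?thesis by simp
qed

lemma marginal_cos_tendsto:
  "(\<lambda>n. \<integral>\<omega>. cos (\<phi> + \<theta> \<bullet> marginal n \<omega>) \<partial>M) \<longlonglongrightarrow> cos \<phi> * exp (- (q \<theta> / 2))"
proof -
  have "(\<lambda>n. (\<integral>\<omega>. cos (\<phi> + \<theta> \<bullet> marginal n \<omega>) \<partial>M) - (\<integral>\<omega>. cos (\<phi> + \<theta> \<bullet> block 1 n 0 \<omega>) \<partial>M)) \<longlonglongrightarrow> 0"
  proof (rule Lim_null_comparison[OF _ marginal_error_tendsto])
    show "\<forall>\<^sub>F n in sequentially. norm ((\<integral>\<omega>. cos (\<phi> + \<theta> \<bullet> marginal n \<omega>) \<partial>M) - (\<integral>\<omega>. cos (\<phi> + \<theta> \<bullet> block 1 n 0 \<omega>) \<partial>M))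
      \<le> (norm \<theta> * (c0 + c * (\<Sum>l. prob (bad l)))) * sqrt (1 / real n)"
      using eventually_gt_at_top[of 0]
    proof eventually_elim
      case (elim n)
      have int: "integrable M (\<lambda>\<omega>. cos (\<phi> + \<theta> \<bullet> marginal n \<omega>))" "integrable M (\<lambda>\<omega>. cos (\<phi> + \<theta> \<bullet> block 1 n 0 \<omega>))"
        by (rule bounded_integrable[of _ 1]; simp)+
      have "\<bar>(\<integral>\<omega>. cos (\<phi> + \<theta> \<bullet> marginal n \<omega>) \<partial>M) - (\<integral>\<omega>. cos (\<phi> + \<theta> \<bullet> block 1 n 0 \<omega>) \<partial>M)\<bar>
         = \<bar>\<integral>\<omega>. cos (\<phi> + \<theta> \<bullet> marginal n \<omega>) - cos (\<phi> + \<theta> \<bullet> block 1 n 0 \<omega>) \<partial>M\<bar>"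
        using int by simp
      also have "\<dots> \<le> (\<integral>\<omega>. norm \<theta> * norm (marginal n \<omega> - block 1 n 0 \<omega>) \<partial>M)"
      proof (rule order_trans[OF integral_abs_bound integral_mono])
        show "\<bar>cos (\<phi> + \<theta> \<bullet> marginal n \<omega>) - cos (\<phi> + \<theta> \<bullet> block 1 n 0 \<omega>)\<bar> \<le> norm \<theta> * norm (marginal n \<omega> - block 1 n 0 \<omega>)" for \<omega>
          using abs_cos_diff_le[of "\<phi> + \<theta> \<bullet> marginal n \<omega>" "\<phi> + \<theta> \<bullet> block 1 n 0 \<omega>"]
            Cauchy_Schwarz_ineq2[of \<theta> "marginal n \<omega> - block 1 n 0 \<omega>"] by (simp add: inner_diff_right)
      qed (use int marginal_near_block(1)[OF elim] in auto)
      also have "\<dots> = norm \<theta> * (\<integral>\<omega>. norm (marginal n \<omega> - block 1 n 0 \<omega>) \<partial>M)" by simp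
      also have "\<dots> \<le> norm \<theta> * ((c0 + c * (\<Sum>l. prob (bad l))) * sqrt (1 / real n))"
        by (intro mult_left_mono marginal_near_block(2)[OF elim]) auto
      finally show ?case by (simp add: mult.assoc)
    qed
  qed
  moreover have "(\<lambda>n. \<integral>\<omega>. cos (\<phi> + \<theta> \<bullet> block 1 n 0 \<omega>) \<partial>M) \<longlonglongrightarrow> cos \<phi> * exp (- (q \<theta> / 2))"
    using blocks_cos_tendsto[of 1 \<phi> "\<lambda>_. \<theta>" 1] by simp
  ultimately show ?thesis using tendsto_add by fastforce
qed

lemma marginal_tight:
  assumes e: "0 < e"
  shows "\<exists>r. \<forall>\<^sub>F n in sequentially. prob {\<omega> \<in> space M. r < norm (marginal n \<omega>)} \<le> e"
proof -
  define A where "A = c0 + c * (\<Sum>l. prob (bad l))"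
  obtain r where r: "\<forall>\<^sub>F n in sequentially. \<forall>i. prob {\<omega> \<in> space M. r < norm (block 1 n i \<omega>)} \<le> e / 2"
    using block_tight[of 1 "e / 2"] e by auto
  have "\<forall>\<^sub>F n in sequentially. A * sqrt (1 / real n) < e / 2"
    using order_tendstoD(2)[OF marginal_error_tendsto[of A], of "e / 2"] e by simp
  with r eventually_gt_at_top[of 0]
  have "\<forall>\<^sub>F n in sequentially. prob {\<omega> \<in> space M. r + 1 < norm (marginal n \<omega>)} \<le> e"
  proof eventually_elim
    case (elim n)
    let ?d = "\<lambda>\<omega>. norm (marginal n \<omega> - block 1 n 0 \<omega>)"
    \<comment> \<open>If the norm exceeds \<open>r + 1\<close>, then either the block exceeds \<open>r\<close> or the two differ by at least \<open>1\<close>.\<close>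
    have "prob {\<omega> \<in> space M. r + 1 < norm (marginal n \<omega>)} \<le> prob ({\<omega> \<in> space M. r < norm (block 1 n 0 \<omega>)} \<union> {\<omega> \<in> space M. 1 \<le> ?d \<omega>})"
    proof (rule finite_measure_mono)
      have "r < norm (block 1 n 0 \<omega>) \<or> 1 \<le> ?d \<omega>" if "r + 1 < norm (marginal n \<omega>)" for \<omega>
        using norm_triangle_ineq[of "block 1 n 0 \<omega>" "marginal n \<omega> - block 1 n 0 \<omega>"] that by auto
      then show "{\<omega> \<in> space M. r + 1 < norm (marginal n \<omega>)} \<subseteq> {\<omega> \<in> space M. r < norm (block 1 n 0 \<omega>)} \<union> {\<omega> \<in> space M. 1 \<le> ?d \<omega>}" by blast
    qed measurable
    also have "\<dots> \<le> prob {\<omega> \<in> space M. r < norm (block 1 n 0 \<omega>)} + prob {\<omega> \<in> space M. 1 \<le> ?d \<omega>}"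
      by (rule measure_Un_le) measurable
    also have "prob {\<omega> \<in> space M. 1 \<le> ?d \<omega>} \<le> (\<integral>\<omega>. ?d \<omega> \<partial>M) / 1"
      by (rule integral_Markov_inequality_measure[of _ _ "{}"]) (use marginal_near_block(1) elim in auto)
    also have "(\<integral>\<omega>. ?d \<omega> \<partial>M) / 1 \<le> A * sqrt (1 / real n)"
      using marginal_near_block(2)[of n] elim by (simp add: A_def)
    finally show ?case using elim by (auto dest: spec[of _ 0])
  qed
  then show ?thesis by blast
qed

text \<open>
  Convergence at a single time does not refer to a limit process, only to a law with the right
  cosine expectations.
\<close>

theorem marginal_expectation_tendsto:
  fixes f :: "'b \<Rightarrow> real"
  assumes N: "prob_space N" and sets: "sets N = sets borel"
    and Ncos: "\<And>\<theta> \<phi>. (\<integral>w. cos (\<phi> + \<theta> \<bullet> w) \<partial>N) = cos \<phi> * exp (- (q \<theta> / 2))"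
    and f: "continuous_on UNIV f" "\<And>w. \<bar>f w\<bar> \<le> C"
  shows "(\<lambda>n. \<integral>\<omega>. f (marginal n \<omega>) \<partial>M) \<longlonglongrightarrow> (\<integral>w. f w \<partial>N)"
proof -
  define V where "V n i \<omega> = (if i < (1::nat) then marginal n \<omega> else 0)" for n i \<omega>
  define U where "U i w = (if i < (1::nat) then w else 0)" for i and w :: 'b
  define G where "G y = f (y 0)" for y :: "nat \<Rightarrow> 'b"
  have [measurable_cong]: "sets N = sets borel" by fact
  have "(\<lambda>n. \<integral>\<omega>. G (\<lambda>i. V n i \<omega>) \<partial>M) \<longlonglongrightarrow> (\<integral>w. G (\<lambda>i. U i w) \<partial>N)"
  proof (rule expectation_continuous_tendsto[OF N, where k = 1 and V = V and U = U and G = G and C = C])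
    show "V n i \<in> borel_measurable M" for n i by (cases "i < 1") (simp_all add: V_def[abs_def])
    show "U i \<in> borel_measurable N" for i by (cases "i < 1") (simp_all add: U_def[abs_def])
    show "(\<lambda>n. \<integral>\<omega>. cos (\<phi> + (\<Sum>i<1. \<theta> i \<bullet> V n i \<omega>)) \<partial>M) \<longlonglongrightarrow> (\<integral>w. cos (\<phi> + (\<Sum>i<1. \<theta> i \<bullet> U i w)) \<partial>N)" for \<theta> \<phi>
      using marginal_cos_tendsto[of \<phi> "\<theta> 0"] by (simp add: V_def U_def Ncos)
    show "\<exists>r. \<forall>\<^sub>F n in sequentially. \<forall>i<1. prob {\<omega> \<in> space M. r < norm (V n i \<omega>)} \<le> e" if "0 < e" for e
      using marginal_tight[OF that] by (simp add: V_def)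
    show "continuous_on UNIV G" unfolding G_def
      by (rule continuous_on_compose2[OF f(1) continuous_on_product_coordinates]) auto
    show "\<bar>G y\<bar> \<le> C" for y unfolding G_def by (rule f(2))
  qed (simp_all add: V_def U_def)
  then show ?thesis by (simp add: G_def V_def U_def)
qed

end

end

section \<open>One step of the biased random walk\<close>

lemma norm1_add_axis: "norm1 (v + axis i s) = norm1 v + (\<bar>v $ i + s\<bar> - \<bar>v $ i\<bar>)"
  for v :: "int ^ 'd"
proof -
  have 1: "norm1 (v + axis i s) = \<bar>v $ i + s\<bar> + (\<Sum>j\<in>UNIV - {i}. \<bar>v $ j\<bar>)"
  proof -
    have "norm1 (v + axis i s) = \<bar>(v + axis i s) $ i\<bar> + (\<Sum>j\<in>UNIV - {i}. \<bar>(v + axis i s) $ j\<bar>)"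
      unfolding norm1_def by (rule sum.remove) auto
    also have "(\<Sum>j\<in>UNIV - {i}. \<bar>(v + axis i s) $ j\<bar>) = (\<Sum>j\<in>UNIV - {i}. \<bar>v $ j\<bar>)"
      by (intro sum.cong) (auto simp: axis_def)
    finally show ?thesis by (simp add: axis_def)
  qed
  have 2: "norm1 v = \<bar>v $ i\<bar> + (\<Sum>j\<in>UNIV - {i}. \<bar>v $ j\<bar>)"
    unfolding norm1_def by (rule sum.remove) auto
  show ?thesis unfolding 1 2 by simp
qed

text \<open>
  For integer vectors, norm one leaves room for a single nonzero entry, which must be a sign.
\<close>

lemma norm1_eq_1_iff: "norm1 w = 1 \<longleftrightarrow> (\<exists>i. \<exists>s\<in>{1, -1}. w = axis i s)"
  for w :: "int ^ 'd"
proof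
  assume w: "norm1 w = 1"
  have "\<exists>i. w $ i \<noteq> 0"
  proof (rule ccontr)
    assume "\<not> (\<exists>i. w $ i \<noteq> 0)"
    then have "norm1 w = 0" by (simp add: norm1_def)
    with w show False by simp
  qed
  then obtain i where i: "w $ i \<noteq> 0" by blast
  have split: "norm1 w = \<bar>w $ i\<bar> + (\<Sum>j\<in>UNIV - {i}. \<bar>w $ j\<bar>)"
    unfolding norm1_def by (rule sum.remove) auto
  have nn: "0 \<le> (\<Sum>j\<in>UNIV - {i}. \<bar>w $ j\<bar>)" by (intro sum_nonneg) auto
  have "1 \<le> \<bar>w $ i\<bar>" using i by linarith
  with nn w split have one: "\<bar>w $ i\<bar> = 1" and z: "(\<Sum>j\<in>UNIV - {i}. \<bar>w $ j\<bar>) = 0" by linarith+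
  from z have "\<forall>j\<in>UNIV - {i}. \<bar>w $ j\<bar> = 0" by (subst (asm) sum_nonneg_eq_0_iff) auto
  then have "w = axis i (w $ i)" by (auto simp: vec_eq_iff axis_def)
  moreover have "w $ i \<in> {1, -1}" using one by auto
  ultimately show "\<exists>i. \<exists>s\<in>{1, -1}. w = axis i s" by blast
next
  assume "\<exists>i. \<exists>s\<in>{1, -1}. w = axis i s"
  then obtain i s where "s \<in> {1, -1}" "w = axis i s" by blast
  then show "norm1 w = 1"
    using norm1_add_axis[of 0 i s] by (auto simp: norm1_def)
qed

lemma neighbours_eq: "neighbours v = (\<lambda>(i, s). v + axis i s) ` (UNIV \<times> {1, -1})"
proof (intro equalityI subsetI)
  fix u assume "u \<in> neighbours v"
  then have "norm1 (u - v) = 1" by (simp add: neighbours_def)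
  then obtain i s where "s \<in> {1, -1}" "u - v = axis i s" unfolding norm1_eq_1_iff by blast
  then show "u \<in> (\<lambda>(i, s). v + axis i s) ` (UNIV \<times> {1, -1})"
    by (intro image_eqI[of _ _ "(i, s)"]) (auto simp: algebra_simps)
next
  fix u assume "u \<in> (\<lambda>(i, s). v + axis i s) ` (UNIV \<times> {1, -1})"
  then obtain i s where "s \<in> {1, -1}" "u = v + axis i s" by auto
  then show "u \<in> neighbours v" unfolding neighbours_def mem_Collect_eq norm1_eq_1_iff by auto
qed

lemma finite_neighbours [simp]: "finite (neighbours v)"
  unfolding neighbours_eq by simp

lemma inj_on_unit_steps: "inj_on (\<lambda>(i, s). v + axis i s) (UNIV \<times> {1, -1 :: int})"
  for v :: "int ^ 'd"
  by (auto simp: inj_on_def axis_eq_axis)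

lemma sum_neighbours: "(\<Sum>u\<in>neighbours v. f u) = (\<Sum>i\<in>UNIV. f (v + axis i 1) + f (v + axis i (-1)))"
  for v :: "int ^ 'd" and f :: "int ^ 'd \<Rightarrow> 'b::comm_monoid_add"
proof -
  have "(\<Sum>u\<in>neighbours v. f u) = (\<Sum>(i, s)\<in>UNIV \<times> {1, -1}. f (v + axis i s))"
    unfolding neighbours_eq by (subst sum.reindex[OF inj_on_unit_steps]) (simp add: o_def case_prod_unfold)
  also have "\<dots> = (\<Sum>i\<in>UNIV. \<Sum>s\<in>{1, -1}. f (v + axis i s))"
    by (rule sum.cartesian_product[symmetric])
  finally show ?thesis by simp
qed

text \<open>
  Exactly one neighbour in each nonzero direction is closer to the origin.
\<close>

lemma deg_minus_eq: "deg_minus v = card {i. v $ i \<noteq> 0}"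
  for v :: "int ^ 'd"
proof -
  have "{u \<in> neighbours v. norm1 u = norm1 v - 1} = (\<lambda>i. v + axis i (- sgn (v $ i))) ` {i. v $ i \<noteq> 0}"
  proof (intro equalityI subsetI)
    fix u assume "u \<in> {u \<in> neighbours v. norm1 u = norm1 v - 1}"
    then have "u \<in> neighbours v" and n: "norm1 u = norm1 v - 1" by auto
    then obtain i s where s: "s \<in> {1, -1}" and u: "u = v + axis i s"
      unfolding neighbours_eq by auto
    have "\<bar>v $ i + s\<bar> - \<bar>v $ i\<bar> = - 1" using n unfolding u norm1_add_axis by linarith
    with s have "v $ i \<noteq> 0" "s = - sgn (v $ i)" by (auto simp: sgn_if split: if_splits)
    with u show "u \<in> (\<lambda>i. v + axis i (- sgn (v $ i))) ` {i. v $ i \<noteq> 0}" by blast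
  next
    fix u assume "u \<in> (\<lambda>i. v + axis i (- sgn (v $ i))) ` {i. v $ i \<noteq> 0}"
    then obtain i where i: "v $ i \<noteq> 0" and u: "u = v + axis i (- sgn (v $ i))" by blast
    have "- sgn (v $ i) \<in> {1, -1}" using i by (auto simp: sgn_if)
    then have "u \<in> neighbours v" unfolding neighbours_eq u by force
    moreover have "norm1 u = norm1 v - 1" unfolding u norm1_add_axis using i by (auto simp: sgn_if)
    ultimately show "u \<in> {u \<in> neighbours v. norm1 u = norm1 v - 1}" by simp
  qed
  moreover have "inj_on (\<lambda>i. v + axis i (- sgn (v $ i))) {i. v $ i \<noteq> 0}"
    by (auto simp: inj_on_def axis_eq_axis sgn_eq_0_iff)
  ultimately show ?thesis unfolding deg_minus_def by (simp add: card_image)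
qed

text \<open>
  The common denominator of the transition probabilities. At the origin it equals \<open>2 d\<close>, so the
  separate rule for the origin needs no case distinction.
\<close>

definition total_rate :: "real \<Rightarrow> int ^ 'd \<Rightarrow> real" where
  "total_rate lam v = 2 * real CARD('d) + (lam - 1) * real (card {i. v $ i \<noteq> 0})"

lemma total_rate_sum: "total_rate lam v = (\<Sum>i\<in>UNIV. if v $ i = 0 then 2 else 1 + lam)"
  for v :: "int ^ 'd"
proof -
  have "(\<Sum>i\<in>UNIV. if v $ i = 0 then 2 else 1 + lam) = (\<Sum>i\<in>UNIV. 2 + (if v $ i \<noteq> 0 then lam - 1 else 0))"
    by (intro sum.cong) auto
  also have "\<dots> = 2 * real CARD('d) + (\<Sum>i\<in>{i. v $ i \<noteq> 0}. lam - 1)"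
    by (simp add: sum.distrib sum.If_cases)
  finally show ?thesis by (simp add: total_rate_def mult.commute)
qed

lemma total_rate_bounds:
  fixes v :: "int ^ 'd"
  assumes "0 \<le> lam" "lam < 1"
  shows "0 < total_rate lam v" "total_rate lam v \<le> 2 * real CARD('d)"
proof -
  have "(\<Sum>i\<in>(UNIV :: 'd set). 1) \<le> total_rate lam v"
    unfolding total_rate_sum using assms by (intro sum_mono) auto
  then have "real CARD('d) \<le> total_rate lam v" by simp
  moreover have "0 < real CARD('d)" by simp
  ultimately show "0 < total_rate lam v" by linarith
  have "total_rate lam v \<le> (\<Sum>i\<in>(UNIV :: 'd set). 2)"
    unfolding total_rate_sum using assms by (intro sum_mono) auto
  then show "total_rate lam v \<le> 2 * real CARD('d)" by simp
qed

lemma rw_prob_step: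
  fixes v :: "int ^ 'd"
  assumes s: "s \<in> {1, -1}"
  shows "rw_prob lam v (v + axis i s) = (if \<bar>v $ i + s\<bar> < \<bar>v $ i\<bar> then lam else 1) / total_rate lam v"
proof -
  have nb: "v + axis i s \<in> neighbours v" unfolding neighbours_eq using s by force
  have "\<bar>v $ i + s\<bar> < \<bar>v $ i\<bar> \<longleftrightarrow> \<bar>v $ i + s\<bar> - \<bar>v $ i\<bar> = - 1" using s by auto
  then have "norm1 (v + axis i s) = norm1 v - 1 \<longleftrightarrow> \<bar>v $ i + s\<bar> < \<bar>v $ i\<bar>" by (simp add: norm1_add_axis)
  then show ?thesis using nb by (auto simp: rw_prob_def total_rate_def deg_minus_eq)
qed

lemma abs_vec_add_axis: "abs_vec (v + axis i s) = abs_vec v + axis i (real_of_int (\<bar>v $ i + s\<bar> - \<bar>v $ i\<bar>))"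
  by (auto simp: abs_vec_def vec_eq_iff axis_def)

text \<open>
  In a direction where the coordinate vanishes both moves increase the absolute value; in the other
  directions the decreasing move carries the weight \<open>lam\<close>.
\<close>

lemma expected_step:
  fixes v :: "int ^ 'd" and h :: "real ^ 'd \<Rightarrow> real"
  shows "(\<Sum>u\<in>neighbours v. rw_prob lam v u * h (abs_vec u - abs_vec v)) =
    (\<Sum>i\<in>UNIV. (if v $ i = 0 then 2 * h (axis i 1) else h (axis i 1) + lam * h (axis i (-1))) / total_rate lam v)"
  unfolding sum_neighbours
proof (intro sum.cong refl)
  fix i :: 'd
  have step: "rw_prob lam v (v + axis i s) * h (abs_vec (v + axis i s) - abs_vec v)
     = (if \<bar>v $ i + s\<bar> < \<bar>v $ i\<bar> then lam else 1) * h (axis i (real_of_int (\<bar>v $ i + s\<bar> - \<bar>v $ i\<bar>))) / total_rate lam v"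
    if "s \<in> {1, -1}" for s
    using rw_prob_step[OF that, where lam = lam and v = v and i = i] by (simp add: abs_vec_add_axis)
  consider "v $ i = 0" | "0 < v $ i" | "v $ i < 0" by linarith
  then show "rw_prob lam v (v + axis i 1) * h (abs_vec (v + axis i 1) - abs_vec v) +
       rw_prob lam v (v + axis i (-1)) * h (abs_vec (v + axis i (-1)) - abs_vec v) =
       (if v $ i = 0 then 2 * h (axis i 1) else h (axis i 1) + lam * h (axis i (-1))) / total_rate lam v"
    by cases (simp_all add: step add_divide_distrib)
qed

lemma rw_prob_sum:
  fixes v :: "int ^ 'd"
  assumes "0 \<le> lam" "lam < 1"
  shows "(\<Sum>u\<in>neighbours v. rw_prob lam v u) = 1"
proof -
  have "(\<Sum>u\<in>neighbours v. rw_prob lam v u * 1) = (\<Sum>i\<in>UNIV. (if v $ i = 0 then 2 * 1 else 1 + lam * 1) / total_rate lam v)"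
    by (rule expected_step[where h = "\<lambda>_. 1"])
  also have "\<dots> = total_rate lam v / total_rate lam v"
    unfolding sum_divide_distrib[symmetric] by (simp only: mult_1_right total_rate_sum[symmetric])
  also have "\<dots> = 1" using total_rate_bounds(1)[OF assms, of v] by simp
  finally show ?thesis by simp
qed

lemma rw_prob_nonneg:
  fixes v :: "int ^ 'd"
  assumes "0 \<le> lam" "lam < 1" shows "0 \<le> rw_prob lam v u"
proof (cases "u \<in> neighbours v")
  case True
  then obtain i s where "s \<in> {1, -1}" "u = v + axis i s" unfolding neighbours_eq by auto
  then show ?thesis using rw_prob_step[of s lam v i] total_rate_bounds(1)[OF assms, of v] assms by simp
qed (simp add: rw_prob_def)

lemma norm_axis_eq: "norm (axis i x) = \<bar>x\<bar>"
  for x :: real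
proof -
  have "axis i x = x *\<^sub>R axis i 1" by (simp add: vec_eq_iff axis_def)
  then show ?thesis by (simp add: norm_axis_1)
qed

lemma norm_abs_vec_step:
  assumes "u \<in> neighbours v"
  shows "norm (abs_vec u - abs_vec v) \<le> 1"
proof -
  obtain i s where s: "s \<in> {1, -1}" and u: "u = v + axis i s"
    using assms unfolding neighbours_eq by auto
  have "abs_vec u - abs_vec v = axis i (real_of_int (\<bar>v $ i + s\<bar> - \<bar>v $ i\<bar>))"
    unfolding u abs_vec_add_axis by simp
  then have "norm (abs_vec u - abs_vec v) = \<bar>real_of_int (\<bar>v $ i + s\<bar> - \<bar>v $ i\<bar>)\<bar>"
    by (simp add: norm_axis_eq)
  also have "\<dots> \<le> 1" using s by auto
  finally show ?thesis .
qed

text \<open>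
  Only moves in direction \<open>i\<close> change the function. From \<open>\<bar>v\<^sub>i\<bar> = k + 1\<close> its expected change is
  proportional to \<open>(lam ^ (k + 2) - lam ^ (k + 1)) + lam * (lam ^ k - lam ^ (k + 1)) = 0\<close>, also for
  \<open>lam = 0\<close> with \<open>0 ^ 0 = 1\<close>; from \<open>v\<^sub>i = 0\<close> it drops by \<open>1 - lam\<close> with probability at least \<open>1 / d\<close>.
\<close>

lemma geometric_supermartingale:
  fixes v :: "int ^ 'd" and i :: 'd
  assumes lam: "0 \<le> lam" "lam < 1"
  shows "(\<Sum>u\<in>neighbours v. rw_prob lam v u * lam ^ nat \<bar>u $ i\<bar>)
     \<le> lam ^ nat \<bar>v $ i\<bar> - (if v $ i = 0 then (1 - lam) / real CARD('d) else 0)"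
proof -
  define h where "h u = lam ^ nat \<bar>u $ i\<bar> - lam ^ nat \<bar>v $ i\<bar>" for u :: "int ^ 'd"
  have "(\<Sum>u\<in>neighbours v. rw_prob lam v u * h u)
     = (\<Sum>l\<in>UNIV. rw_prob lam v (v + axis l 1) * h (v + axis l 1) + rw_prob lam v (v + axis l (-1)) * h (v + axis l (-1)))"
    by (rule sum_neighbours)
  also have "\<dots> = (\<Sum>l\<in>UNIV. if l = i then rw_prob lam v (v + axis i 1) * h (v + axis i 1) + rw_prob lam v (v + axis i (-1)) * h (v + axis i (-1)) else 0)"
    by (intro sum.cong) (auto simp: h_def axis_def)
  also have "\<dots> = rw_prob lam v (v + axis i 1) * h (v + axis i 1) + rw_prob lam v (v + axis i (-1)) * h (v + axis i (-1))"
    by simp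
  also have "\<dots> \<le> - (if v $ i = 0 then (1 - lam) / real CARD('d) else 0)"
  proof -
    have d: "0 < total_rate lam v" "total_rate lam v \<le> 2 * real CARD('d)" by (rule total_rate_bounds[OF lam])+
    have r: "rw_prob lam v (v + axis i 1) = (if \<bar>v $ i + 1\<bar> < \<bar>v $ i\<bar> then lam else 1) / total_rate lam v"
      "rw_prob lam v (v + axis i (-1)) = (if \<bar>v $ i + (-1)\<bar> < \<bar>v $ i\<bar> then lam else 1) / total_rate lam v"
      by (rule rw_prob_step, simp)+
    consider "v $ i = 0" | k where "v $ i = 1 + int k" | k where "v $ i = - 1 - int k"
    proof -
      assume a: "v $ i = 0 \<Longrightarrow> thesis" "\<And>k. v $ i = 1 + int k \<Longrightarrow> thesis" "\<And>k. v $ i = - 1 - int k \<Longrightarrow> thesis"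
      consider "v $ i = 0" | "0 < v $ i" | "v $ i < 0" by linarith
      then show thesis
      proof cases
        case 1 then show ?thesis by (rule a)
      next
        case 2 then show ?thesis by (intro a(2)[of "nat (v $ i - 1)"]) simp
      next
        case 3 then show ?thesis by (intro a(3)[of "nat (- v $ i - 1)"]) simp
      qed
    qed
    then show ?thesis
    proof cases
      case 1
      have "2 * (1 - lam) / (2 * real CARD('d)) \<le> 2 * (1 - lam) / total_rate lam v"
        using d lam by (intro divide_left_mono) (auto intro!: mult_pos_pos)
      moreover have "rw_prob lam v (v + axis i 1) * h (v + axis i 1) + rw_prob lam v (v + axis i (-1)) * h (v + axis i (-1)) = - (2 * (1 - lam) / total_rate lam v)"
        unfolding r using 1 d by (simp add: h_def axis_def field_simps)
      moreover have "2 * (1 - lam) / (2 * real CARD('d)) = (1 - lam) / real CARD('d)" by (rule mult_divide_mult_cancel_left) simp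
      ultimately show ?thesis using 1 by (simp only: if_True neg_le_iff_le refl)
    next
      case (2 k)
      have "nat (2 + int k) = Suc (Suc k)" "nat (1 + int k) = Suc k" by simp_all
      then have "rw_prob lam v (v + axis i 1) * h (v + axis i 1) + rw_prob lam v (v + axis i (-1)) * h (v + axis i (-1)) = 0"
        unfolding r using 2 d by (simp add: h_def axis_def field_simps)
      then show ?thesis using 2 by simp
    next
      case (3 k)
      have n: "nat \<bar>v $ i + 1\<bar> = k" "nat \<bar>v $ i - 1\<bar> = Suc (Suc k)" "nat \<bar>v $ i\<bar> = Suc k"
        using 3 by auto
      have h1: "h (v + axis i 1) = lam ^ k - lam ^ Suc k" and h2: "h (v + axis i (-1)) = lam ^ Suc (Suc k) - lam ^ Suc k"
        by (simp_all add: h_def axis_def n del: power_Suc)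
      have "\<bar>v $ i + 1\<bar> < \<bar>v $ i\<bar>" "\<not> \<bar>v $ i + (-1)\<bar> < \<bar>v $ i\<bar>" using 3 by auto
      then have "rw_prob lam v (v + axis i 1) * h (v + axis i 1) + rw_prob lam v (v + axis i (-1)) * h (v + axis i (-1)) = 0"
        unfolding r h1 h2 using d by (simp add: field_simps)
      then show ?thesis using 3 by simp
    qed
  qed
  finally have "(\<Sum>u\<in>neighbours v. rw_prob lam v u * h u) \<le> - (if v $ i = 0 then (1 - lam) / real CARD('d) else 0)" .
  moreover have "(\<Sum>u\<in>neighbours v. rw_prob lam v u * h u) = (\<Sum>u\<in>neighbours v. rw_prob lam v u * lam ^ nat \<bar>u $ i\<bar>) - lam ^ nat \<bar>v $ i\<bar>"
    by (simp add: h_def right_diff_distrib sum_subtractf rw_prob_sum[OF lam] flip: sum_distrib_right)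
  ultimately show ?thesis by simp
qed

definition mean_step :: "real \<Rightarrow> int ^ 'd \<Rightarrow> real ^ 'd" where
  "mean_step lam v = (\<Sum>u\<in>neighbours v. rw_prob lam v u *\<^sub>R (abs_vec u - abs_vec v))"

lemma norm_mean_step:
  assumes "0 \<le> lam" "lam < 1"
  shows "norm (mean_step lam v) \<le> 1"
proof -
  have "norm (mean_step lam v) \<le> (\<Sum>u\<in>neighbours v. rw_prob lam v u)"
    unfolding mean_step_def
  proof (rule sum_norm_le)
    fix u assume "u \<in> neighbours v"
    then show "norm (rw_prob lam v u *\<^sub>R (abs_vec u - abs_vec v)) \<le> rw_prob lam v u"
      using rw_prob_nonneg[OF assms, of v u] norm_abs_vec_step[of u v] by (simp add: mult_left_le)
  qed
  then show ?thesis by (simp add: rw_prob_sum[OF assms])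
qed

definition drift :: "real \<Rightarrow> real ^ 'd" where
  "drift lam = (\<chi> i. (1 - lam) / (real CARD('d) * (1 + lam)))"

text \<open>
  The quadratic form of the limiting covariance matrix \<open>\<Sigma>\<close>.
\<close>

definition asymptotic_variance :: "real \<Rightarrow> real ^ 'd \<Rightarrow> real" where
  "asymptotic_variance lam \<theta> = (\<theta> \<bullet> \<theta>) / real CARD('d) - (\<theta> \<bullet> drift lam)\<^sup>2"

lemma interior_rate:
  fixes v :: "int ^ 'd"
  assumes "\<And>i. v $ i \<noteq> 0"
  shows "total_rate lam v = real CARD('d) * (1 + lam)"
  unfolding total_rate_sum using assms by simp

lemma inner_drift: "\<theta> \<bullet> drift lam = (1 - lam) / (real CARD('d) * (1 + lam)) * (\<Sum>i\<in>UNIV. \<theta> $ i)"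
  for \<theta> :: "real ^ 'd"
  by (simp add: inner_vec_def drift_def sum_distrib_left sum_divide_distrib mult.commute)

lemma mean_step_interior:
  fixes v :: "int ^ 'd"
  assumes lam: "0 \<le> lam" and v: "\<And>i. v $ i \<noteq> 0"
  shows "mean_step lam v = drift lam"
proof -
  have "mean_step lam v \<bullet> \<theta> = drift lam \<bullet> \<theta>" for \<theta>
  proof -
    have "mean_step lam v \<bullet> \<theta> = (\<Sum>u\<in>neighbours v. rw_prob lam v u * ((abs_vec u - abs_vec v) \<bullet> \<theta>))"
      by (simp add: mean_step_def inner_sum_left)
    also have "\<dots> = (\<Sum>i\<in>UNIV. (axis i 1 \<bullet> \<theta> + lam * (axis i (-1) \<bullet> \<theta>)) / total_rate lam v)"
      by (subst expected_step[where h = "\<lambda>w. w \<bullet> \<theta>"]) (simp add: v)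
    also have "\<dots> = (\<Sum>i\<in>UNIV. (1 - lam) / (real CARD('d) * (1 + lam)) * \<theta> $ i)"
      by (intro sum.cong) (simp_all add: inner_axis' interior_rate[OF v] algebra_simps)
    also have "\<dots> = drift lam \<bullet> \<theta>"
      by (subst inner_commute) (simp add: inner_drift sum_distrib_left)
    finally show ?thesis .
  qed
  then show ?thesis by (metis vector_eq_rdot)
qed

text \<open>
  Off the hyperplanes the step of the absolute values has the uniform second moment \<open>I / d\<close>, and its mean is
  subtracted.
\<close>

lemma variance_interior:
  fixes v :: "int ^ 'd" and \<theta> :: "real ^ 'd"
  assumes lam: "0 \<le> lam" and v: "\<And>i. v $ i \<noteq> 0"
  shows "(\<Sum>u\<in>neighbours v. rw_prob lam v u * (\<theta> \<bullet> (abs_vec u - abs_vec v - mean_step lam v))\<^sup>2) = asymptotic_variance lam \<theta>"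
proof -
  define c where "c = real CARD('d) * (1 + lam)"
  define a where "a = \<theta> \<bullet> drift lam"
  have "0 < c" using lam by (simp add: c_def)
  have a: "(\<Sum>i\<in>UNIV. \<theta> $ i) * (1 - lam) = c * a"
    using lam by (simp add: a_def inner_drift c_def)
  have "(\<Sum>u\<in>neighbours v. rw_prob lam v u * (\<theta> \<bullet> (abs_vec u - abs_vec v - mean_step lam v))\<^sup>2)
     = (\<Sum>i\<in>UNIV. ((\<theta> $ i - a)\<^sup>2 + lam * (- \<theta> $ i - a)\<^sup>2) / c)"
    unfolding mean_step_interior[OF assms]
    by (subst expected_step[where h = "\<lambda>w. (\<theta> \<bullet> (w - drift lam))\<^sup>2"])
       (simp add: v inner_diff_right a_def[symmetric] inner_axis interior_rate[OF v] c_def)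
  also have "\<dots> = (\<Sum>i\<in>UNIV. (1 + lam) * (\<theta> $ i)\<^sup>2 - 2 * a * ((1 - lam) * \<theta> $ i) + (1 + lam) * a\<^sup>2) / c"
    unfolding sum_divide_distrib by (intro sum.cong refl) (simp add: power2_eq_square algebra_simps)
  also have "(\<Sum>i\<in>UNIV. (1 + lam) * (\<theta> $ i)\<^sup>2 - 2 * a * ((1 - lam) * \<theta> $ i) + (1 + lam) * a\<^sup>2)
     = (1 + lam) * (\<theta> \<bullet> \<theta>) - 2 * a * ((\<Sum>i\<in>UNIV. \<theta> $ i) * (1 - lam)) + c * a\<^sup>2"
    by (simp add: sum.distrib sum_subtractf inner_vec_def power2_eq_square c_def mult.commute flip: sum_distrib_left sum_distrib_right)
  also have "\<dots> = (1 + lam) * (\<theta> \<bullet> \<theta>) - c * a\<^sup>2"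
    unfolding a by (simp add: power2_eq_square)
  also have "\<dots> / c = (1 + lam) * (\<theta> \<bullet> \<theta>) / c - a\<^sup>2"
    using \<open>0 < c\<close> by (simp add: diff_divide_distrib)
  also have "(1 + lam) * (\<theta> \<bullet> \<theta>) / c = (\<theta> \<bullet> \<theta>) / real CARD('d)"
    using lam by (simp add: c_def)
  finally show ?thesis by (simp add: asymptotic_variance_def a_def)
qed

text \<open>
  It is the variance of a step from an interior vertex.
\<close>

lemma asymptotic_variance_nonneg:
  fixes \<theta> :: "real ^ 'd"
  assumes "0 \<le> lam" "lam < 1"
  shows "0 \<le> asymptotic_variance lam \<theta>"
proof -
  \<comment> \<open>Any vertex off the hyperplanes will do.\<close>
  define v :: "int ^ 'd" where "v = (\<chi> i. 1)"
  have "0 \<le> (\<Sum>u\<in>neighbours v. rw_prob lam v u * (\<theta> \<bullet> (abs_vec u - abs_vec v - mean_step lam v))\<^sup>2)"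
    using rw_prob_nonneg[OF assms] by (intro sum_nonneg mult_nonneg_nonneg) auto
  also have "\<dots> = asymptotic_variance lam \<theta>"
    by (rule variance_interior) (use assms in \<open>auto simp: v_def\<close>)
  finally show ?thesis .
qed

section \<open>The walk as a perturbed martingale\<close>

locale walk =
  fixes lam :: real and x :: "int ^ 'd" and M :: "'a measure" and X :: "nat \<Rightarrow> 'a \<Rightarrow> int ^ 'd"
  assumes lam: "0 \<le> lam" "lam < 1" and walk: "biased_random_walk lam x M X"

sublocale walk \<subseteq> prob_space M
  using walk by (simp add: biased_random_walk_def)

context walk
begin

lemma X_measurable [measurable]: "X n \<in> measurable M (count_space UNIV)"
  using walk by (simp add: biased_random_walk_def)

lemma X_start: "AE \<omega> in M. X 0 \<omega> = x"
  using walk by (simp add: biased_random_walk_def)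

text \<open>
  The list of positions up to time \<open>j\<close>. The Markov property in the definition of the walk is stated in terms of
  such finite histories, and there are only countably many of them.
\<close>

definition hist :: "nat \<Rightarrow> 'a \<Rightarrow> (int ^ 'd) list" where
  "hist j \<omega> = map (\<lambda>i. X i \<omega>) [0..<Suc j]"

lemma length_hist [simp]: "length (hist j \<omega>) = Suc j"
  by (simp add: hist_def)

lemma last_hist [simp]: "last (hist j \<omega>) = X j \<omega>"
  by (simp add: hist_def)

lemma hist_Suc: "hist (Suc j) \<omega> = hist j \<omega> @ [X (Suc j) \<omega>]"
  by (simp add: hist_def)

lemma hist_eq_iff: "length p = Suc j \<Longrightarrow> hist j \<omega> = p \<longleftrightarrow> (\<forall>i\<le>j. X i \<omega> = p ! i)"
  by (auto simp: hist_def list_eq_iff_nth_eq nth_append less_Suc_eq_le all_conj_distrib simp del: upt_Suc)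

lemma hist_measurable [measurable]: "hist j \<in> measurable M (count_space UNIV)"
proof (subst measurable_count_space_eq_countable, simp, intro conjI ballI)
  fix p :: "(int ^ 'd) list"
  show "hist j -` {p} \<inter> space M \<in> sets M"
  proof (cases "length p = Suc j")
    case True
    have "hist j -` {p} \<inter> space M = {\<omega> \<in> space M. hist j \<omega> = p}" by auto
    also have "\<dots> = {\<omega> \<in> space M. \<forall>i\<in>{..j}. X i \<omega> = p ! i}"
      using True by (simp add: hist_eq_iff Ball_def)
    also have "\<dots> \<in> sets M" by measurable
    finally show ?thesis .
  next
    case False
    then have "hist j -` {p} \<inter> space M = {}" using length_hist by auto
    then show ?thesis by (simp only: sets.empty_sets)
  qed
qed auto

definition weight :: "nat \<Rightarrow> (int ^ 'd) list \<Rightarrow> real" where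
  "weight j p = prob {\<omega> \<in> space M. hist j \<omega> = p}"

lemma weight_snoc:
  assumes "length p = Suc j"
  shows "weight (Suc j) (p @ [u]) = weight j p * rw_prob lam (last p) u"
proof -
  have 1: "weight j p = \<P>(\<omega> in M. \<forall>i\<le>j. X i \<omega> = p ! i)"
    using assms by (simp add: weight_def hist_eq_iff)
  have 2: "weight (Suc j) (p @ [u]) = \<P>(\<omega> in M. X (Suc j) \<omega> = u \<and> (\<forall>i\<le>j. X i \<omega> = p ! i))"
    using assms by (auto simp: weight_def hist_Suc hist_eq_iff conj_commute intro!: arg_cong[where f = prob])
  have last: "p ! j = last p" using assms by (simp add: last_conv_nth flip: length_0_conv)
  show ?thesis
  proof (cases "weight j p = 0")
    case True
    have "weight (Suc j) (p @ [u]) \<le> weight j p"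
      unfolding weight_def hist_Suc by (rule finite_measure_mono) auto
    moreover have "0 \<le> weight (Suc j) (p @ [u])" by (simp add: weight_def)
    ultimately show ?thesis using True by simp
  next
    case False
    have "\<P>(\<omega> in M. X (Suc j) \<omega> = u \<bar> \<forall>i\<le>j. X i \<omega> = p ! i) = rw_prob lam (p ! j) u"
      using walk False unfolding 1 biased_random_walk_def by blast
    then show ?thesis using False unfolding cond_prob_def 1 2 last by (simp add: field_simps)
  qed
qed

text \<open>
  The histories that are possible for the walk: finitely many for each \<open>j\<close>.
\<close>

primrec paths :: "nat \<Rightarrow> (int ^ 'd) list set" where
  "paths 0 = {[x]}"
| "paths (Suc j) = (\<lambda>(p, u). p @ [u]) ` (SIGMA p:paths j. neighbours (last p))"

lemma finite_paths [simp]: "finite (paths j)"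
  by (induction j) auto

lemma length_paths: "p \<in> paths j \<Longrightarrow> length p = Suc j"
  by (induction j arbitrary: p) auto

lemma sum_paths_Suc: "(\<Sum>p\<in>paths (Suc j). f p) = (\<Sum>p\<in>paths j. \<Sum>u\<in>neighbours (last p). f (p @ [u]))"
proof -
  have "(\<Sum>p\<in>paths (Suc j). f p) = (\<Sum>(p, u)\<in>(SIGMA p:paths j. neighbours (last p)). f (p @ [u]))"
    by (simp add: sum.reindex inj_on_def case_prod_unfold)
  also have "\<dots> = (\<Sum>p\<in>paths j. \<Sum>u\<in>neighbours (last p). f (p @ [u]))"
    by (rule sum.Sigma[symmetric]) auto
  finally show ?thesis .
qed

text \<open>
  The transition probabilities to the neighbours sum to one, so almost surely the walk never leaves the
  possible histories.
\<close>

lemma sum_weight_paths: "(\<Sum>p\<in>paths j. weight j p) = 1"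
proof (induction j)
  case 0
  have "prob {\<omega> \<in> space M. hist 0 \<omega> = [x]} = 1"
    using X_start by (intro prob_eq_1[THEN iffD2]) (auto simp: hist_def)
  then show ?case by (simp add: weight_def)
next
  case (Suc j)
  have "(\<Sum>p\<in>paths (Suc j). weight (Suc j) p) = (\<Sum>p\<in>paths j. \<Sum>u\<in>neighbours (last p). weight j p * rw_prob lam (last p) u)"
    unfolding sum_paths_Suc by (intro sum.cong refl weight_snoc length_paths)
  also have "\<dots> = (\<Sum>p\<in>paths j. weight j p)"
    by (simp add: rw_prob_sum[OF lam] flip: sum_distrib_left)
  finally show ?case using Suc by simp
qed

lemma AE_paths: "AE \<omega> in M. hist j \<omega> \<in> paths j"
proof -
  have "prob {\<omega> \<in> space M. hist j \<omega> \<in> paths j} = prob (\<Union>p\<in>paths j. {\<omega> \<in> space M. hist j \<omega> = p})"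
    by (intro arg_cong[where f = prob]) auto
  also have "\<dots> = (\<Sum>p\<in>paths j. weight j p)"
    unfolding weight_def by (rule finite_measure_finite_Union) (auto simp: disjoint_family_on_def)
  also have "\<dots> = 1" by (rule sum_weight_paths)
  finally have "prob {\<omega> \<in> space M. hist j \<omega> \<in> paths j} = 1" .
  from prob_eq_1[THEN iffD1, OF _ this] show ?thesis by simp
qed

lemma expectation_hist: "(\<integral>\<omega>. f (hist j \<omega>) \<partial>M) = (\<Sum>p\<in>paths j. weight j p * f p)"
  for f :: "(int ^ 'd) list \<Rightarrow> real"
proof -
  have "(\<integral>\<omega>. f (hist j \<omega>) \<partial>M) = (\<integral>\<omega>. (\<Sum>p\<in>paths j. f p * indicator {\<omega> \<in> space M. hist j \<omega> = p} \<omega>) \<partial>M)"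
  proof (rule integral_cong_AE)
    show "(\<lambda>\<omega>. f (hist j \<omega>)) \<in> borel_measurable M" by measurable
    show "AE \<omega> in M. f (hist j \<omega>) = (\<Sum>p\<in>paths j. f p * indicator {\<omega> \<in> space M. hist j \<omega> = p} \<omega>)"
      using AE_paths[of j] AE_space
    proof eventually_elim
      case (elim \<omega>)
      have "(\<Sum>p\<in>paths j. f p * indicator {\<omega> \<in> space M. hist j \<omega> = p} \<omega>) = (\<Sum>p\<in>paths j. if p = hist j \<omega> then f p else 0)"
        using elim by (intro sum.cong) (auto simp: indicator_def)
      then show ?case using elim by simp
    qed
  qed measurable
  also have "\<dots> = (\<Sum>p\<in>paths j. f p * weight j p)"
    by (subst Bochner_Integration.integral_sum) (auto simp: weight_def less_top[symmetric])
  finally show ?thesis by (simp add: mult.commute)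
qed

text \<open>
  The Markov property for functions of the history and the next position. All expectations are finite
  sums over possible histories.
\<close>

lemma expectation_step:
  fixes K :: "(int ^ 'd) list \<Rightarrow> int ^ 'd \<Rightarrow> real"
  shows "(\<integral>\<omega>. K (hist j \<omega>) (X (Suc j) \<omega>) \<partial>M) = (\<integral>\<omega>. (\<Sum>u\<in>neighbours (X j \<omega>). rw_prob lam (X j \<omega>) u * K (hist j \<omega>) u) \<partial>M)"
proof -
  have "(\<integral>\<omega>. K (hist j \<omega>) (X (Suc j) \<omega>) \<partial>M) = (\<integral>\<omega>. (\<lambda>p. K (butlast p) (last p)) (hist (Suc j) \<omega>) \<partial>M)"
    by (simp add: hist_Suc)
  also have "\<dots> = (\<Sum>p\<in>paths j. \<Sum>u\<in>neighbours (last p). weight j p * rw_prob lam (last p) u * K p u)"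
    unfolding expectation_hist[where f = "\<lambda>p. K (butlast p) (last p)"] sum_paths_Suc by (intro sum.cong refl) (simp add: weight_snoc[OF length_paths])
  also have "\<dots> = (\<Sum>p\<in>paths j. weight j p * (\<Sum>u\<in>neighbours (last p). rw_prob lam (last p) u * K p u))"
    by (simp add: sum_distrib_left mult.assoc)
  also have "\<dots> = (\<integral>\<omega>. (\<lambda>p. \<Sum>u\<in>neighbours (last p). rw_prob lam (last p) u * K p u) (hist j \<omega>) \<partial>M)"
    by (rule expectation_hist[symmetric])
  finally show ?thesis by simp
qed

lemma AE_neighbour: "AE \<omega> in M. \<forall>j. X (Suc j) \<omega> \<in> neighbours (X j \<omega>)"
proof (subst AE_all_countable, rule)
  fix j
  show "AE \<omega> in M. X (Suc j) \<omega> \<in> neighbours (X j \<omega>)"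
    using AE_paths[of "Suc j"]
  proof eventually_elim
    case (elim \<omega>)
    then obtain p u where p: "hist j \<omega> = p" "X (Suc j) \<omega> = u" "u \<in> neighbours (last p)"
      by (auto simp: hist_Suc)
    then show ?case using last_hist[of j \<omega>] by simp
  qed
qed

definition filt :: "nat \<Rightarrow> 'a measure" where
  "filt j = vimage_algebra (space M) (hist j) (count_space UNIV)"

lemma space_filt [simp]: "space (filt j) = space M"
  by (simp add: filt_def)

lemma sets_filt: "sets (filt j) = {hist j -` A \<inter> space M | A. True}"
  unfolding filt_def by (subst sets_vimage_algebra2) auto

lemma filt_subalgebra: "subalgebra M (filt j)"
  unfolding subalgebra_def sets_filt using measurable_sets[OF hist_measurable[of j]] by auto

lemma filt_mono: "subalgebra (filt (Suc j)) (filt j)"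
proof -
  have "hist j -` A \<inter> space M = hist (Suc j) -` (butlast -` A) \<inter> space M" for A
    by (auto simp: hist_Suc)
  then show ?thesis unfolding subalgebra_def sets_filt by auto
qed

lemma hist_filt_measurable: "hist j \<in> measurable (filt j) (count_space UNIV)"
  unfolding filt_def by (rule measurable_vimage_algebra1) auto

text \<open>
  All preimages under the history are measurable and there are no other measurable sets, so a measurable
  function takes a single value wherever the history is fixed.
\<close>

lemma filt_factor:
  fixes g :: "'a \<Rightarrow> 'c::euclidean_space"
  assumes g: "g \<in> borel_measurable (filt j)"
  obtains G where "\<And>\<omega>. \<omega> \<in> space M \<Longrightarrow> g \<omega> = G (hist j \<omega>)"
proof
  fix \<omega> assume \<omega>: "\<omega> \<in> space M"
  define \<omega>' where "\<omega>' = (SOME \<omega>'. \<omega>' \<in> space M \<and> hist j \<omega>' = hist j \<omega>)"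
  have \<omega>': "\<omega>' \<in> space M" "hist j \<omega>' = hist j \<omega>"
    using someI[of "\<lambda>\<omega>'. \<omega>' \<in> space M \<and> hist j \<omega>' = hist j \<omega>" \<omega>] \<omega> unfolding \<omega>'_def by auto
  have "g -` {g \<omega>} \<inter> space M \<in> sets (filt j)"
    using measurable_sets[OF g, of "{g \<omega>}"] by simp
  then obtain A where A: "g -` {g \<omega>} \<inter> space M = hist j -` A \<inter> space M" unfolding sets_filt by blast
  then have "hist j \<omega> \<in> A" using \<omega> by blast
  then have "\<omega>' \<in> g -` {g \<omega>} \<inter> space M" unfolding A using \<omega>' by auto
  then show "g \<omega> = (\<lambda>p. g (SOME \<omega>'. \<omega>' \<in> space M \<and> hist j \<omega>' = p)) (hist j \<omega>)"
    by (simp add: \<omega>'_def)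
qed

text \<open>
  The centred step of the absolute values. It is set to zero on the null event that the walk jumps to a
  vertex that is not a neighbour, so that the bound on the increments holds everywhere.
\<close>

definition noise :: "nat \<Rightarrow> 'a \<Rightarrow> real ^ 'd" where
  "noise j \<omega> = (if X (Suc j) \<omega> \<in> neighbours (X j \<omega>)
     then abs_vec (X (Suc j) \<omega>) - abs_vec (X j \<omega>) - mean_step lam (X j \<omega>) else 0)"

text \<open>
  The event that the walk is on a coordinate hyperplane; these are the bad events of the martingale.
\<close>

definition boundary :: "nat \<Rightarrow> 'a set" where
  "boundary j = {\<omega> \<in> space M. \<exists>i. X j \<omega> $ i = 0}"

lemma filt_hist_borel: "(\<lambda>\<omega>. f (hist j \<omega>)) \<in> borel_measurable (filt j)"
  by (rule measurable_compose[OF hist_filt_measurable]) simp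

lemma boundary_filt: "boundary j \<in> sets (filt j)"
proof -
  have "boundary j = hist j -` {p. \<exists>i. last p $ i = 0} \<inter> space M" by (auto simp: boundary_def)
  then show ?thesis unfolding sets_filt by blast
qed

text \<open>
  The expectation of \<open>lam ^ \<bar>X\<^sub>j\<^sup>i\<bar>\<close> stays between \<open>0\<close> and \<open>1\<close> and drops by at least \<open>(1 - lam) / d\<close> times
  the probability of being at zero in each step.
\<close>

lemma coordinate_zero_sum:
  "(\<Sum>j<n. prob {\<omega> \<in> space M. X j \<omega> $ i = 0}) \<le> real CARD('d) / (1 - lam)"
proof -
  define c where "c = (1 - lam) / real CARD('d)"
  have "0 < c" using lam by (simp add: c_def)
  define e where "e j = (\<integral>\<omega>. lam ^ nat \<bar>X j \<omega> $ i\<bar> \<partial>M)" for j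
  have pow: "0 \<le> lam ^ k" "lam ^ k \<le> 1" for k using lam by (auto intro: power_le_one)
  have int: "integrable M (\<lambda>\<omega>. lam ^ nat \<bar>X j \<omega> $ i\<bar>)" for j
    by (rule integrable_const_bound[of _ 1]) (use pow in auto)
  have e: "0 \<le> e j" "e j \<le> 1" for j
  proof -
    show "0 \<le> e j" unfolding e_def using pow by (intro integral_nonneg_AE) auto
    have "e j \<le> (\<integral>\<omega>. 1 \<partial>M)" unfolding e_def using pow int by (intro integral_mono) auto
    then show "e j \<le> 1" by (simp add: prob_space)
  qed
  have step: "e (Suc j) \<le> e j - c * prob {\<omega> \<in> space M. X j \<omega> $ i = 0}" for j
  proof -
    have ind: "(\<integral>\<omega>. lam ^ nat \<bar>X j \<omega> $ i\<bar> - c * indicator {\<omega> \<in> space M. X j \<omega> $ i = 0} \<omega> \<partial>M) = e j - c * prob {\<omega> \<in> space M. X j \<omega> $ i = 0}"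
      using int by (subst Bochner_Integration.integral_diff) (auto simp: e_def less_top[symmetric])
    have "e (Suc j) = (\<integral>\<omega>. (\<Sum>u\<in>neighbours (X j \<omega>). rw_prob lam (X j \<omega>) u * lam ^ nat \<bar>u $ i\<bar>) \<partial>M)"
      unfolding e_def by (rule expectation_step[of "\<lambda>_ u. lam ^ nat \<bar>u $ i\<bar>"])
    also have "\<dots> \<le> (\<integral>\<omega>. lam ^ nat \<bar>X j \<omega> $ i\<bar> - c * indicator {\<omega> \<in> space M. X j \<omega> $ i = 0} \<omega> \<partial>M)"
    proof (rule integral_mono)
      have s: "0 \<le> (\<Sum>u\<in>neighbours w. rw_prob lam w u * lam ^ nat \<bar>u $ i\<bar>)" for w :: "int ^ 'd"
        using rw_prob_nonneg[OF lam] pow by (intro sum_nonneg mult_nonneg_nonneg) auto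
      show "integrable M (\<lambda>\<omega>. \<Sum>u\<in>neighbours (X j \<omega>). rw_prob lam (X j \<omega>) u * lam ^ nat \<bar>u $ i\<bar>)"
      proof (rule integrable_const_bound[of _ 1])
        show "AE \<omega> in M. norm (\<Sum>u\<in>neighbours (X j \<omega>). rw_prob lam (X j \<omega>) u * lam ^ nat \<bar>u $ i\<bar>) \<le> 1"
        proof (rule AE_I2)
          fix \<omega>
          have "(\<Sum>u\<in>neighbours (X j \<omega>). rw_prob lam (X j \<omega>) u * lam ^ nat \<bar>u $ i\<bar>) \<le> (\<Sum>u\<in>neighbours (X j \<omega>). rw_prob lam (X j \<omega>) u)"
            using rw_prob_nonneg[OF lam] pow by (intro sum_mono mult_left_le) auto
          then show "norm (\<Sum>u\<in>neighbours (X j \<omega>). rw_prob lam (X j \<omega>) u * lam ^ nat \<bar>u $ i\<bar>) \<le> 1"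
            using s[of "X j \<omega>"] by (simp add: rw_prob_sum[OF lam])
        qed
        show "(\<lambda>\<omega>. \<Sum>u\<in>neighbours (X j \<omega>). rw_prob lam (X j \<omega>) u * lam ^ nat \<bar>u $ i\<bar>) \<in> borel_measurable M"
          by (rule measurable_compose[OF X_measurable]) simp
      qed
      show "integrable M (\<lambda>\<omega>. lam ^ nat \<bar>X j \<omega> $ i\<bar> - c * indicator {\<omega> \<in> space M. X j \<omega> $ i = 0} \<omega>)"
        using int by (intro Bochner_Integration.integrable_diff integrable_mult_right integrable_real_indicator) (auto simp: less_top[symmetric])
      show "(\<Sum>u\<in>neighbours (X j \<omega>). rw_prob lam (X j \<omega>) u * lam ^ nat \<bar>u $ i\<bar>) \<le> lam ^ nat \<bar>X j \<omega> $ i\<bar> - c * indicator {\<omega> \<in> space M. X j \<omega> $ i = 0} \<omega>"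
        if "\<omega> \<in> space M" for \<omega>
        using geometric_supermartingale[OF lam, of "X j \<omega>" i] that by (auto simp: c_def indicator_def)
    qed
    finally show ?thesis unfolding ind .
  qed
  have "c * (\<Sum>j<n. prob {\<omega> \<in> space M. X j \<omega> $ i = 0}) \<le> e 0 - e n"
    by (induction n) (use step in \<open>auto simp: distrib_left intro: order_trans\<close>, smt (verit) step)
  also have "\<dots> \<le> 1" using e(1)[of n] e(2)[of 0] by linarith
  finally show ?thesis using \<open>0 < c\<close> lam by (simp add: c_def field_simps)
qed

lemma boundary_summable: "summable (\<lambda>j. prob (boundary j))"
proof (rule summable_comparison_test')
  have zero_event: "{\<omega> \<in> space M. X j \<omega> $ i = 0} \<in> events" for i j
    using measurable_sets[OF X_measurable[of j], of "{v. v $ i = 0}"] by (simp add: vimage_def Int_def conj_commute)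
  show "summable (\<lambda>j. \<Sum>i\<in>UNIV. prob {\<omega> \<in> space M. X j \<omega> $ i = 0})"
  proof (rule summable_sum)
    fix i :: 'd
    show "summable (\<lambda>j. prob {\<omega> \<in> space M. X j \<omega> $ i = 0})"
    proof (rule bounded_imp_summable)
      show "(\<Sum>j\<le>n. prob {\<omega> \<in> space M. X j \<omega> $ i = 0}) \<le> real CARD('d) / (1 - lam)" for n
        using coordinate_zero_sum[where n = "Suc n" and i = i] by (simp only: lessThan_Suc_atMost)
    qed simp
  qed
  show "norm (prob (boundary j)) \<le> (\<Sum>i\<in>UNIV. prob {\<omega> \<in> space M. X j \<omega> $ i = 0})" for j
  proof -
    have "boundary j = (\<Union>i. {\<omega> \<in> space M. X j \<omega> $ i = 0})" by (auto simp: boundary_def)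
    moreover have "prob (\<Union>i. {\<omega> \<in> space M. X j \<omega> $ i = 0}) \<le> (\<Sum>i\<in>UNIV. prob {\<omega> \<in> space M. X j \<omega> $ i = 0})"
      by (rule finite_measure_subadditive_finite) (use zero_event in auto)
    ultimately show ?thesis by simp
  qed
qed

lemma noise_bounded: "norm (noise j \<omega>) \<le> 2"
proof (cases "X (Suc j) \<omega> \<in> neighbours (X j \<omega>)")
  case True
  have "norm ((abs_vec (X (Suc j) \<omega>) - abs_vec (X j \<omega>)) - mean_step lam (X j \<omega>)) \<le> 2"
    using norm_abs_vec_step[OF True] norm_mean_step[OF lam, of "X j \<omega>"] norm_triangle_ineq4[of "abs_vec (X (Suc j) \<omega>) - abs_vec (X j \<omega>)" "mean_step lam (X j \<omega>)"]
    by linarith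
  with True show ?thesis by (simp add: noise_def)
qed (simp add: noise_def)

text \<open>
  The centred step of the absolute values. It is set to zero on the null event that the walk jumps to a
  vertex that is not a neighbour, so that the bound on the increments holds everywhere.
\<close>

sublocale noise: bounded_martingale_differences M filt noise 2 boundary "asymptotic_variance lam"
proof
  fix j :: nat
  show "subalgebra M (filt j)" by (rule filt_subalgebra)
  show "subalgebra (filt (Suc j)) (filt j)" by (rule filt_mono)
  define f where "f p = (if last p \<in> neighbours (last (butlast p))
     then abs_vec (last p) - abs_vec (last (butlast p)) - mean_step lam (last (butlast p)) else 0)" for p :: "(int ^ 'd) list"
  have "noise j = (\<lambda>\<omega>. f (hist (Suc j) \<omega>))"
    by (auto simp: f_def noise_def hist_Suc fun_eq_iff)
  then show "noise j \<in> borel_measurable (filt (Suc j))"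
    using filt_hist_borel[of f "Suc j"] by simp
  show "norm (noise j \<omega>) \<le> 2" for \<omega> by (rule noise_bounded)
  show "boundary j \<in> sets (filt j)" by (rule boundary_filt)
  show "summable (\<lambda>j. prob (boundary j))" by (rule boundary_summable)
  show "(\<integral>\<omega>. g \<omega> \<bullet> noise j \<omega> \<partial>M) = 0" if g: "g \<in> borel_measurable (filt j)" for g
  proof -
    obtain G where G: "\<And>\<omega>. \<omega> \<in> space M \<Longrightarrow> g \<omega> = G (hist j \<omega>)" using filt_factor[OF g] by blast
    define K where "K p u = (if u \<in> neighbours (last p) then G p \<bullet> (abs_vec u - abs_vec (last p) - mean_step lam (last p)) else 0)" for p u
    have "(\<integral>\<omega>. g \<omega> \<bullet> noise j \<omega> \<partial>M) = (\<integral>\<omega>. K (hist j \<omega>) (X (Suc j) \<omega>) \<partial>M)"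
      by (rule Bochner_Integration.integral_cong) (auto simp: K_def noise_def G)
    also have "\<dots> = (\<integral>\<omega>. (\<Sum>u\<in>neighbours (X j \<omega>). rw_prob lam (X j \<omega>) u * K (hist j \<omega>) u) \<partial>M)"
      by (rule expectation_step)
    also have "\<dots> = (\<integral>\<omega>. 0 \<partial>M)"
    proof (rule Bochner_Integration.integral_cong[OF refl])
      fix \<omega>
      have "(\<Sum>u\<in>neighbours (X j \<omega>). rw_prob lam (X j \<omega>) u * K (hist j \<omega>) u)
         = (\<Sum>u\<in>neighbours (X j \<omega>). G (hist j \<omega>) \<bullet> (rw_prob lam (X j \<omega>) u *\<^sub>R (abs_vec u - abs_vec (X j \<omega>)) - rw_prob lam (X j \<omega>) u *\<^sub>R mean_step lam (X j \<omega>)))"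
        by (intro sum.cong) (simp_all add: K_def inner_diff_right algebra_simps)
      also have "\<dots> = G (hist j \<omega>) \<bullet> (mean_step lam (X j \<omega>) - (\<Sum>u\<in>neighbours (X j \<omega>). rw_prob lam (X j \<omega>) u) *\<^sub>R mean_step lam (X j \<omega>))"
        by (simp add: mean_step_def sum_subtractf scaleR_sum_left flip: inner_sum_right)
      finally show "(\<Sum>u\<in>neighbours (X j \<omega>). rw_prob lam (X j \<omega>) u * K (hist j \<omega>) u) = 0"
        by (simp add: rw_prob_sum[OF lam])
    qed
    finally show ?thesis by simp
  qed
  show "(\<integral>\<omega>. h \<omega> * (\<theta> \<bullet> noise j \<omega>)\<^sup>2 \<partial>M) = asymptotic_variance lam \<theta> * (\<integral>\<omega>. h \<omega> \<partial>M)"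
    if h: "h \<in> borel_measurable (filt j)" and h0: "\<And>\<omega>. \<omega> \<in> boundary j \<Longrightarrow> h \<omega> = 0" for h \<theta>
  proof -
    obtain G where G: "\<And>\<omega>. \<omega> \<in> space M \<Longrightarrow> h \<omega> = G (hist j \<omega>)" using filt_factor[OF h] by blast
    define K where "K p u = (if u \<in> neighbours (last p) then G p * (\<theta> \<bullet> (abs_vec u - abs_vec (last p) - mean_step lam (last p)))\<^sup>2 else 0)" for p u
    have "(\<integral>\<omega>. h \<omega> * (\<theta> \<bullet> noise j \<omega>)\<^sup>2 \<partial>M) = (\<integral>\<omega>. K (hist j \<omega>) (X (Suc j) \<omega>) \<partial>M)"
      by (rule Bochner_Integration.integral_cong) (auto simp: K_def noise_def G)
    also have "\<dots> = (\<integral>\<omega>. (\<Sum>u\<in>neighbours (X j \<omega>). rw_prob lam (X j \<omega>) u * K (hist j \<omega>) u) \<partial>M)"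
      by (rule expectation_step)
    also have "\<dots> = (\<integral>\<omega>. asymptotic_variance lam \<theta> * h \<omega> \<partial>M)"
    proof (rule Bochner_Integration.integral_cong[OF refl])
      fix \<omega> assume \<omega>: "\<omega> \<in> space M"
      have "(\<Sum>u\<in>neighbours (X j \<omega>). rw_prob lam (X j \<omega>) u * K (hist j \<omega>) u)
         = h \<omega> * (\<Sum>u\<in>neighbours (X j \<omega>). rw_prob lam (X j \<omega>) u * (\<theta> \<bullet> (abs_vec u - abs_vec (X j \<omega>) - mean_step lam (X j \<omega>)))\<^sup>2)"
        unfolding sum_distrib_left by (intro sum.cong) (simp_all add: K_def G[OF \<omega>])
      also have "\<dots> = asymptotic_variance lam \<theta> * h \<omega>"
      proof (cases "\<omega> \<in> boundary j")
        case True
        then show ?thesis by (simp add: h0)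
      next
        case False
        then have "X j \<omega> $ i \<noteq> 0" for i using \<omega> by (auto simp: boundary_def)
        then show ?thesis by (simp add: variance_interior[OF lam(1)])
      qed
      finally show "(\<Sum>u\<in>neighbours (X j \<omega>). rw_prob lam (X j \<omega>) u * K (hist j \<omega>) u) = asymptotic_variance lam \<theta> * h \<omega>" .
    qed
    finally show ?thesis by simp
  qed
  show "0 \<le> asymptotic_variance lam \<theta>" for \<theta> by (rule asymptotic_variance_nonneg[OF lam])
qed

text \<open>
  Off the hyperplanes the mean step is exactly the limiting drift, so only boundary times contribute to
  the difference.
\<close>

lemma abs_vec_near_martingale:
  "AE \<omega> in M. \<forall>k. norm (abs_vec (X k \<omega>) - noise.S k \<omega> - real k *\<^sub>R drift lam)
     \<le> norm (abs_vec x) + (1 + norm (drift lam :: real ^ 'd)) * (\<Sum>l<k. indicator (boundary l) \<omega>)"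
  using X_start AE_neighbour AE_space
proof eventually_elim
  case (elim \<omega>)
  have eq: "abs_vec (X k \<omega>) - noise.S k \<omega> - real k *\<^sub>R drift lam = abs_vec x + (\<Sum>l<k. mean_step lam (X l \<omega>) - drift lam)" for k
  proof (induction k)
    case 0
    show ?case using elim(1) by (simp add: noise.S_def)
  next
    case (Suc k)
    have "abs_vec (X (Suc k) \<omega>) = abs_vec (X k \<omega>) + noise k \<omega> + mean_step lam (X k \<omega>)"
      using elim(2) by (simp add: noise_def)
    with Suc show ?case by (simp add: noise.S_def algebra_simps)
  qed
  have term_le: "norm (mean_step lam (X l \<omega>) - drift lam) \<le> (1 + norm (drift lam :: real ^ 'd)) * indicator (boundary l) \<omega>" for l
  proof (cases "\<omega> \<in> boundary l")
    case True
    then show ?thesis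
      using norm_triangle_ineq4[of "mean_step lam (X l \<omega>)" "drift lam"] norm_mean_step[OF lam, of "X l \<omega>"] by simp
  next
    case False
    then have "X l \<omega> $ i \<noteq> 0" for i using elim(3) by (auto simp: boundary_def)
    then show ?thesis by (simp add: mean_step_interior[OF lam(1)])
  qed
  show ?case
  proof
    fix k
    have "norm (\<Sum>l<k. mean_step lam (X l \<omega>) - drift lam) \<le> (\<Sum>l<k. (1 + norm (drift lam :: real ^ 'd)) * indicator (boundary l) \<omega>)"
      by (rule sum_norm_le) (rule term_le)
    then show "norm (abs_vec (X k \<omega>) - noise.S k \<omega> - real k *\<^sub>R drift lam)
     \<le> norm (abs_vec x) + (1 + norm (drift lam :: real ^ 'd)) * (\<Sum>l<k. indicator (boundary l) \<omega>)"
      unfolding eq sum_distrib_left[symmetric] using norm_triangle_ineq[of "abs_vec x" "\<Sum>l<k. mean_step lam (X l \<omega>) - drift lam"] by linarith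
  qed
qed

end

section \<open>The Gaussian limit\<close>

text \<open>
  A normal law with positive variance is the image of the standard one under scaling.
\<close>

lemma char_normal_law:
  assumes "0 \<le> s"
  shows "char (normal_law s) t = complex_of_real (exp (- (s * t\<^sup>2 / 2)))"
proof (cases "s = 0")
  case True
  then show ?thesis by (simp add: normal_law_def char_def integral_return)
next
  case False
  with assms have s: "0 < s" by simp
  interpret std: prob_space std_normal_distribution
    by (rule prob_space_normal_density) simp
  have "distributed std_normal_distribution lborel (\<lambda>y. y) std_normal_density"
    unfolding distributed_def by (simp add: distr_id2)
  from std.normal_density_affine[OF this, of "sqrt s" 0] s
  have "distributed std_normal_distribution lborel (\<lambda>y. sqrt s * y) (normal_density 0 (sqrt s))"
    by simp
  then have "distr std_normal_distribution lborel (\<lambda>y. sqrt s * y) = density lborel (normal_density 0 (sqrt s))"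
    by (rule distributed_distr_eq_density)
  then have eq: "normal_law s = distr std_normal_distribution borel (\<lambda>y. sqrt s * y)"
    using s by (simp add: normal_law_def cong: distr_cong)
  have "char (normal_law s) t = char std_normal_distribution (t * sqrt s)"
    unfolding eq char_def by (subst integral_distr) (auto simp: mult.assoc)
  then show ?thesis using s by (simp add: char_std_normal_distribution power_mult_distrib mult.commute)
qed

lemma real_distribution_normal_law:
  assumes "0 \<le> s" shows "real_distribution (normal_law s)"
proof (cases "s = 0")
  case True
  then show ?thesis
    by (auto simp: normal_law_def real_distribution_def real_distribution_axioms_def intro: prob_space_return)
next
  case False
  then show ?thesis using assms prob_space_normal_density[of "sqrt s" 0]
    by (auto simp: normal_law_def real_distribution_def real_distribution_axioms_def)
qed

lemma (in prob_space) expectation_cos_eq_char: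
  assumes [measurable]: "Y \<in> borel_measurable M"
  shows "(\<integral>\<omega>. cos (\<phi> + Y \<omega>) \<partial>M) = Re (cis \<phi> * char (distr M borel Y) 1)"
proof -
  have int: "integrable M (\<lambda>\<omega>. cis \<phi> * iexp (Y \<omega>))"
    by (rule integrable_const_bound[of _ 1]) (auto simp: norm_mult)
  have "Re (cis \<phi> * char (distr M borel Y) 1) = Re (\<integral>\<omega>. cis \<phi> * iexp (Y \<omega>) \<partial>M)"
    unfolding char_def by (subst integral_distr) auto
  also have "\<dots> = (\<integral>\<omega>. Re (cis \<phi> * iexp (Y \<omega>)) \<partial>M)"
    using int by (rule integral_Re[symmetric])
  also have "\<dots> = (\<integral>\<omega>. cos (\<phi> + Y \<omega>) \<partial>M)"
    by (intro Bochner_Integration.integral_cong refl) (simp add: cis_conv_exp[symmetric] cos_add)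
  finally show ?thesis ..
qed

text \<open>
  The matrix that is applied to Brownian motion, in terms of \<open>lam\<close>.
\<close>

definition limit_map :: "real \<Rightarrow> real ^ 'd \<Rightarrow> real ^ 'd" where
  "limit_map lam w = (1 / sqrt (real CARD('d))) *\<^sub>R
     ((mat 1 - ((1 - 2 * sqrt lam / (1 + lam)) / real CARD('d)) *\<^sub>R (\<chi> i j. 1)) *v w)"

lemma limit_map_eq:
  fixes w :: "real ^ 'd"
  shows "limit_map lam w = (1 / sqrt (real CARD('d))) *\<^sub>R
    (w - (((1 - 2 * sqrt lam / (1 + lam)) / real CARD('d)) * (\<Sum>j\<in>UNIV. w $ j)) *\<^sub>R (\<chi> i. 1))"
proof -
  have "((\<chi> i j. 1) :: real ^ 'd ^ 'd) *v w = (\<Sum>j\<in>UNIV. w $ j) *\<^sub>R (\<chi> i. 1)"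
    by (simp add: vec_eq_iff matrix_vector_mult_def)
  then show ?thesis
    unfolding limit_map_def
    by (simp add: matrix_vector_mult_diff_rdistrib scaleR_matrix_vector_assoc[symmetric])
qed

lemma inner_one_vec: "u \<bullet> (\<chi> i. 1) = (\<Sum>j\<in>UNIV. u $ j)" for u :: "real ^ 'd"
  by (simp add: inner_vec_def)

lemma limit_map_adjoint: "u \<bullet> limit_map lam w = limit_map lam u \<bullet> w"
  for u w :: "real ^ 'd"
  unfolding limit_map_eq
  by (simp add: inner_diff_left inner_diff_right inner_one_vec inner_commute[of "\<chi> i. 1"] algebra_simps)

lemma linear_limit_map: "linear (limit_map lam)"
  unfolding limit_map_def
  by (intro linear_compose_scale_right matrix_vector_mul_linear)

text \<open>
  The matrix is symmetric and its square is \<open>\<Sigma>\<close>, because \<open>1 - \<rho>\<^sup>2 = ((1 - lam) / (1 + lam))\<^sup>2\<close>.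
\<close>

lemma norm_limit_map:
  fixes u :: "real ^ 'd"
  assumes lam: "0 \<le> lam"
  shows "limit_map lam u \<bullet> limit_map lam u = asymptotic_variance lam u"
proof -
  define n where "n = real CARD('d)"
  define r where "r = 2 * sqrt lam / (1 + lam)"
  define s where "s = (\<Sum>j\<in>UNIV. u $ j)"
  have n: "0 < n" by (simp add: n_def)
  have r2: "1 - r\<^sup>2 = ((1 - lam) / (1 + lam))\<^sup>2"
    using lam by (simp add: r_def power_divide power_mult_distrib divide_simps) (simp add: power2_eq_square algebra_simps)
  have one: "((\<chi> i. 1) :: real ^ 'd) \<bullet> (\<chi> i. 1) = n" by (simp add: inner_one_vec n_def)
  have expand: "(k *\<^sub>R (u - a *\<^sub>R e)) \<bullet> (k *\<^sub>R (u - a *\<^sub>R e)) = k\<^sup>2 * ((u \<bullet> u) - 2 * a * (u \<bullet> e) + a\<^sup>2 * (e \<bullet> e))" for k a e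
    by (simp add: inner_diff_left inner_diff_right inner_commute[of e u] power2_eq_square algebra_simps)
  have "limit_map lam u \<bullet> limit_map lam u = (1 / sqrt n)\<^sup>2 * ((u \<bullet> u) - 2 * ((1 - r) / n * s) * s + ((1 - r) / n * s)\<^sup>2 * n)"
    unfolding limit_map_eq n_def[symmetric] r_def[symmetric] s_def[symmetric] expand one
    by (simp add: inner_one_vec s_def[symmetric])
  also have "(1 / sqrt n)\<^sup>2 = 1 / n" using n by (simp add: power_divide)
  also have "1 / n * ((u \<bullet> u) - 2 * ((1 - r) / n * s) * s + ((1 - r) / n * s)\<^sup>2 * n) = (u \<bullet> u) / n - (1 - r\<^sup>2) * (s / n)\<^sup>2"
    using n by (simp add: power2_eq_square divide_simps) (simp add: algebra_simps)
  also have "(1 - r\<^sup>2) * (s / n)\<^sup>2 = (u \<bullet> drift lam)\<^sup>2"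
    unfolding r2 inner_drift n_def[symmetric] s_def[symmetric] by (simp add: power_mult_distrib power_divide mult.commute)
  finally show ?thesis by (simp add: asymptotic_variance_def n_def)
qed

lemma limit_map_borel [measurable]: "limit_map lam \<in> borel_measurable borel"
  by (intro borel_measurable_continuous_onI linear_continuous_on linear_conv_bounded_linear[THEN iffD1] linear_limit_map)

text \<open>
  Moving the matrix to the other side of the inner product turns each summand into a linear
  functional of a Brownian increment, with a known normal law; independence multiplies the
  characteristic functions.
\<close>

lemma brownian_increments_cos:
  fixes W :: "real \<Rightarrow> 'w \<Rightarrow> real ^ 'd"
  assumes lam: "0 \<le> lam" "lam < 1" and W: "brownian_motion N W" and m: "0 < m"
  shows "(\<integral>\<omega>. cos (\<phi> + (\<Sum>i<k. \<theta> i \<bullet> (limit_map lam (W (real (Suc i) / real m) \<omega>) - limit_map lam (W (real i / real m) \<omega>)))) \<partial>N)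
    = cos \<phi> * exp (- ((\<Sum>i<k. asymptotic_variance lam (\<theta> i)) / (2 * real m)))"
proof -
  interpret N: prob_space N using W by (simp add: brownian_motion_def)
  define t where "t i = real i / real m" for i :: nat
  define \<Delta> where "\<Delta> i \<omega> = W (t (Suc i)) \<omega> - W (t i) \<omega>" for i \<omega>
  define Y where "Y i \<omega> = limit_map lam (\<theta> i) \<bullet> \<Delta> i \<omega>" for i \<omega>
  have Wm: "W (t i) \<in> borel_measurable N" for i
    using W by (simp add: brownian_motion_def t_def)
  then have [measurable]: "\<Delta> i \<in> borel_measurable N" for i unfolding \<Delta>_def by measurable
  have [measurable]: "Y i \<in> borel_measurable N" for i unfolding Y_def by measurable
  have "0 \<le> t 0 \<and> mono t" by (auto simp: t_def mono_def divide_right_mono)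
  then have "N.indep_vars (\<lambda>_. borel) \<Delta> {..<k}"
    using W unfolding brownian_motion_def \<Delta>_def by blast
  then have ind: "N.indep_vars (\<lambda>_. borel) Y {..<k}"
    unfolding Y_def by (rule N.indep_vars_compose2) measurable
  have law: "char (distr N borel (Y i)) 1 = complex_of_real (exp (- (asymptotic_variance lam (\<theta> i) / (2 * real m))))" for i
  proof -
    have tt: "0 \<le> t i \<and> t i < t (Suc i)" "t (Suc i) - t i = 1 / real m"
      using m by (auto simp: t_def divide_strict_right_mono diff_divide_distrib[symmetric])
    then have "centred_gaussian (mat (1 / real m)) (distr N borel (\<Delta> i))"
      using W unfolding brownian_motion_def \<Delta>_def by metis
    then have "distr (distr N borel (\<Delta> i)) borel (\<lambda>y. limit_map lam (\<theta> i) \<bullet> y)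
        = normal_law (limit_map lam (\<theta> i) \<bullet> (mat (1 / real m) *v limit_map lam (\<theta> i)))"
      unfolding centred_gaussian_def by blast
    moreover have "mat (1 / real m) *v w = (1 / real m) *\<^sub>R w" for w :: "real ^ 'd"
      by (simp add: vec_eq_iff matrix_vector_mult_def mat_def if_distrib[where f = "\<lambda>z. z * _"] cong: if_cong)
    moreover have "distr (distr N borel (\<Delta> i)) borel (\<lambda>y. limit_map lam (\<theta> i) \<bullet> y) = distr N borel (Y i)"
      by (subst distr_distr) (auto simp: Y_def[abs_def] o_def)
    ultimately have "distr N borel (Y i) = normal_law (asymptotic_variance lam (\<theta> i) / real m)"
      by (simp add: norm_limit_map[OF lam(1)])
    then show ?thesis
      using asymptotic_variance_nonneg[OF lam, of "\<theta> i"] by (simp add: char_normal_law)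
  qed
  have "char (distr N borel (\<lambda>\<omega>. \<Sum>i<k. Y i \<omega>)) 1 = (\<Prod>i<k. char (distr N borel (Y i)) 1)"
    by (rule N.char_distr_sum[OF ind])
  also have "\<dots> = complex_of_real (exp (- ((\<Sum>i<k. asymptotic_variance lam (\<theta> i)) / (2 * real m))))"
    by (simp add: law exp_sum[symmetric] sum_negf sum_divide_distrib flip: of_real_prod)
  finally have ch: "char (distr N borel (\<lambda>\<omega>. \<Sum>i<k. Y i \<omega>)) 1 = complex_of_real (exp (- ((\<Sum>i<k. asymptotic_variance lam (\<theta> i)) / (2 * real m))))" .
  have "(\<integral>\<omega>. cos (\<phi> + (\<Sum>i<k. \<theta> i \<bullet> (limit_map lam (W (real (Suc i) / real m) \<omega>) - limit_map lam (W (real i / real m) \<omega>)))) \<partial>N)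
     = (\<integral>\<omega>. cos (\<phi> + (\<Sum>i<k. Y i \<omega>)) \<partial>N)"
    by (simp add: Y_def \<Delta>_def t_def limit_map_adjoint[symmetric] linear_diff[OF linear_limit_map] del: of_nat_Suc)
  also have "\<dots> = Re (cis \<phi> * char (distr N borel (\<lambda>\<omega>. \<Sum>i<k. Y i \<omega>)) 1)"
    by (rule N.expectation_cos_eq_char) measurable
  also have "\<dots> = cos \<phi> * exp (- ((\<Sum>i<k. asymptotic_variance lam (\<theta> i)) / (2 * real m)))"
    unfolding ch by simp
  finally show ?thesis .
qed

text \<open>
  The limiting Gaussian law, constructed from independent standard normal variables because there
  need not be a Brownian motion at hand.
\<close>

definition limit_law :: "real \<Rightarrow> (real ^ 'd) measure" where
  "limit_law lam = distr (\<Pi>\<^sub>M i\<in>(UNIV :: 'd set). std_normal_distribution) borel (\<lambda>y. limit_map lam (\<chi> i. y i))"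

text \<open>
  The characteristic function of a linear functional factorises over the coordinates, and a law on the line
  is determined by its characteristic function.
\<close>

lemma limit_law_marginal:
  fixes u :: "real ^ 'd"
  assumes lam: "0 \<le> lam" "lam < 1"
  shows "prob_space (limit_law lam :: (real ^ 'd) measure)"
    and "distr (limit_law lam) borel (\<lambda>w. u \<bullet> w) = normal_law (asymptotic_variance lam u)"
proof -
  let ?P = "\<Pi>\<^sub>M i\<in>(UNIV :: 'd set). std_normal_distribution"
  interpret std: prob_space std_normal_distribution by (rule prob_space_normal_density) simp
  interpret product_prob_space "\<lambda>_ :: 'd. std_normal_distribution" UNIV by unfold_locales
  have vm [measurable]: "(\<lambda>y. \<chi> i. y i) \<in> borel_measurable ?P"
  proof (subst borel_measurable_euclidean_space, intro ballI)
    fix b :: "real ^ 'd" assume "b \<in> Basis"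
    then obtain i where b: "b = axis i 1" by (auto simp: Basis_vec_def)
    have "(\<lambda>y. y i) \<in> measurable ?P std_normal_distribution" by (rule measurable_component_singleton) simp
    then show "(\<lambda>y. (\<chi> i. y i) \<bullet> b) \<in> borel_measurable ?P" by (simp add: b inner_axis)
  qed
  have lm [measurable]: "(\<lambda>y. limit_map lam (\<chi> i. y i)) \<in> borel_measurable ?P" by measurable
  show ps: "prob_space (limit_law lam :: (real ^ 'd) measure)"
    unfolding limit_law_def by (rule prob_space_distr[OF lm])
  define c where "c = limit_map lam u"
  have cm [measurable]: "(\<lambda>y. c \<bullet> (\<chi> i. y i)) \<in> borel_measurable ?P" by measurable
  have eq: "distr (limit_law lam) borel (\<lambda>w. u \<bullet> w) = distr ?P borel (\<lambda>y. c \<bullet> (\<chi> i. y i))"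
    unfolding limit_law_def by (subst distr_distr) (auto simp: o_def limit_map_adjoint c_def)
  show "distr (limit_law lam) borel (\<lambda>w. u \<bullet> w) = normal_law (asymptotic_variance lam u)"
    unfolding eq
  proof (rule Levy_uniqueness)
    show "real_distribution (distr ?P borel (\<lambda>y. c \<bullet> (\<chi> i. y i)))"
      using prob_space_distr[OF cm] by (simp add: real_distribution_def real_distribution_axioms_def)
    show "real_distribution (normal_law (asymptotic_variance lam u))"
      by (rule real_distribution_normal_law[OF asymptotic_variance_nonneg[OF lam]])
    show "char (distr ?P borel (\<lambda>y. c \<bullet> (\<chi> i. y i))) = char (normal_law (asymptotic_variance lam u))"
    proof
      fix t
      have "char (distr ?P borel (\<lambda>y. c \<bullet> (\<chi> i. y i))) t = (\<integral>y. iexp (t * (c \<bullet> (\<chi> i. y i))) \<partial>?P)"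
        unfolding char_def by (subst integral_distr) auto
      also have "\<dots> = (\<integral>y. (\<Prod>i\<in>UNIV. iexp ((t * c $ i) * y i)) \<partial>?P)"
        by (intro Bochner_Integration.integral_cong refl)
           (simp add: inner_vec_def exp_sum[symmetric] sum_distrib_left mult.assoc)
      also have "\<dots> = (\<Prod>i\<in>UNIV. (\<integral>z. iexp ((t * c $ i) * z) \<partial>std_normal_distribution))"
        by (rule product_integral_prod) (auto intro!: std.integrable_const_bound[of _ 1])
      also have "\<dots> = (\<Prod>i\<in>UNIV. complex_of_real (exp (- ((t * c $ i)\<^sup>2) / 2)))"
        unfolding char_def[symmetric] char_std_normal_distribution ..
      also have "\<dots> = complex_of_real (exp (- (c \<bullet> c * t\<^sup>2 / 2)))"
      proof -
        have "(\<Sum>i\<in>UNIV. - ((t * c $ i)\<^sup>2) / 2) = - (c \<bullet> c * t\<^sup>2 / 2)"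
          unfolding inner_vec_def sum_distrib_right sum_divide_distrib sum_negf[symmetric]
          by (intro sum.cong refl) (simp add: power2_eq_square)
        then show ?thesis by (simp add: exp_sum[symmetric] flip: of_real_prod)
      qed
      also have "\<dots> = char (normal_law (asymptotic_variance lam u)) t"
        unfolding c_def norm_limit_map[OF lam(1)] by (rule char_normal_law[OF asymptotic_variance_nonneg[OF lam], symmetric])
      finally show "char (distr ?P borel (\<lambda>y. c \<bullet> (\<chi> i. y i))) t = char (normal_law (asymptotic_variance lam u)) t" .
    qed
  qed
qed

lemma sets_limit_law [measurable_cong]: "sets (limit_law lam) = sets borel"
  by (simp add: limit_law_def)

lemma limit_law_cos:
  fixes \<theta> :: "real ^ 'd"
  assumes lam: "0 \<le> lam" "lam < 1"
  shows "(\<integral>w. cos (\<phi> + \<theta> \<bullet> w) \<partial>limit_law lam) = cos \<phi> * exp (- (asymptotic_variance lam \<theta> / 2))"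
proof -
  interpret prob_space "limit_law lam :: (real ^ 'd) measure" by (rule limit_law_marginal[OF lam])
  have "(\<lambda>w. \<theta> \<bullet> w) \<in> borel_measurable (limit_law lam)" by measurable
  from expectation_cos_eq_char[OF this, of \<phi>] show ?thesis
    unfolding limit_law_marginal(2)[OF lam] char_normal_law[OF asymptotic_variance_nonneg[OF lam]] by simp
qed

section \<open>The invariance principle\<close>

lemma quadratic_form_covariance:
  fixes u :: "real ^ 'd" and \<Sigma> :: "real ^ 'd ^ 'd"
  assumes d: "d = real CARD('d)" and lam: "0 \<le> lam"
    and Sigma: "\<Sigma> = (\<chi> i j. if i = j then 1 / d - (1 - lam)\<^sup>2 / (d\<^sup>2 * (1 + lam)\<^sup>2)
                                    else - ((1 - lam)\<^sup>2 / (d\<^sup>2 * (1 + lam)\<^sup>2)))"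
  shows "u \<bullet> (\<Sigma> *v u) = asymptotic_variance lam u"
proof -
  define c where "c = (1 - lam) / (d * (1 + lam))"
  have c2: "(1 - lam)\<^sup>2 / (d\<^sup>2 * (1 + lam)\<^sup>2) = c\<^sup>2" by (simp add: c_def power_divide power_mult_distrib)
  have comp: "(\<Sigma> *v u) $ i = u $ i / d - c\<^sup>2 * (\<Sum>j\<in>UNIV. u $ j)" for i
  proof -
    have "(\<Sigma> *v u) $ i = (\<Sum>j\<in>UNIV. (if i = j then u $ j / d else 0) - c\<^sup>2 * u $ j)"
      unfolding matrix_vector_mult_def Sigma c2 by (simp, intro sum.cong) (auto simp: algebra_simps)
    then show ?thesis by (simp add: sum_subtractf sum_distrib_left)
  qed
  have "u \<bullet> (\<Sigma> *v u) = (\<Sum>i\<in>UNIV. u $ i * u $ i / d - c\<^sup>2 * (\<Sum>j\<in>UNIV. u $ j) * u $ i)"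
    unfolding inner_vec_def comp by (intro sum.cong refl) (simp add: algebra_simps)
  also have "\<dots> = (u \<bullet> u) / d - c\<^sup>2 * (\<Sum>j\<in>UNIV. u $ j) * (\<Sum>j\<in>UNIV. u $ j)"
    by (simp add: sum_subtractf inner_vec_def sum_divide_distrib sum_distrib_left)
  finally show ?thesis
    by (simp add: asymptotic_variance_def inner_drift d[symmetric] c_def[symmetric] power2_eq_square mult_ac)
qed

lemma borel_of_euclidean: "sets (borel_of euclidean) = sets borel"
  by (simp add: borel_of_def borel_def)

theorem theorem2p1:
  fixes lam \<rho> d :: real
    and x :: "int ^ 'd"
    and M :: "'a measure"
    and X :: "nat \<Rightarrow> 'a \<Rightarrow> int ^ 'd"
    and v :: "real ^ 'd"
    and E \<Sigma> :: "real ^ 'd ^ 'd"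
  assumes lam_range: "0 \<le> lam" "lam < 1"
    and walk: "biased_random_walk lam x M X"
    and d: "d = real CARD('d)"
    and v: "v = (\<chi> i. (1 - lam) / (d * (1 + lam)))"
    and rho: "\<rho> = 2 * sqrt lam / (1 + lam)"
    and E: "E = (\<chi> i j. 1)"
    and Sigma: "\<Sigma> = (\<chi> i j. if i = j then 1 / d - (1 - lam)\<^sup>2 / (d\<^sup>2 * (1 + lam)\<^sup>2)
                                    else - ((1 - lam)\<^sup>2 / (d\<^sup>2 * (1 + lam)\<^sup>2)))"
  shows "(\<forall>(N :: 'w measure) (W :: real \<Rightarrow> 'w \<Rightarrow> real ^ 'd). brownian_motion N W \<longrightarrow>
            converges_in_distribution skorohod_topology
              M (\<lambda>n \<omega>. \<lambda>t\<in>{0..}. (abs_vec (X (nat \<lfloor>real n * t\<rfloor>) \<omega>) - (real n * t) *\<^sub>R v) /\<^sub>R sqrt (real n))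
              N (\<lambda>\<omega>. \<lambda>t\<in>{0..}. (1 / sqrt d) *\<^sub>R ((mat 1 - ((1 - \<rho>) / d) *\<^sub>R E) *v W t \<omega>)))
       \<and> (\<exists>G. centred_gaussian \<Sigma> G \<and>
            (\<forall>n. (\<lambda>\<omega>. (abs_vec (X n \<omega>) - real n *\<^sub>R v) /\<^sub>R sqrt (real n)) \<in> borel_measurable M) \<and>
            weakly_converges euclidean
              (\<lambda>n. distr M borel (\<lambda>\<omega>. (abs_vec (X n \<omega>) - real n *\<^sub>R v) /\<^sub>R sqrt (real n))) G)"
proof -
  interpret walk lam x M X by unfold_locales (use lam_range walk in auto)
  have v_eq: "v = drift lam" by (simp add: v drift_def d)
  have Zeq: "(1 / sqrt d) *\<^sub>R ((mat 1 - ((1 - \<rho>) / d) *\<^sub>R E) *v w) = limit_map lam w" for w :: "real ^ 'd"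
    by (simp add: limit_map_def d rho E)
  have Rm [measurable]: "(\<lambda>\<omega>. abs_vec (X k \<omega>)) \<in> borel_measurable M" for k
    by (rule measurable_compose[OF X_measurable]) simp
  have c: "0 \<le> norm (abs_vec x)" "0 \<le> 1 + norm (drift lam :: real ^ 'd)" by simp_all
  have part1: "converges_in_distribution skorohod_topology
              M (\<lambda>n \<omega>. \<lambda>t\<in>{0..}. (abs_vec (X (nat \<lfloor>real n * t\<rfloor>) \<omega>) - (real n * t) *\<^sub>R v) /\<^sub>R sqrt (real n))
              N (\<lambda>\<omega>. \<lambda>t\<in>{0..}. limit_map lam (W t \<omega>))"
    if W: "brownian_motion N W" for N :: "'w measure" and W :: "real \<Rightarrow> 'w \<Rightarrow> real ^ 'd"
  proof (rule converges_in_distribution_skorohodI)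
    show "prob_space M" by unfold_locales
    show N: "prob_space N" using W by (simp add: brownian_motion_def)
    define Z where "Z t \<omega> = limit_map lam (W t \<omega>)" for t \<omega>
    have Wm: "W t \<in> borel_measurable N" if "0 \<le> t" for t using W that by (simp add: brownian_motion_def)
    have Zm: "Z t \<in> borel_measurable N" if "0 \<le> t" for t
      unfolding Z_def by (rule measurable_compose[OF Wm[OF that] limit_map_borel])
    have Z0: "Z 0 \<omega> = 0" if "\<omega> \<in> space N" for \<omega>
      using W that linear_0[OF linear_limit_map] by (simp add: brownian_motion_def Z_def)
    have Zc: "continuous_on {0..} (\<lambda>t. Z t \<omega>)" if "\<omega> \<in> space N" for \<omega>
      unfolding Z_def using W that
      by (intro continuous_on_compose2[OF linear_continuous_on[OF linear_conv_bounded_linear[THEN iffD1, OF linear_limit_map]]])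
         (auto simp: brownian_motion_def)
    show "path_measurable N (\<lambda>\<omega>. \<lambda>t\<in>{0..}. limit_map lam (W t \<omega>))"
      using continuous_process_measurable[OF Zm Zc] by (simp add: Z_def)
    show "path_measurable M (\<lambda>\<omega>. \<lambda>t\<in>{0..}. (abs_vec (X (nat \<lfloor>real n * t\<rfloor>) \<omega>) - (real n * t) *\<^sub>R v) /\<^sub>R sqrt (real n))" for n
    proof -
      have "path_measurable M (\<lambda>\<omega>. \<lambda>t\<in>{0..}. abs_vec (X (nat \<lfloor>real n * t\<rfloor>) \<omega>) /\<^sub>R sqrt (real n) + (- ((real n * t) *\<^sub>R v /\<^sub>R sqrt (real n))))"
        by (rule step_path_measurable[where y = "\<lambda>i \<omega>. abs_vec (X i \<omega>) /\<^sub>R sqrt (real n)"]) (auto intro!: continuous_intros)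
      then show ?thesis by (simp add: scaleR_diff_right)
    qed
    fix L C and \<Phi> :: "(real \<Rightarrow> real ^ 'd) \<Rightarrow> real"
    assume L: "0 \<le> L" and lip: "loc_lip L \<Phi>" and bdd: "\<And>g. \<bar>\<Phi> g\<bar> \<le> C"
    have "(\<lambda>n. \<integral>\<omega>. \<Phi> (\<lambda>t. (abs_vec (X (nat \<lfloor>real n * t\<rfloor>) \<omega>) - (real n * t) *\<^sub>R v) /\<^sub>R sqrt (real n)) \<partial>M)
       \<longlonglongrightarrow> (\<integral>\<omega>. \<Phi> (\<lambda>t. Z t \<omega>) \<partial>N)"
      unfolding v_eq
    proof (rule noise.near_martingale_functional_tendsto[OF N Zm Z0 Zc _ Rm abs_vec_near_martingale c L lip bdd])
      show "(\<integral>\<omega>. cos (\<phi> + (\<Sum>i<k. \<theta> i \<bullet> (Z (real (Suc i) / real m) \<omega> - Z (real i / real m) \<omega>))) \<partial>N)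
        = cos \<phi> * exp (- ((\<Sum>i<k. asymptotic_variance lam (\<theta> i)) / (2 * real m)))" if "0 < m" for m k \<theta> \<phi>
        unfolding Z_def by (rule brownian_increments_cos[OF lam_range W that])
    qed
    moreover have "\<Phi> (\<lambda>t\<in>{0..}. g t) = \<Phi> (\<lambda>t. g t)" for g
      by (rule loc_lip_cong[OF lip]) simp
    ultimately show "(\<lambda>n. \<integral>\<omega>. \<Phi> (\<lambda>t\<in>{0..}. (abs_vec (X (nat \<lfloor>real n * t\<rfloor>) \<omega>) - (real n * t) *\<^sub>R v) /\<^sub>R sqrt (real n)) \<partial>M)
       \<longlonglongrightarrow> (\<integral>\<omega>. \<Phi> (\<lambda>t\<in>{0..}. limit_map lam (W t \<omega>)) \<partial>N)"
      by (simp add: Z_def)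
  qed
  have gauss: "centred_gaussian \<Sigma> (limit_law lam)"
    unfolding centred_gaussian_def
  proof (intro conjI allI)
    show "transpose \<Sigma> = \<Sigma>" by (auto simp: Sigma transpose_def vec_eq_iff)
    fix u
    show "0 \<le> u \<bullet> (\<Sigma> *v u)" "distr (limit_law lam) borel ((\<bullet>) u) = normal_law (u \<bullet> (\<Sigma> *v u))"
      unfolding quadratic_form_covariance[OF d lam_range(1) Sigma]
      using asymptotic_variance_nonneg[OF lam_range] limit_law_marginal(2)[OF lam_range] by auto
  qed (simp_all add: limit_law_marginal(1)[OF lam_range] sets_limit_law)
  have meas: "(\<lambda>\<omega>. (abs_vec (X n \<omega>) - real n *\<^sub>R v) /\<^sub>R sqrt (real n)) \<in> borel_measurable M" for n
    by measurable
  have "weakly_converges euclidean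
              (\<lambda>n. distr M borel (\<lambda>\<omega>. (abs_vec (X n \<omega>) - real n *\<^sub>R v) /\<^sub>R sqrt (real n))) (limit_law lam)"
    unfolding weakly_converges_def
  proof (intro conjI allI impI)
    fix f :: "real ^ 'd \<Rightarrow> real" assume f: "continuous_map euclidean euclideanreal f \<and> bounded (f ` topspace euclidean)"
    then have fc: "continuous_on UNIV f" by simp
    then have fm: "f \<in> borel_measurable borel" by (rule borel_measurable_continuous_onI)
    from f obtain C where C: "\<And>w. \<bar>f w\<bar> \<le> C" unfolding bounded_iff by (auto simp: real_norm_def)
    have "(\<lambda>n. \<integral>\<omega>. f (noise.marginal (\<lambda>k \<omega>. abs_vec (X k \<omega>)) (drift lam) n \<omega>) \<partial>M) \<longlonglongrightarrow> (\<integral>w. f w \<partial>limit_law lam)"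
      by (rule noise.marginal_expectation_tendsto[OF Rm abs_vec_near_martingale c limit_law_marginal(1)[OF lam_range] sets_limit_law limit_law_cos[OF lam_range] fc C])
    then show "(\<lambda>n. integral\<^sup>L (distr M borel (\<lambda>\<omega>. (abs_vec (X n \<omega>) - real n *\<^sub>R v) /\<^sub>R sqrt (real n))) f) \<longlonglongrightarrow> integral\<^sup>L (limit_law lam) f"
      unfolding integral_distr[OF meas fm] unfolding noise.marginal_def[OF Rm abs_vec_near_martingale c] v_eq .
  qed (auto simp: borel_of_euclidean sets_limit_law limit_law_marginal(1)[OF lam_range] intro: prob_space_distr[OF meas])
  with part1 gauss meas show ?thesis unfolding Zeq by blast
qed

end
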